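(* Let $N\geq 2$ and $1\leq k\leq N$, and let $\mathcal{H}(\mathbb{R}^N)$ be the Fréchet space of harmonic functions on $\mathbb{R}^N$. (i) Let $\varphi\colon\mathbb{R}_+\to\mathbb{R}_+$ be any function with $\varphi(r)\to\infty$ as $r\to\infty$. Then there exists a harmonic function $h\in\mathcal{H}(\mathbb{R}^N)$ which is distributionally irregular for the partial differentiation operator $\partial/\partial x_k\colon\mathcal{H}(\mathbb{R}^N)\to\mathcal{H}(\mathbb{R}^N)$ and satisfies $$M_2(h,r)\leq\varphi(r)\frac{e^r}{r^{N/2-3/4}}$$ for all $r>0$ sufficiently large. (ii) There does not exist a function $h\in\mathcal{H}(\mathbb{R}^N)$ which is distributionally irregular for $\partial/\partial x_k$ and for which there is a constant $c>0$ such that $$M_2(h,r)\leq c\,\frac{e^r}{r^{N/2-3/4}}$$ for all $r>0$ sufficiently large.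
   Context: $\mathcal{H}(\mathbb{R}^N)$ is the space of real-valued harmonic functions on $\mathbb{R}^N$ with the topology of local uniform convergence, given by the increasing sequence of seminorms $\|h\|_n=\sup_{\|x\|=n}|h(x)|$, $n\in\mathbb{N}$ ($n \ge 1$); it is a Fréchet space. For $r>0$, $S(r)$ is the Euclidean sphere of radius $r$ centred at the origin of $\mathbb{R}^N$, $\sigma_r$ is the normalised $(N-1)$-dimensional surface measure on $S(r)$ (so $\sigma_r(S(r))=1$), and $M_2(h,r)=\left(\int_{S(r)}|h|^2\,d\sigma_r\right)^{1/2}$. The upper density of $A\subset\mathbb{N}$ is $\overline{\mathrm{dens}}(A)=\limsup_{n\to\infty}\frac{|A\cap\{1,\dots,n\}|}{n}$. Let $X$ be a Fréchet space whose topology is given by an increasing sequence of seminorms $(\|\cdot\|_k)_{k\in\mathbb{N}}$ and $T\colon X\to X$ a continuous linear operator. A vector $x\in X$ is distributionally irregular for $T$ if both: (1) there is $A\subset\mathbb{N}$ with $\overline{\mathrm{dens}}(A)=1$ such that $T^n x\to 0$ as $n\to\infty$ with $n\in A$; and (2) there are $m\in\mathbb{N}$ and $B\subset\mathbb{N}$ with $\overline{\mathrm{dens}}(B)=1$ such that $\|T^n x\|_m\to\infty$ as $n\to\infty$ with $n\in B$. *)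

theory Defs
  imports "HOL-Probability.Probability"
begin

subsection \<open>Harmonic functions on Euclidean space\<close>

definition partial :: "'n::finite \<Rightarrow> (real ^ 'n \<Rightarrow> real) \<Rightarrow> (real ^ 'n \<Rightarrow> real)" where
  "partial k f x = deriv (\<lambda>t::real. f (x + t *\<^sub>R axis k 1)) 0"

definition C1_fun :: "(real ^ 'n::finite \<Rightarrow> real) \<Rightarrow> bool" where
  "C1_fun f \<longleftrightarrow> f differentiable_on UNIV \<and> (\<forall>i. continuous_on UNIV (partial i f))"

definition C2_fun :: "(real ^ 'n::finite \<Rightarrow> real) \<Rightarrow> bool" where
  "C2_fun f \<longleftrightarrow> C1_fun f \<and> (\<forall>i. C1_fun (partial i f))"

definition harmonic_functions :: "(real ^ 'n::finite \<Rightarrow> real) set" where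
  "harmonic_functions = {h. C2_fun h \<and> (\<forall>x. (\<Sum>i\<in>UNIV. partial i (partial i h) x) = 0)}"

definition sphere_seminorm :: "nat \<Rightarrow> (real ^ 'n::finite \<Rightarrow> real) \<Rightarrow> real" where
  "sphere_seminorm n h = (SUP x\<in>sphere 0 (real n). \<bar>h x\<bar>)"

text \<open>Because \<^const>\<open>deriv\<close> is a choice operator, \<^const>\<open>partial\<close> carries information only
  where the derivative exists; the differentiability conditions above guarantee this.\<close>

lemma partial_eq_frechet_derivative:
  fixes f :: "real ^ 'n::finite \<Rightarrow> real"
  assumes "f differentiable (at x)"
  shows "partial k f x = frechet_derivative f (at x) (axis k 1)"
proof -
  let ?F = "frechet_derivative f (at x)"
  have F: "(f has_derivative ?F) (at x)"
    using assms by (simp add: frechet_derivative_works)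
  have G: "((\<lambda>t::real. x + t *\<^sub>R axis k 1) has_derivative (\<lambda>t. t *\<^sub>R axis k 1)) (at 0)"
    by (auto intro!: derivative_eq_intros)
  have "((\<lambda>t::real. f (x + t *\<^sub>R axis k 1)) has_derivative (\<lambda>t. ?F (t *\<^sub>R axis k 1))) (at 0)"
    by (rule has_derivative_compose[OF G]) (use F in simp)
  moreover have "(\<lambda>t. ?F (t *\<^sub>R axis k 1)) = (*) (?F (axis k 1))"
    using has_derivative_bounded_linear[OF F]
    by (auto simp: bounded_linear.linear linear_scale)
  ultimately show ?thesis
    unfolding partial_def by (simp add: DERIV_imp_deriv has_field_derivative_def)
qed

subsection \<open>Surface measure on spheres\<close>

text \<open>The \<open>(N - 1)\<close>-dimensional surface measure of a Borel set \<open>A\<close> in the sphere of radius \<open>r\<close> is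
  \<open>N / r\<close> times the volume of the cone \<open>{t x | 0 < t \<le> 1, x \<in> A}\<close>. That set is the preimage
  of \<open>A\<close> under the radial projection of the punctured ball onto the sphere, so the measure is a
  push-forward of Lebesgue measure; see \<open>emeasure_sphere_surface_measure\<close> below. It is only
  meant for \<open>r > 0\<close>.\<close>

definition sphere_surface_measure :: "real \<Rightarrow> (real ^ 'n::finite) measure" where
  "sphere_surface_measure r =
     scale_measure (ennreal (real CARD('n) / r))
       (distr (restrict_space lborel (cball 0 r - {0})) (restrict_space borel (sphere 0 r))
          (\<lambda>x. (r / norm x) *\<^sub>R x))"

definition normalised_sphere_measure :: "real \<Rightarrow> (real ^ 'n::finite) measure" where
  "normalised_sphere_measure r = uniform_measure (sphere_surface_measure r) (sphere 0 r)"

definition M2 :: "(real ^ 'n::finite \<Rightarrow> real) \<Rightarrow> real \<Rightarrow> real" where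
  "M2 h r = sqrt (LINT x|normalised_sphere_measure r. \<bar>h x\<bar>\<^sup>2)"

lemma space_sphere_surface_measure [simp]: "space (sphere_surface_measure r) = sphere 0 r"
  by (simp add: sphere_surface_measure_def space_scale_measure space_restrict_space)

lemma sets_sphere_surface_measure [simp]:
  "sets (sphere_surface_measure r) = sets (restrict_space borel (sphere 0 r))"
  by (simp add: sphere_surface_measure_def)

lemma emeasure_sphere_surface_measure:
  fixes A :: "(real ^ 'n::finite) set"
  assumes r: "r > 0" and A: "A \<in> sets borel" "A \<subseteq> sphere 0 r"
  shows "emeasure (sphere_surface_measure r) A =
    ennreal (real CARD('n) / r) * emeasure lborel {t *\<^sub>R x |t x. 0 < t \<and> t \<le> 1 \<and> x \<in> A}"
proof -
  let ?B = "cball 0 r - {0} :: (real ^ 'n) set" and ?p = "\<lambda>x::real ^ 'n. (r / norm x) *\<^sub>R x"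
  have B: "?B \<in> sets borel" by auto
  have meas: "?p \<in> measurable (restrict_space lborel ?B) (restrict_space borel (sphere 0 r))"
    using r by (intro measurable_restrict_space2 measurable_restrict_space1) auto
  have "A \<in> sets (restrict_space borel (sphere 0 r))"
    using A by (auto simp: sets_restrict_space_iff)
  then have "emeasure (sphere_surface_measure r) A = ennreal (real CARD('n) / r) *
      emeasure (restrict_space lborel ?B) (?p -` A \<inter> ?B)"
    unfolding sphere_surface_measure_def
    by (simp add: emeasure_distr[OF meas] space_restrict_space)
  also have "emeasure (restrict_space lborel ?B) (?p -` A \<inter> ?B) = emeasure lborel (?p -` A \<inter> ?B)"
    by (rule emeasure_restrict_space) (use B in auto)
  also have "?p -` A \<inter> ?B = {t *\<^sub>R x |t x. 0 < t \<and> t \<le> 1 \<and> x \<in> A}"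
  proof (intro set_eqI iffI)
    fix y assume y: "y \<in> ?p -` A \<inter> ?B"
    with r have "y = (norm y / r) *\<^sub>R ?p y" "0 < norm y / r" "norm y / r \<le> 1" "?p y \<in> A" by auto
    then show "y \<in> {t *\<^sub>R x |t x. 0 < t \<and> t \<le> 1 \<and> x \<in> A}" by blast
  next
    fix y assume "y \<in> {t *\<^sub>R x |t x. 0 < t \<and> t \<le> 1 \<and> x \<in> A}"
    then obtain t x where y: "y = t *\<^sub>R x" "0 < t" "t \<le> 1" "x \<in> A" by blast
    then have n: "norm x = r" using A by auto
    with y r have "?p y = x" "norm y \<le> r" "y \<noteq> 0"
      by (auto simp: mult_left_le_one_le)
    with y show "y \<in> ?p -` A \<inter> ?B" by auto
  qed
  finally show ?thesis .
qed

lemma prob_space_normalised_sphere_measure: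
  assumes r: "r > 0"
  shows "prob_space (normalised_sphere_measure r :: (real ^ 'n::finite) measure)"
proof -
  let ?S = "sphere 0 r :: (real ^ 'n) set"
  have "{t *\<^sub>R x |t x. 0 < t \<and> t \<le> 1 \<and> x \<in> ?S} = cball 0 r - {0}"
  proof (intro set_eqI iffI)
    fix y assume "y \<in> {t *\<^sub>R x |t x. 0 < t \<and> t \<le> 1 \<and> x \<in> ?S}"
    then show "y \<in> cball 0 r - {0}" using r by (auto simp: mult_left_le_one_le)
  next
    fix y :: "real ^ 'n" assume y: "y \<in> cball 0 r - {0}"
    with r have "y = (norm y / r) *\<^sub>R ((r / norm y) *\<^sub>R y)" "0 < norm y / r" "norm y / r \<le> 1"
      "(r / norm y) *\<^sub>R y \<in> ?S" by auto
    then show "y \<in> {t *\<^sub>R x |t x. 0 < t \<and> t \<le> 1 \<and> x \<in> ?S}" by blast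
  qed
  moreover have "emeasure lborel (cball 0 r - {0} :: (real ^ 'n) set) =
      emeasure lborel (cball 0 r :: (real ^ 'n) set)"
    by (rule emeasure_Diff_null_set) auto
  ultimately have S: "emeasure (sphere_surface_measure r) ?S =
      ennreal (real CARD('n) / r) * emeasure lborel (cball 0 r :: (real ^ 'n) set)"
    using emeasure_sphere_surface_measure[OF r, of ?S] by auto
  have "emeasure lborel (cball 0 r :: (real ^ 'n) set) \<noteq> 0"
    using r less_imp_neq[OF unit_ball_vol_pos[of "real CARD('n)"]] by (simp add: emeasure_cball)
  moreover have "emeasure lborel (cball 0 r :: (real ^ 'n) set) \<noteq> \<infinity>"
    using emeasure_lborel_cball_finite[of "0 :: real ^ 'n" r] by simp
  ultimately have "emeasure (sphere_surface_measure r) ?S \<noteq> 0"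
    "emeasure (sphere_surface_measure r) ?S \<noteq> \<infinity>"
    unfolding S using r by (auto simp: ennreal_mult_eq_top_iff)
  then show ?thesis
    unfolding normalised_sphere_measure_def by (rule prob_space_uniform_measure)
qed

subsection \<open>Distributional irregularity\<close>

definition upper_density :: "nat set \<Rightarrow> ereal" where
  "upper_density A = limsup (\<lambda>n. ereal (real (card (A \<inter> {1..n})) / real n))"

text \<open>The topology is the one generated by the seminorms \<open>p k\<close> for \<open>k \<ge> 1\<close>, so that
  convergence to \<open>0\<close> means convergence to \<open>0\<close> in each of them; the limit along
  \<open>n \<in> A\<close> is taken with respect to \<open>inf sequentially (principal A)\<close>.\<close>

definition distributionally_irregular ::
  "(nat \<Rightarrow> 'x \<Rightarrow> real) \<Rightarrow> ('x \<Rightarrow> 'x) \<Rightarrow> 'x \<Rightarrow> bool" where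
  "distributionally_irregular p T x \<longleftrightarrow>
     (\<exists>A. upper_density A = 1 \<and>
        (\<forall>k\<ge>1. ((\<lambda>n. p k ((T ^^ n) x)) \<longlongrightarrow> 0) (inf sequentially (principal A)))) \<and>
     (\<exists>m\<ge>1. \<exists>B. upper_density B = 1 \<and>
        filterlim (\<lambda>n. p m ((T ^^ n) x)) at_top (inf sequentially (principal B)))"

end

theory Submission
  imports Defs
begin

text \<open>Fix an axis \<open>e\<close> with derivative \<open>D\<close> along it, and let \<open>Q\<^sub>n\<close> be the zonal harmonic polynomials
  normalised by \<open>Q\<^sub>n(e) = 1\<close>, so that \<open>D Q\<^sub>n = n Q\<^bsub>n-1\<^esub>\<close>. Integration by parts against the
  weights \<open>(R\<^sup>2 - \<bar>x\<bar>\<^sup>2)\<^sub>+\<^sup>p\<close> trades one degree of \<open>Q\<^sub>n\<close> for one derivative: up to an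
  explicit factor, the weighted integral of \<open>h Q\<^sub>n\<close> is \<open>D\<^sup>n h(0)\<close> for every harmonic \<open>h\<close>. This
  single identity yields orthogonality and norms of the \<open>Q\<^sub>n\<close>, and a Bessel inequality bounding
  \<open>\<Sum> \<bar>D\<^sup>n h(y)\<bar>\<^sup>2 \<beta>\<^sub>n R\<^sup>2\<^sup>n\<close> by the weighted square integral of \<open>h\<close> over the ball of
  radius \<open>R\<close> about \<open>y\<close>.

  Under the growth bound of (ii), multiplying this inequality by an exponential and integrating over
  \<open>R\<close> makes all the weights comparable to \<open>1\<close>. Hence \<open>\<bar>D\<^sup>n h(y)\<bar>\<^sup>2\<close> is bounded on
  average over \<open>n \<le> K\<close>, locally uniformly in \<open>y\<close>, so the iterates cannot tend to infinity along
  a set of upper density one.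

  For (i) take \<open>h = \<Sum> a\<^sub>n Q\<^sub>n / n!\<close>, on which \<open>D\<close> acts as a shift of the coefficients, with
  \<open>a\<^sub>n\<close> vanishing on and slowly increasing off long blocks of indices. By orthogonality on
  spheres, the growth of \<open>h\<close> exceeds the critical rate only by as much as the \<open>a\<^sub>n\<close> grow.\<close>

section \<open>Calculus with partial derivatives\<close>

text \<open>The ball weights replace Green's formula: they vanish on the boundary, so integration by
  parts leaves no boundary term and rests on translation invariance of Lebesgue measure alone.
  Spheres, whose measure is given by volumes of cones, are reached afterwards through homogeneity.
  The critical rate is that of bounded coefficients: the squared norm of
  \<open>zonal k n / fact n\<close> on the sphere of radius \<open>r\<close> is of order
  \<open>(2 * r) ^ (2 * n)\<close> over a factorial at the half-integer 2n + N - 3/2, and summation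
  over n gives e^(2r) / r^(N - 3/2), the square of the rate in the theorem. So (ii) may lose no
  power of the radius at all. The exponential rate is therefore taken at distance of order 1/K from
  the critical one, which costs just the factor K that an average over K terms permits. In (i),
  \<phi> may grow arbitrarily slowly and need not be monotone, so the coefficients are adapted to
  it. Only indices of order r matter at radius r; hence a bound on the squared coefficients that is
  linear in n with slope of order 1/r is as good as a constant one.\<close>

lemma C1_has_derivative:
  fixes f :: "real ^ 'n::finite \<Rightarrow> real"
  assumes "C1_fun f"
  shows "(f has_derivative (\<lambda>v. \<Sum>i\<in>UNIV. v $ i * partial i f x)) (at x)"
proof -
  have d: "f differentiable (at x)"
    using assms by (simp add: C1_fun_def differentiable_on_def)
  let ?F = "frechet_derivative f (at x)"
  have F: "(f has_derivative ?F) (at x)"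
    using d by (simp add: frechet_derivative_works)
  have lin: "linear ?F"
    using F has_derivative_linear by blast
  have "?F v = (\<Sum>i\<in>UNIV. v $ i * partial i f x)" for v
  proof -
    have "?F v = ?F (\<Sum>i\<in>UNIV. v $ i *\<^sub>R axis i 1)"
      by (metis basis_expansion scalar_mult_eq_scaleR)
    also have "\<dots> = (\<Sum>i\<in>UNIV. v $ i * ?F (axis i 1))"
      using lin by (simp add: linear_sum linear_scale)
    finally show ?thesis
      by (simp add: partial_eq_frechet_derivative[OF d])
  qed
  then have "?F = (\<lambda>v. \<Sum>i\<in>UNIV. v $ i * partial i f x)" by blast
  with F show ?thesis by simp
qed

lemma partial_eqI:
  fixes f :: "real ^ 'n::finite \<Rightarrow> real"
  assumes "(f has_derivative (\<lambda>v. \<Sum>i\<in>UNIV. v $ i * G i)) (at x)"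
  shows "partial i f x = G i"
proof -
  have "frechet_derivative f (at x) = (\<lambda>v. \<Sum>i\<in>UNIV. v $ i * G i)"
    using frechet_derivative_at[OF assms] by simp
  moreover have "f differentiable (at x)"
    using assms by (auto simp: differentiable_def)
  ultimately have "partial i f x = (\<Sum>j\<in>UNIV. axis i 1 $ j * G j)"
    by (simp add: partial_eq_frechet_derivative)
  also have "\<dots> = (\<Sum>j\<in>UNIV. if j = i then G j else 0)"
    by (intro sum.cong) (auto simp: axis_def)
  finally show ?thesis by simp
qed

text \<open>A candidate gradient that is verified as a Frechet derivative identifies all
  \<open>partial i f\<close> at once, so difference quotients along the axes are never handled; the
  second fact then serves as the rewriting rule for \<open>partial\<close>.\<close>

lemma C1_funI:
  fixes f :: "real ^ 'n::finite \<Rightarrow> real"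
  assumes "\<And>x. (f has_derivative (\<lambda>v. \<Sum>i\<in>UNIV. v $ i * G i x)) (at x)"
    and "\<And>i. continuous_on UNIV (G i)"
  shows "C1_fun f" "partial i f = G i"
proof -
  show *: "partial i f = G i" for i
    using partial_eqI[OF assms(1)] by blast
  show "C1_fun f"
    unfolding C1_fun_def * using assms
    by (auto simp: differentiable_on_def differentiable_def intro: has_derivative_at_withinI)
qed

lemma C1_continuous_on: "C1_fun f \<Longrightarrow> continuous_on S f"
  unfolding C1_fun_def
  by (meson continuous_on_subset differentiable_imp_continuous_on subset_UNIV)

lemma C1_continuous_on_partial: "C1_fun f \<Longrightarrow> continuous_on S (partial i f)"
  unfolding C1_fun_def by (meson continuous_on_subset subset_UNIV)

lemma C1_const: "C1_fun (\<lambda>x. c)" and partial_const [simp]: "partial i (\<lambda>x. c) = (\<lambda>x. 0)"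
  using C1_funI[of "\<lambda>x. c" "\<lambda>i x. 0"] by auto

lemma C1_coord: "C1_fun (\<lambda>x::real^'n::finite. x $ j)"
  and partial_coord: "partial i (\<lambda>x::real^'n::finite. x $ j) = (\<lambda>x. if i = j then 1 else 0)"
proof -
  have eq: "(\<lambda>v::real^'n. v $ j) = (\<lambda>v. \<Sum>i\<in>UNIV. v $ i * (if i = j then 1 else 0))"
    by (auto simp: if_distrib cong: if_cong)
  have "((\<lambda>x::real^'n. x $ j) has_derivative (\<lambda>v. v $ j)) (at x)" for x
    by (rule bounded_linear_imp_has_derivative) (simp add: bounded_linear_vec_nth)
  then have *: "((\<lambda>x::real^'n. x $ j) has_derivative
       (\<lambda>v. \<Sum>i\<in>UNIV. v $ i * (if i = j then 1 else 0))) (at x)" for x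
    by (subst eq[symmetric])
  show "C1_fun (\<lambda>x::real^'n. x $ j)" "partial i (\<lambda>x. x $ j) = (\<lambda>x. if i = j then 1 else 0)"
    using C1_funI[of "\<lambda>x. x $ j" "\<lambda>i x. if i = j then 1 else 0"] * by auto
qed

lemma C1_add: assumes "C1_fun f" "C1_fun g"
  shows "C1_fun (\<lambda>x. f x + g x)"
    "partial i (\<lambda>x. f x + g x) = (\<lambda>x. partial i f x + partial i g x)"
proof -
  have "((\<lambda>x. f x + g x) has_derivative
      (\<lambda>v. \<Sum>i\<in>UNIV. v $ i * (partial i f x + partial i g x))) (at x)" for x
    using has_derivative_add[OF C1_has_derivative[OF assms(1)] C1_has_derivative[OF assms(2)], of x]
    by (simp add: ring_distribs sum.distrib)
  note d = this
  have c: "continuous_on UNIV (\<lambda>x. partial i f x + partial i g x)" for i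
    using assms by (auto intro!: continuous_intros C1_continuous_on_partial)
  show "C1_fun (\<lambda>x. f x + g x)"
    by (rule C1_funI(1)[OF d c])
  show "partial i (\<lambda>x. f x + g x) = (\<lambda>x. partial i f x + partial i g x)"
    by (rule C1_funI(2)[OF d c])
qed

lemma C1_mult: assumes "C1_fun f" "C1_fun g"
  shows "C1_fun (\<lambda>x. f x * g x)"
    "partial i (\<lambda>x. f x * g x) = (\<lambda>x. partial i f x * g x + f x * partial i g x)"
proof -
  have "((\<lambda>x. f x * g x) has_derivative
      (\<lambda>v. \<Sum>i\<in>UNIV. v $ i * (partial i f x * g x + f x * partial i g x))) (at x)" for x
    using has_derivative_mult[OF C1_has_derivative[OF assms(1)] C1_has_derivative[OF assms(2)], of x]
    by (simp add: ring_distribs sum.distrib sum_distrib_left sum_distrib_right mult_ac add.commute)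
  note d = this
  have c: "continuous_on UNIV (\<lambda>x. partial i f x * g x + f x * partial i g x)" for i
    by (intro continuous_on_add continuous_on_mult C1_continuous_on_partial[OF assms(1)]
        C1_continuous_on_partial[OF assms(2)] C1_continuous_on[OF assms(1)] C1_continuous_on[OF assms(2)])
  show "C1_fun (\<lambda>x. f x * g x)"
    by (rule C1_funI(1)[OF d c])
  show "partial i (\<lambda>x. f x * g x) = (\<lambda>x. partial i f x * g x + f x * partial i g x)"
    by (rule C1_funI(2)[OF d c])
qed

lemma C1_cmult: assumes "C1_fun f"
  shows "C1_fun (\<lambda>x. c * f x)" "partial i (\<lambda>x. c * f x) = (\<lambda>x. c * partial i f x)"
  using C1_mult[OF C1_const assms] by auto

lemma C1_sum: assumes "finite S" "\<And>j. j \<in> S \<Longrightarrow> C1_fun (f j)"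
  shows "C1_fun (\<lambda>x. \<Sum>j\<in>S. f j x) \<and> partial i (\<lambda>x. \<Sum>j\<in>S. f j x) = (\<lambda>x. \<Sum>j\<in>S. partial i (f j) x)"
  using assms by (induction S rule: finite_induct) (auto simp: C1_const C1_add)

lemma C1_inner_self: "C1_fun (\<lambda>x::real^'n::finite. x \<bullet> x)"
  "partial i (\<lambda>x::real^'n::finite. x \<bullet> x) = (\<lambda>x. 2 * x $ i)"
proof -
  have e: "(\<lambda>x::real^'n. x \<bullet> x) = (\<lambda>x. \<Sum>j\<in>UNIV. x $ j * x $ j)"
    by (auto simp: inner_vec_def)
  have "C1_fun (\<lambda>x::real^'n. \<Sum>j\<in>UNIV. x $ j * x $ j) \<and>
      partial i (\<lambda>x. \<Sum>j\<in>UNIV. x $ j * x $ j) = (\<lambda>x::real^'n. \<Sum>j\<in>UNIV. partial i (\<lambda>x. x $ j * x $ j) x)"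
    by (rule C1_sum) (auto intro: C1_mult C1_coord)
  moreover have "(\<Sum>j\<in>UNIV. partial i (\<lambda>x. x $ j * x $ j) x) = 2 * x $ i" for x :: "real^'n"
    by (simp add: C1_mult(2)[OF C1_coord C1_coord] partial_coord if_distrib if_distribR sum.distrib cong: if_cong)
  ultimately show "C1_fun (\<lambda>x::real^'n::finite. x \<bullet> x)"
    "partial i (\<lambda>x::real^'n::finite. x \<bullet> x) = (\<lambda>x. 2 * x $ i)"
    unfolding e by auto
qed

lemma C1_affine: assumes "C1_fun f"
  shows "C1_fun (\<lambda>x. f (y + s *\<^sub>R x))"
    "partial i (\<lambda>x. f (y + s *\<^sub>R x)) = (\<lambda>x. s * partial i f (y + s *\<^sub>R x))"
proof -
  have "((\<lambda>x. f (y + s *\<^sub>R x)) has_derivative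
      (\<lambda>v. \<Sum>i\<in>UNIV. v $ i * (s * partial i f (y + s *\<^sub>R x)))) (at x)" for x
  proof -
    have "((\<lambda>x. y + s *\<^sub>R x) has_derivative (\<lambda>v. s *\<^sub>R v)) (at x)"
      by (auto intro!: derivative_eq_intros)
    from has_derivative_compose[OF this C1_has_derivative[OF assms]]
    show ?thesis by (simp add: mult_ac)
  qed
  note d = this
  have c: "continuous_on UNIV (\<lambda>x. s * partial i f (y + s *\<^sub>R x))" for i
    using assms by (auto intro!: continuous_intros continuous_on_compose2[OF C1_continuous_on_partial])
  show "C1_fun (\<lambda>x. f (y + s *\<^sub>R x))"
    by (rule C1_funI(1)[OF d c])
  show "partial i (\<lambda>x. f (y + s *\<^sub>R x)) = (\<lambda>x. s * partial i f (y + s *\<^sub>R x))"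
    by (rule C1_funI(2)[OF d c])
qed

lemma C1_translate: fixes f :: "real ^ 'n::finite \<Rightarrow> real" assumes "C1_fun f"
  shows "C1_fun (\<lambda>x. f (y + x))"
    "partial i (\<lambda>x. f (y + x)) = (\<lambda>x. partial i f (y + x))"
  using C1_affine[OF assms, where y=y and s=1] by simp_all

lemma C1_scale: fixes f :: "real ^ 'n::finite \<Rightarrow> real" assumes "C1_fun f"
  shows "C1_fun (\<lambda>x. f (s *\<^sub>R x))"
    "partial i (\<lambda>x. f (s *\<^sub>R x)) = (\<lambda>x. s * partial i f (s *\<^sub>R x))"
  using C1_affine[OF assms, where y=0 and s=s] by simp_all

lemma C1_compose_real: 
  assumes "C1_fun f" "\<And>t. (g has_field_derivative g' t) (at t)" "continuous_on UNIV g'"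
  shows "C1_fun (\<lambda>x. g (f x))"
    "partial i (\<lambda>x. g (f x)) = (\<lambda>x. g' (f x) * partial i f x)"
proof -
  have "((\<lambda>x. g (f x)) has_derivative
      (\<lambda>v. \<Sum>i\<in>UNIV. v $ i * (g' (f x) * partial i f x))) (at x)" for x
  proof -
    have "(g has_derivative (\<lambda>v. g' (f x) * v)) (at (f x))"
      using assms(2)[of "f x"] by (simp add: has_field_derivative_def)
    from has_derivative_compose[OF C1_has_derivative[OF assms(1)] this]
    show ?thesis by (simp add: mult_ac sum_distrib_left)
  qed
  note d = this
  have c: "continuous_on UNIV (\<lambda>x. g' (f x) * partial i f x)" for i
    by (intro continuous_on_mult continuous_on_compose2[OF assms(3)] C1_continuous_on_partial[OF assms(1)]
        C1_continuous_on[OF assms(1)] subset_UNIV)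
  show "C1_fun (\<lambda>x. g (f x))"
    by (rule C1_funI(1)[OF d c])
  show "partial i (\<lambda>x. g (f x)) = (\<lambda>x. g' (f x) * partial i f x)"
    by (rule C1_funI(2)[OF d c])
qed

section \<open>Compactly supported integrands and differentiation under the integral sign\<close>

lemma integrable_compact_support:
  fixes f :: "'a::euclidean_space \<Rightarrow> real"
  assumes "continuous_on UNIV f" "\<And>x. norm x > R \<Longrightarrow> f x = 0"
  shows "integrable lborel f"
proof -
  have "integrable lborel (\<lambda>x. indicator (cball 0 R) x *\<^sub>R f x)"
    by (rule borel_integrable_compact) (auto intro: continuous_on_subset[OF assms(1)])
  also have "(\<lambda>x. indicator (cball 0 R) x *\<^sub>R f x) = f"
    using assms(2) by (fastforce simp: indicator_def)
  finally show ?thesis .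
qed

lemma ball_subset_box:
  fixes x :: "'a::euclidean_space" assumes "norm x \<le> R"
  shows "x \<in> cbox (- R *\<^sub>R One) (R *\<^sub>R One)"
  using assms Basis_le_norm[of _ x] by (fastforce simp: mem_box abs_le_iff)

lemma integral_eq_cbox:
  fixes f :: "'a::euclidean_space \<Rightarrow> real"
  assumes "continuous_on UNIV f" "\<And>x. norm x > R \<Longrightarrow> f x = 0"
  shows "integral (cbox (- R *\<^sub>R One) (R *\<^sub>R One)) f = (LINT x|lborel. f x)"
proof -
  have "integral UNIV f = (LINT x|lborel. f x)"
    using integrable_compact_support[OF assms] by (simp add: integral_lborel)
  moreover have "integral (cbox (- R *\<^sub>R One) (R *\<^sub>R One)) f = integral UNIV f"
    by (rule integral_spike_set) 
       (use assms(2) ball_subset_box in \<open>auto intro!: negligible_subset[OF negligible_empty]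
          simp: not_le[symmetric]\<close>)
  ultimately show ?thesis by simp
qed

text \<open>The support of \<open>g\<close> confines the integral to one fixed box, where the
  Leibniz rule for parameter integrals applies. All derivatives fall on \<open>f\<close>, so
  \<open>g\<close> only has to be continuous, which covers the weight with exponent 1.\<close>

lemma C1_convolution:
  fixes f g :: "real ^ 'n::finite \<Rightarrow> real"
  assumes f: "C1_fun f" and g: "continuous_on UNIV g" "\<And>x. norm x > R \<Longrightarrow> g x = 0"
  defines "u \<equiv> (\<lambda>y. LINT x|lborel. f (y + x) * g x)"
  shows "C1_fun u" "partial i u = (\<lambda>y. LINT x|lborel. partial i f (y + x) * g x)"
proof -
  let ?B = "cbox (- R *\<^sub>R One) (R *\<^sub>R One) :: (real^'n) set"
  \<comment> \<open>The gradient as a bounded linear map, because the Leibniz rule expects the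
    parameter derivative as a \<open>blinfun\<close>.\<close>
  define fx where "fx y x = (\<Sum>i\<in>UNIV. (partial i f (y + x) * g x) *\<^sub>R blinfun_inner_right (axis i 1 :: real^'n))"
    for y x :: "real^'n"
  have fx: "blinfun_apply (fx y x) v = (\<Sum>i\<in>UNIV. v $ i * partial i f (y + x)) * g x" for y x v
    by (simp add: fx_def blinfun.sum_left blinfun.scaleR_left inner_axis' sum_distrib_right)
       (simp add: mult_ac)
  note cf = continuous_on_compose2[OF C1_continuous_on[OF f]]
  note cp = continuous_on_compose2[OF C1_continuous_on_partial[OF f]]
  have ct: "continuous_on UNIV (\<lambda>x. f (y + x) * g x)"
    "continuous_on UNIV (\<lambda>x. partial j f (y + x) * g x)" for j y
    by (auto intro!: continuous_intros g cf cp)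
  have cfx: "continuous_on (UNIV \<times> ?B) (\<lambda>(y, x). fx y x)"
    unfolding fx_def split_def
    by (intro continuous_intros cp continuous_on_compose2[OF g(1)]) auto
  have cc: "continuous_on UNIV (\<lambda>y. LINT x|lborel. partial j f (y + x) * g x)" for j
  proof -
    have "continuous_on UNIV (\<lambda>y. integral ?B (\<lambda>x. partial j f (y + x) * g x))"
      by (rule integral_continuous_on_param)
         (auto simp: split_def intro!: continuous_intros cp continuous_on_compose2[OF g(1)])
    then show ?thesis
      using ct g(2) by (subst (asm) integral_eq_cbox) auto
  qed
  have d: "(u has_derivative (\<lambda>v. \<Sum>i\<in>UNIV. v $ i * (LINT x|lborel. partial i f (y + x) * g x))) (at y)" for y
  proof -
    have "((\<lambda>y. integral ?B (\<lambda>x. f (y + x) * g x)) has_derivative integral ?B (fx y)) (at y within UNIV)"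
    proof (rule leibniz_rule[OF _ _ cfx])
      fix y x :: "real^'n"
      have "((\<lambda>y. y + x) has_derivative (\<lambda>v. v)) (at y)"
        by (auto intro!: derivative_eq_intros)
      from has_derivative_compose[OF this C1_has_derivative[OF f]]
      have "((\<lambda>y. f (y + x)) has_derivative (\<lambda>v. \<Sum>i\<in>UNIV. v $ i * partial i f (y + x))) (at y)"
        by simp
      then have "((\<lambda>y. f (y + x) * g x) has_derivative
         (\<lambda>v. (\<Sum>i\<in>UNIV. v $ i * partial i f (y + x)) * g x)) (at y)"
        by (rule has_derivative_mult_left)
      then show "((\<lambda>y. f (y + x) * g x) has_derivative blinfun_apply (fx y x)) (at y within UNIV)"
        using fx by presburger
    next
      show "(\<lambda>x. f (y + x) * g x) integrable_on ?B" for y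
        by (rule integrable_continuous) (rule continuous_on_subset[OF ct(1)], simp)
    qed auto
    moreover have "(\<lambda>y. integral ?B (\<lambda>x. f (y + x) * g x)) = u"
      unfolding u_def using ct g(2) by (subst integral_eq_cbox) auto
    moreover have "blinfun_apply (integral ?B (fx y)) =
        (\<lambda>v. \<Sum>i\<in>UNIV. v $ i * (LINT x|lborel. partial i f (y + x) * g x))"
    proof
      fix v :: "real^'n"
      have int: "fx y integrable_on ?B"
        by (rule integrable_continuous)
           (rule continuous_on_compose2[OF cfx, where f="\<lambda>x. (y, x)", simplified split_def, simplified],
            auto intro!: continuous_intros)
      have "blinfun_apply (integral ?B (fx y)) v = integral ?B (\<lambda>x. blinfun_apply (fx y x) v)"
        using integral_linear[OF int, of "\<lambda>b. blinfun_apply b v"]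
        by (simp add: o_def blinfun.bounded_linear_left)
      also have "\<dots> = integral ?B (\<lambda>x. \<Sum>i\<in>UNIV. v $ i * (partial i f (y + x) * g x))"
        by (simp add: fx sum_distrib_right mult.assoc)
      also have "\<dots> = (LINT x|lborel. (\<Sum>i\<in>UNIV. v $ i * (partial i f (y + x) * g x)))"
        using g(2) by (intro integral_eq_cbox) (auto intro!: continuous_intros ct)
      also have "\<dots> = (\<Sum>i\<in>UNIV. LINT x|lborel. v $ i * (partial i f (y + x) * g x))"
        using g(2) by (intro Bochner_Integration.integral_sum integrable_compact_support[of _ R])
          (auto intro!: continuous_intros ct)
      finally show "blinfun_apply (integral ?B (fx y)) v =
        (\<Sum>i\<in>UNIV. v $ i * (LINT x|lborel. partial i f (y + x) * g x))" by simp
    qed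
    ultimately show ?thesis by simp
  qed
  show "C1_fun u" "partial i u = (\<lambda>y. LINT x|lborel. partial i f (y + x) * g x)"
    using C1_funI[of u, OF d cc] by auto
qed

text \<open>By translation invariance the integral of a shifted \<open>f\<close> does not depend on
  the shift, so its derivative with respect to the shift, the integral of
  \<open>partial i f\<close>, is zero. No iterated integration along lines is involved.\<close>

lemma integral_partial_zero:
  fixes f :: "real ^ 'n::finite \<Rightarrow> real"
  assumes f: "C1_fun f" and z: "\<And>x. norm x > R \<Longrightarrow> f x = 0"
  shows "(LINT x|lborel. partial i f x) = 0"
proof -
  \<comment> \<open>The cutoff is 1 up to radius \<open>R + 1\<close>, which leaves room for shifts
    by less than 1, and has the compact support that \<open>C1_convolution\<close> asks for.\<close>
  define g where "g x = max 0 (min 1 (R + 2 - norm x))" for x :: "real^'n"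
  have g: "continuous_on UNIV g" "\<And>x. norm x > R + 2 \<Longrightarrow> g x = 0" "\<And>x. norm x \<le> R + 1 \<Longrightarrow> g x = 1"
    unfolding g_def by (auto intro!: continuous_intros)
  define u where "u y = (LINT x|lborel. f (y + x) * g x)" for y
  have u: "partial i u 0 = (LINT x|lborel. partial i f (0 + x) * g x)"
    using C1_convolution(2)[OF f g(1,2)] unfolding u_def by simp
  have pz: "partial i f x = 0" if "norm x > R" for x
  proof -
    have "(f has_derivative (\<lambda>v. \<Sum>i\<in>UNIV. v $ i * 0)) (at x)"
    proof (rule has_derivative_transform_within_open)
      show "((\<lambda>x. 0) has_derivative (\<lambda>v. \<Sum>i\<in>UNIV. v $ i * 0)) (at x)" by simp
      show "open {x. norm x > R}" by (intro open_Collect_less continuous_intros)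
    qed (use that z in auto)
    then show ?thesis by (rule partial_eqI)
  qed
  have "u y = (LINT x|lborel. f x)" if "norm y < 1" for y
  proof -
    have "f (y + x) * g x = f (y + x)" for x
    proof (cases "norm (y + x) > R")
      case False
      have "norm x \<le> norm (y + x) + norm y"
        by (metis add_diff_cancel_left' norm_triangle_ineq4)
      with False that show ?thesis using g(3)[of x] by simp
    qed (use z in simp)
    then have "u y = (LINT x|lborel. f (y + x))" unfolding u_def by presburger
    also have "\<dots> = (LINT x|lborel. f x)"
      using borel_measurable_continuous_onI[OF C1_continuous_on[OF f]]
      by (subst (2) lborel_distr_plus[of y, symmetric], subst integral_distr) auto
    finally show ?thesis .
  qed
  then have ueq: "(LINT x|lborel. f x) = u y" if "y \<in> ball 0 1" for y
    using that by simp
  have "((\<lambda>y. LINT x|lborel. f x) has_derivative (\<lambda>v::real^'n. \<Sum>i\<in>UNIV. v $ i * 0)) (at 0)"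
    by simp
  then have "(u has_derivative (\<lambda>v. \<Sum>i\<in>UNIV. v $ i * 0)) (at 0)"
    by (rule has_derivative_transform_within_open[of _ _ _ _ "ball 0 1"]) (simp_all add: ueq)
  then have "partial i u 0 = 0" by (rule partial_eqI)
  moreover have "partial i f x * g x = partial i f x" for x
    using pz[of x] g(3)[of x] by (cases "norm x > R") auto
  ultimately show ?thesis using u by simp
qed

section \<open>Harmonic functions and the mean value property\<close>

text \<open>The exponent measures smoothness at the boundary of the ball: continuous for
  \<open>p = 1\<close>, continuously differentiable from \<open>p = 2\<close> on. For
  \<open>p = 0\<close> this is the constant 1 and not the indicator of the ball, since
  \<open>0 ^ 0 = 1\<close>; hence \<open>p \<ge> 1\<close> in what follows.\<close>

definition ball_weight :: "real \<Rightarrow> nat \<Rightarrow> real ^ 'n::finite \<Rightarrow> real" where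
  "ball_weight R p x = (max 0 (R\<^sup>2 - x \<bullet> x)) ^ p"

definition ball_integral :: "real \<Rightarrow> nat \<Rightarrow> (real ^ 'n::finite \<Rightarrow> real) \<Rightarrow> real" where
  "ball_integral R p f = (LINT x|lborel. f x * ball_weight R p x)"

lemma ball_weight_nonneg: "ball_weight R p x \<ge> 0"
  by (simp add: ball_weight_def)

lemma ball_weight_eq_0: assumes "R > 0" "p \<ge> 1" "norm x > R" shows "ball_weight R p x = 0"
proof -
  have "R\<^sup>2 \<le> x \<bullet> x"
    using assms by (simp add: power2_norm_eq_inner[symmetric] power_mono)
  then show ?thesis using assms by (simp add: ball_weight_def max_def)
qed

lemma continuous_ball_weight: "continuous_on S (ball_weight R p)"
  unfolding ball_weight_def by (intro continuous_intros)

lemma ball_weight_Suc: assumes "p \<ge> 1" shows "ball_weight R (Suc p) x = (R\<^sup>2 - x \<bullet> x) * ball_weight R p x"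
  using assms by (auto simp: ball_weight_def max_def)

lemma DERIV_max_power:
  assumes "p \<ge> 1"
  shows "((\<lambda>t::real. (max 0 t) ^ Suc p) has_field_derivative real (Suc p) * (max 0 t) ^ p) (at t)"
proof -
  consider "t > 0" | "t < 0" | "t = 0" by linarith
  then show ?thesis
  proof cases
    case 1
    have "((\<lambda>t::real. t ^ Suc p) has_field_derivative real (Suc p) * t ^ p) (at t)"
      using DERIV_pow[of "Suc p" t] by simp
    then have "((\<lambda>t::real. (max 0 t) ^ Suc p) has_field_derivative real (Suc p) * t ^ p) (at t)"
      by (rule has_field_derivative_transform_within_open[where S="{0<..}"]) (use 1 in auto)
    then show ?thesis using 1 by simp
  next
    case 2
    have "((\<lambda>t::real. 0) has_field_derivative 0) (at t)" by simp
    then have "((\<lambda>t::real. (max 0 t) ^ Suc p) has_field_derivative 0) (at t)"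
      by (rule has_field_derivative_transform_within_open[where S="{..<0}"]) (use 2 in auto)
    then show ?thesis using 2 assms by (simp add: power_0_left)
  next
    case 3
    \<comment> \<open>At the kink the difference quotient is dominated by
      \<open>\<bar>u\<bar> ^ p\<close>, which tends to 0 because \<open>p \<ge> 1\<close>.\<close>
    have "((\<lambda>u::real. \<bar>u\<bar> ^ p) \<longlongrightarrow> \<bar>0\<bar> ^ p) (at 0)"
      by (intro tendsto_intros)
    then have "((\<lambda>u::real. \<bar>u\<bar> ^ p) \<longlongrightarrow> 0) (at 0)"
      using assms by (simp add: power_0_left split: if_splits)
    then have "((\<lambda>u::real. (max 0 u) ^ Suc p / u) \<longlongrightarrow> 0) (at 0)"
    proof (rule Lim_null_comparison[rotated], intro always_eventually allI)
      show "norm ((max 0 u) ^ Suc p / u) \<le> \<bar>u\<bar> ^ p" for u :: real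
        by (cases "u > 0") (auto simp: max_def)
    qed
    then show ?thesis using assms by (simp add: 3 DERIV_def power_0_left)
  qed
qed

lemma C1_ball_weight:
  assumes "p \<ge> 1"
  shows "C1_fun (ball_weight R (Suc p))" "partial i (ball_weight R (Suc p)) = (\<lambda>x. - 2 * real (Suc p) * x $ i * ball_weight R p x)"
proof -
  have c: "C1_fun (\<lambda>x::real^'n. R\<^sup>2 + (-1) * (x \<bullet> x))"
    and pt: "partial i (\<lambda>x::real^'n. R\<^sup>2 + (-1) * (x \<bullet> x)) = (\<lambda>x. - 2 * x $ i)" for i
  proof -
    note c = C1_cmult[OF C1_inner_self(1), of "-1"]
    show "C1_fun (\<lambda>x::real^'n. R\<^sup>2 + (-1) * (x \<bullet> x))"
      by (rule C1_add(1)[OF C1_const c(1)])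
    show "partial i (\<lambda>x::real^'n. R\<^sup>2 + (-1) * (x \<bullet> x)) = (\<lambda>x. - 2 * x $ i)" for i
      unfolding C1_add(2)[OF C1_const c(1)] C1_cmult(2)[OF C1_inner_self(1)] C1_inner_self(2) by simp
  qed
  have e: "ball_weight R (Suc p) = (\<lambda>x::real^'n. (max 0 (R\<^sup>2 + (-1) * (x \<bullet> x))) ^ Suc p)"
    by (simp add: ball_weight_def fun_eq_iff)
  have cg: "continuous_on UNIV (\<lambda>t::real. real (Suc p) * (max 0 t) ^ p)"
    by (intro continuous_intros)
  show "C1_fun (ball_weight R (Suc p) :: real^'n \<Rightarrow> real)"
    unfolding e by (rule C1_compose_real(1)[OF c DERIV_max_power[OF assms] cg])
  show "partial i (ball_weight R (Suc p)) = (\<lambda>x. - 2 * real (Suc p) * x $ i * ball_weight R p x)"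
    unfolding e C1_compose_real(2)[OF c DERIV_max_power[OF assms] cg] pt ball_weight_def
    by (simp add: fun_eq_iff ring_distribs)
qed

lemma ball_integral_integrable:
  assumes "continuous_on UNIV f" "R > 0" "p \<ge> 1"
  shows "integrable lborel (\<lambda>x. f x * ball_weight R p x)"
  using assms by (intro integrable_compact_support[of _ R]) (auto intro!: continuous_intros continuous_ball_weight simp: ball_weight_eq_0)

lemma ball_integral_add:
  assumes "continuous_on UNIV f" "continuous_on UNIV g" "R > 0" "p \<ge> 1"
  shows "ball_integral R p (\<lambda>x. f x + g x) = ball_integral R p f + ball_integral R p g"
  using assms by (simp add: ball_integral_def ring_distribs ball_integral_integrable)

lemma ball_integral_diff:
  assumes "continuous_on UNIV f" "continuous_on UNIV g" "R > 0" "p \<ge> 1"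
  shows "ball_integral R p (\<lambda>x. f x - g x) = ball_integral R p f - ball_integral R p g"
  using assms by (simp add: ball_integral_def ring_distribs ball_integral_integrable)

lemma ball_integral_cmult: "ball_integral R p (\<lambda>x. c * f x) = c * ball_integral R p f"
  by (simp add: ball_integral_def mult.assoc)

lemma ball_integral_sum:
  assumes "\<And>i. i \<in> S \<Longrightarrow> continuous_on UNIV (f i)" "R > 0" "p \<ge> 1"
  shows "ball_integral R p (\<lambda>x. \<Sum>i\<in>S. f i x) = (\<Sum>i\<in>S. ball_integral R p (f i))"
  unfolding ball_integral_def sum_distrib_right
  by (rule Bochner_Integration.integral_sum) (rule ball_integral_integrable, use assms in auto)

lemma ball_integral_nonneg: "(\<And>x. f x \<ge> 0) \<Longrightarrow> ball_integral R p f \<ge> 0"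
  unfolding ball_integral_def by (intro integral_nonneg_AE) (auto simp: ball_weight_nonneg)

text \<open>Halving the radius keeps the weight above \<open>(R\<^sup>2 * 3/4) ^ p\<close>. The
  bound is crude but has the right order in \<open>R\<close>.\<close>

lemma ball_integral_1_ge:
  assumes "R > 0" "p \<ge> 1"
  shows "(R\<^sup>2 * 3/4) ^ p * measure lborel (ball 0 (R/2) :: (real^'n::finite) set) \<le> ball_integral R p (\<lambda>x::real^'n. 1)"
proof -
  have "(R\<^sup>2 * 3/4) ^ p * measure lborel (ball 0 (R/2) :: (real^'n) set)
      = (LINT x|lborel. (R\<^sup>2 * 3/4) ^ p * indicator (ball 0 (R/2) :: (real^'n) set) x)"
    by simp
  also have "\<dots> \<le> ball_integral R p (\<lambda>x::real^'n::finite. 1)"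
    unfolding ball_integral_def
  proof (rule integral_mono)
    show "integrable lborel (\<lambda>x. 1 * ball_weight R p (x::real^'n))"
      using assms by (intro ball_integral_integrable) auto
    show "(R\<^sup>2 * 3/4) ^ p * indicator (ball 0 (R/2)) x \<le> 1 * ball_weight R p x" for x :: "real^'n"
    proof (cases "x \<in> ball 0 (R/2)")
      case True
      then have "x \<bullet> x \<le> (R/2)\<^sup>2"
        by (simp add: power2_norm_eq_inner[symmetric] power_mono)
      then have "R\<^sup>2 * 3/4 \<le> max 0 (R\<^sup>2 - x \<bullet> x)"
        by (intro max.coboundedI2) (simp add: power_divide)
      then have "(R\<^sup>2 * 3/4) ^ p \<le> ball_weight R p x"
        unfolding ball_weight_def by (rule power_mono) simp
      then show ?thesis using True by simp
    qed (simp add: ball_weight_nonneg)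
    have "integrable lborel (indicator (ball 0 (R/2)) :: real^'n \<Rightarrow> real)"
      using emeasure_lborel_ball_finite[of 0 "R/2"] by (intro integrable_real_indicator) simp_all
    then show "integrable lborel (\<lambda>x. (R\<^sup>2 * 3/4) ^ p * indicator (ball 0 (R/2)) (x::real^'n) :: real)"
      by (rule integrable_mult_right)
  qed
  finally show ?thesis .
qed

lemma ball_integral_1_pos:
  assumes "R > 0" "p \<ge> 1"
  shows "ball_integral R p (\<lambda>x::real^'n::finite. 1) > 0"
proof (rule less_le_trans[OF _ ball_integral_1_ge[OF assms]])
  show "(R\<^sup>2 * 3/4) ^ p * measure lborel (ball 0 (R/2) :: (real^'n) set) > 0"
    using assms content_ball_pos[of "R/2" "0::real^'n"] by (intro mult_pos_pos) auto
qed

text \<open>Differentiating the weight with exponent \<open>Suc p\<close> gives the weight with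
  exponent \<open>p\<close> times a multiple of \<open>x $ i\<close>. A coordinate factor can thus
  be exchanged for a derivative at the price of raising the exponent by one.\<close>

lemma ball_integral_ibp:
  assumes f: "C1_fun f" and R: "R > 0" and p: "p \<ge> 1"
  shows "ball_integral R (Suc p) (partial i f) = 2 * real (Suc p) * ball_integral R p (\<lambda>x. x $ i * f x)"
proof -
  have "(LINT x|lborel. partial i (\<lambda>x. f x * ball_weight R (Suc p) x) x) = 0"
    using R by (intro integral_partial_zero[of _ R] C1_mult f C1_ball_weight p) (auto simp: ball_weight_eq_0)
  also have "partial i (\<lambda>x. f x * ball_weight R (Suc p) x) =
      (\<lambda>x. partial i f x * ball_weight R (Suc p) x - 2 * real (Suc p) * (x $ i * f x * ball_weight R p x))"
    by (subst C1_mult(2)[OF f C1_ball_weight(1)[OF p]], subst C1_ball_weight(2)[OF p]) (auto simp: algebra_simps)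
  also have "(LINT x|lborel. partial i f x * ball_weight R (Suc p) x - 2 * real (Suc p) * (x $ i * f x * ball_weight R p x))
     = ball_integral R (Suc p) (partial i f) - 2 * real (Suc p) * ball_integral R p (\<lambda>x. x $ i * f x)"
    unfolding ball_integral_def using p R
    by (subst Bochner_Integration.integral_diff)
       (auto intro!: ball_integral_integrable[where p="Suc p"] ball_integral_integrable[where p=p] integrable_mult_right
          C1_continuous_on_partial f continuous_intros C1_continuous_on[OF f])
  finally show ?thesis by simp
qed

lemma harmonicD:
  assumes "h \<in> harmonic_functions"
  shows "C1_fun h" "C1_fun (partial i h)" "(\<Sum>i\<in>UNIV. partial i (partial i h) x) = 0"
  using assms by (auto simp: harmonic_functions_def C2_fun_def)

lemma harmonicI:
  assumes "C1_fun h" "\<And>i. C1_fun (partial i h)" "\<And>x. (\<Sum>i\<in>UNIV. partial i (partial i h) x) = 0"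
  shows "h \<in> harmonic_functions"
  using assms by (auto simp: harmonic_functions_def C2_fun_def)

lemma harmonic_continuous: "h \<in> harmonic_functions \<Longrightarrow> continuous_on S h"
  by (meson harmonicD(1) C1_continuous_on)

text \<open>Each factor \<open>x $ i\<close> is traded for a derivative of
  \<open>f * partial i h\<close>; the second derivatives of \<open>h\<close> add up to its Laplacian
  and disappear. The right-hand side is symmetric in \<open>f\<close> and \<open>h\<close>, so for
  two harmonic functions this acts as Green's second identity.\<close>

lemma ball_integral_radial_derivative:
  assumes h: "h \<in> harmonic_functions" and f: "C1_fun f" and R: "R > 0" and p: "p \<ge> 1"
  shows "2 * real (Suc p) * ball_integral R p (\<lambda>x. f x * (\<Sum>i\<in>UNIV. x $ i * partial i h x)) =
    ball_integral R (Suc p) (\<lambda>x. \<Sum>i\<in>UNIV. partial i f x * partial i h x)"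
proof -
  note [continuous_intros] = C1_continuous_on[OF f] C1_continuous_on_partial[OF f]
    C1_continuous_on[OF harmonicD(2)[OF h]] C1_continuous_on_partial[OF harmonicD(2)[OF h]]
  have "2 * real (Suc p) * ball_integral R p (\<lambda>x. f x * (\<Sum>i\<in>UNIV. x $ i * partial i h x)) =
      2 * real (Suc p) * (\<Sum>i\<in>UNIV. ball_integral R p (\<lambda>x. x $ i * (f x * partial i h x)))"
    using R p by (subst ball_integral_sum[symmetric]) (auto intro!: continuous_intros simp: sum_distrib_left mult_ac)
  also have "\<dots> = (\<Sum>i\<in>UNIV. ball_integral R (Suc p) (partial i (\<lambda>x. f x * partial i h x)))"
    by (simp add: ball_integral_ibp[OF C1_mult(1)[OF f harmonicD(2)[OF h]] R p] sum_distrib_left)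
  also have "\<dots> = ball_integral R (Suc p) (\<lambda>x. \<Sum>i\<in>UNIV. partial i (\<lambda>x. f x * partial i h x) x)"
    using R by (intro ball_integral_sum[symmetric])
      (auto intro!: C1_continuous_on_partial C1_mult(1)[OF f harmonicD(2)[OF h]])
  also have "(\<lambda>x. \<Sum>i\<in>UNIV. partial i (\<lambda>x. f x * partial i h x) x) =
      (\<lambda>x. \<Sum>i\<in>UNIV. partial i f x * partial i h x)"
    by (simp add: C1_mult(2)[OF f harmonicD(2)[OF h]] sum.distrib sum_distrib_left[symmetric]
        harmonicD(3)[OF h])
  finally show ?thesis .
qed

lemma harmonic_affine:
  assumes h: "h \<in> harmonic_functions"
  shows "(\<lambda>x. h (y + s *\<^sub>R x)) \<in> harmonic_functions"
proof (rule harmonicI)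
  show "C1_fun (\<lambda>x. h (y + s *\<^sub>R x))" using h by (intro C1_affine harmonicD)
  show "C1_fun (partial i (\<lambda>x. h (y + s *\<^sub>R x)))" for i
    unfolding C1_affine(2)[OF harmonicD(1)[OF h]] using h by (intro C1_cmult C1_affine harmonicD)
  show "(\<Sum>i\<in>UNIV. partial i (partial i (\<lambda>x. h (y + s *\<^sub>R x))) x) = 0" for x
    unfolding C1_affine(2)[OF harmonicD(1)[OF h]] C1_cmult(2)[OF C1_affine(1)[OF harmonicD(2)[OF h]]]
      C1_affine(2)[OF harmonicD(2)[OF h]]
    by (simp add: sum_distrib_left[symmetric] harmonicD(3)[OF h])
qed

lemma harmonic_translate: "h \<in> harmonic_functions \<Longrightarrow> (\<lambda>x. h (y + x)) \<in> harmonic_functions"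
  using harmonic_affine[of h y 1] by simp

text \<open>Along the dilations \<open>h (s *\<^sub>R x)\<close> the weighted integral is constant:
  its derivative is the integral of a radial derivative, which integration by parts turns, up to a
  constant factor, into \<open>s\<close> times an integral of the Laplacian. Then
  \<open>s = 1\<close> is compared with \<open>s = 0\<close>.\<close>

lemma harmonic_mean_value:
  fixes h :: "real^'n::finite \<Rightarrow> real"
  assumes h: "h \<in> harmonic_functions" and R: "R > 0" and p: "p \<ge> 1"
  shows "ball_integral R p h = h 0 * ball_integral R p (\<lambda>x::real^'n. 1)"
proof -
  let ?B = "cbox (- R *\<^sub>R One) (R *\<^sub>R One) :: (real^'n) set"
  note ch = C1_continuous_on[OF harmonicD(1)[OF h]]
  note cp = C1_continuous_on_partial[OF harmonicD(1)[OF h]]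
  note [continuous_intros] = continuous_on_compose2[OF ch] continuous_on_compose2[OF cp]
     continuous_on_compose2[OF continuous_ball_weight]
  define F where "F s = ball_integral R p (\<lambda>x. h (s *\<^sub>R x))" for s
  have F: "F s = integral ?B (\<lambda>x. h (s *\<^sub>R x) * ball_weight R p x)" for s
    unfolding F_def ball_integral_def using R p
    by (intro integral_eq_cbox[symmetric]) (auto intro!: continuous_intros simp: ball_weight_eq_0)
  have "(F has_field_derivative 0) (at s)" for s
  proof -
    let ?d = "\<lambda>s x. (\<Sum>i\<in>UNIV. x $ i * partial i h (s *\<^sub>R x)) * ball_weight R p x"
    have "((\<lambda>s. integral ?B (\<lambda>x. h (s *\<^sub>R x) * ball_weight R p x)) has_field_derivative integral ?B (?d s)) (at s within UNIV)"
    proof (rule leibniz_rule_field_derivative)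
      fix s :: real and x :: "real^'n"
      have "((\<lambda>s. s *\<^sub>R x) has_derivative (\<lambda>t. t *\<^sub>R x)) (at s)"
        by (auto intro!: derivative_eq_intros)
      note d = has_derivative_compose[OF this C1_has_derivative[OF harmonicD(1)[OF h]]]
      have "(\<lambda>t. \<Sum>i\<in>UNIV. (t *\<^sub>R x) $ i * partial i h (s *\<^sub>R x))
          = (*) (\<Sum>i\<in>UNIV. x $ i * partial i h (s *\<^sub>R x))"
        by (simp add: fun_eq_iff sum_distrib_right) (simp add: mult_ac)
      with d have "((\<lambda>s. h (s *\<^sub>R x)) has_field_derivative (\<Sum>i\<in>UNIV. x $ i * partial i h (s *\<^sub>R x))) (at s)"
        by (simp add: has_field_derivative_def)
      then show "((\<lambda>s. h (s *\<^sub>R x) * ball_weight R p x) has_field_derivative ?d s x) (at s within UNIV)"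
        by (intro DERIV_cmult_right)
    next
      show "(\<lambda>x. h (s *\<^sub>R x) * ball_weight R p x) integrable_on ?B" for s
        by (intro integrable_continuous continuous_intros) auto
      show "continuous_on (UNIV \<times> ?B) (\<lambda>(s, x). ?d s x)"
        unfolding split_def by (intro continuous_intros) auto
    qed auto
    moreover have "integral ?B (?d s) = 0"
    proof -
      have "integral ?B (?d s) = ball_integral R p (\<lambda>x. \<Sum>i\<in>UNIV. x $ i * partial i h (s *\<^sub>R x))"
        unfolding ball_integral_def using R p
        by (intro integral_eq_cbox) (auto intro!: continuous_intros simp: ball_weight_eq_0)
      also have "\<dots> = (\<Sum>i\<in>UNIV. ball_integral R p (\<lambda>x. x $ i * partial i h (s *\<^sub>R x)))"
        using R p by (intro ball_integral_sum) (auto intro!: continuous_intros)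
      also have "2 * real (Suc p) * \<dots> = (\<Sum>i\<in>UNIV. ball_integral R (Suc p) (partial i (\<lambda>x. partial i h (s *\<^sub>R x))))"
        by (simp add: ball_integral_ibp[OF C1_scale(1)[OF harmonicD(2)[OF h]] R p] sum_distrib_left)
      also have "\<dots> = (\<Sum>i\<in>UNIV. s * ball_integral R (Suc p) (\<lambda>x. partial i (partial i h) (s *\<^sub>R x)))"
        by (simp add: C1_scale(2)[OF harmonicD(2)[OF h]] ball_integral_cmult)
      also have "\<dots> = s * ball_integral R (Suc p) (\<lambda>x. \<Sum>i\<in>UNIV. partial i (partial i h) (s *\<^sub>R x))"
        using R by (subst ball_integral_sum)
          (auto simp: sum_distrib_left intro!: continuous_intros
            continuous_on_compose2[OF C1_continuous_on_partial[OF harmonicD(2)[OF h]]])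
      also have "\<dots> = 0"
        by (simp add: harmonicD(3)[OF h] ball_integral_def)
      finally show ?thesis by simp
    qed
    moreover have "F = (\<lambda>s. integral ?B (\<lambda>x. h (s *\<^sub>R x) * ball_weight R p x))"
      using F by blast
    ultimately show ?thesis by simp
  qed
  then have "F 1 = F 0" by (intro DERIV_isconst_all) auto
  then show ?thesis
    using ball_integral_cmult[of R p "h 0" "\<lambda>x. 1"] by (simp add: F_def)
qed

lemma harmonic_mean_value_at:
  fixes h :: "real^'n::finite \<Rightarrow> real"
  assumes h: "h \<in> harmonic_functions" and R: "R > 0" and p: "p \<ge> 1"
  shows "(LINT x|lborel. h (y + x) * ball_weight R p x) = ball_integral R p (\<lambda>x::real^'n::finite. 1) * h y"
  using harmonic_mean_value[OF harmonic_translate[OF h, of y] R p] by (simp add: ball_integral_def mult.commute)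

lemma harmonic_convolution:
  assumes h: "h \<in> harmonic_functions"
    and g: "continuous_on UNIV g" "\<And>x. norm x > R \<Longrightarrow> g x = 0"
  shows "(\<lambda>y. LINT x|lborel. h (y + x) * g x) \<in> harmonic_functions"
proof -
  note 1 = C1_convolution[OF harmonicD(1)[OF h] g]
  note 2 = C1_convolution[OF harmonicD(2)[OF h] g]
  show ?thesis
  proof (rule harmonicI)
    show "(\<Sum>i\<in>UNIV. partial i (partial i (\<lambda>y. LINT x|lborel. h (y + x) * g x)) y) = 0" for y
    proof -
      have "(\<Sum>i\<in>UNIV. partial i (partial i (\<lambda>y. LINT x|lborel. h (y + x) * g x)) y)
         = (\<Sum>i\<in>UNIV. LINT x|lborel. partial i (partial i h) (y + x) * g x)"
        by (simp add: 1 2)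
      also have "\<dots> = (LINT x|lborel. (\<Sum>i\<in>UNIV. partial i (partial i h) (y + x) * g x))"
        using g(2) by (intro Bochner_Integration.integral_sum[symmetric] integrable_compact_support[of _ R])
          (auto intro!: continuous_intros g continuous_on_compose2[OF C1_continuous_on_partial[OF harmonicD(2)[OF h]]])
      also have "\<dots> = 0"
        by (simp add: sum_distrib_right[symmetric] harmonicD(3)[OF h])
      finally show ?thesis .
    qed
  qed (simp_all add: 1 2)
qed

text \<open>The mean value property reproduces \<open>h\<close> as a convolution with a weight, and
  integration by parts moves the derivative onto that weight. What remains is \<open>h\<close>
  itself against a continuous kernel.\<close>

lemma partial_harmonic_eq:
  fixes h :: "real^'n::finite \<Rightarrow> real"
  assumes h: "h \<in> harmonic_functions" and R: "R > 0" and p: "p \<ge> 1"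
  shows "ball_integral R (Suc p) (\<lambda>x::real^'n::finite. 1) * partial i h y =
    2 * real (Suc p) * (LINT x|lborel. h (y + x) * (x $ i * ball_weight R p x))"
proof -
  let ?V = "ball_integral R (Suc p) (\<lambda>x::real^'n. 1)"
  have "(\<lambda>y. LINT x|lborel. h (y + x) * ball_weight R (Suc p) x) = (\<lambda>y. ?V * h y)"
    by (rule ext) (use harmonic_mean_value_at[OF h R, of "Suc p"] in simp)
  then have "?V * partial i h y = partial i (\<lambda>y. LINT x|lborel. h (y + x) * ball_weight R (Suc p) x) y"
    using C1_cmult(2)[OF harmonicD(1)[OF h]] by simp
  also have "\<dots> = (LINT x|lborel. partial i h (y + x) * ball_weight R (Suc p) x)"
    using R by (subst C1_convolution(2)[OF harmonicD(1)[OF h] continuous_ball_weight, where R=R]) (auto simp: ball_weight_eq_0)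
  also have "\<dots> = ball_integral R (Suc p) (partial i (\<lambda>x. h (y + x)))"
    by (simp add: C1_translate(2)[OF harmonicD(1)[OF h]] ball_integral_def)
  also have "\<dots> = 2 * real (Suc p) * ball_integral R p (\<lambda>x. x $ i * h (y + x))"
    by (rule ball_integral_ibp[OF C1_translate(1)[OF harmonicD(1)[OF h]] R p])
  finally show ?thesis by (simp add: ball_integral_def mult_ac)
qed

lemma harmonic_cmult: assumes "h \<in> harmonic_functions"
  shows "(\<lambda>x. c * h x) \<in> harmonic_functions"
  using assms by (intro harmonicI)
    (simp_all add: C1_cmult harmonicD[OF assms] sum_distrib_left[symmetric])

lemma harmonic_add: assumes "f \<in> harmonic_functions" "g \<in> harmonic_functions"
  shows "(\<lambda>x. f x + g x) \<in> harmonic_functions"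
  by (intro harmonicI)
    (simp_all add: C1_add harmonicD[OF assms(1)] harmonicD[OF assms(2)] sum.distrib)

lemma harmonic_zero: "(\<lambda>x. 0) \<in> harmonic_functions"
  by (rule harmonicI) (auto simp: C1_const)

lemma harmonic_sum:
  assumes "finite S" "\<And>j. j \<in> S \<Longrightarrow> f j \<in> harmonic_functions"
  shows "(\<lambda>x. \<Sum>j\<in>S. f j x) \<in> harmonic_functions"
  using assms by (induction S rule: finite_induct) (auto simp: harmonic_zero harmonic_add)

text \<open>Regularity bootstrap: harmonicity only grants two derivatives, but averages of
  translates of \<open>h\<close> are harmonic again, and \<open>partial i h\<close> is such an
  average by \<open>partial_harmonic_eq\<close>. This makes all iterates of the operator
  available.\<close>

lemma harmonic_partial:
  fixes h :: "real^'n::finite \<Rightarrow> real"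
  assumes h: "h \<in> harmonic_functions"
  shows "partial i h \<in> harmonic_functions"
proof -
  let ?V = "ball_integral 1 2 (\<lambda>x::real^'n. 1)"
  have V: "?V > 0" by (rule ball_integral_1_pos) auto
  have u: "(\<lambda>y. LINT x|lborel. h (y + x) * (x $ i * ball_weight 1 1 x)) \<in> harmonic_functions"
    by (rule harmonic_convolution[OF h, where R=1])
       (auto intro!: continuous_intros continuous_ball_weight simp: ball_weight_eq_0)
  have "partial i h = (\<lambda>y. (4 / ?V) * (LINT x|lborel. h (y + x) * (x $ i * ball_weight 1 1 x)))"
    using partial_harmonic_eq[OF h, of 1 1 i] V
    by (intro ext) (simp add: field_simps numeral_2_eq_2[symmetric])
  then show ?thesis using harmonic_cmult[OF u, of "4 / ?V"] by simp
qed

section \<open>Gradient bounds and locally uniform limits of harmonic functions\<close>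

lemma gradient_estimate:
  "\<exists>C\<ge>0. \<forall>h\<in>harmonic_functions. \<forall>y i M.
     (\<forall>x. dist y x \<le> 1 \<longrightarrow> \<bar>h x\<bar> \<le> M) \<longrightarrow> \<bar>partial i h (y::real^'n::finite)\<bar> \<le> C * M"
proof (intro exI conjI ballI allI impI)
  let ?V = "ball_integral 1 2 (\<lambda>x::real^'n. 1)" and ?C = "LINT x|lborel. norm x * ball_weight 1 1 (x::real^'n)"
  have V: "?V > 0" by (rule ball_integral_1_pos) auto
  have C: "?C \<ge> 0" by (intro integral_nonneg_AE) (auto simp: ball_weight_nonneg)
  have iC: "integrable lborel (\<lambda>x::real^'n. norm x * ball_weight 1 1 x)"
    by (intro integrable_compact_support[of _ 1]) (auto intro!: continuous_intros continuous_ball_weight simp: ball_weight_eq_0)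
  show "4 * ?C / ?V \<ge> 0" using V C by simp
  fix h :: "real^'n \<Rightarrow> real" and y i M
  assume h: "h \<in> harmonic_functions" and "\<forall>x. dist y x \<le> 1 \<longrightarrow> \<bar>h x\<bar> \<le> M"
  then have M: "\<And>x. dist y x \<le> 1 \<Longrightarrow> \<bar>h x\<bar> \<le> M" by blast
  have M0: "M \<ge> 0" using M[of y] by force
  have "\<bar>LINT x|lborel. h (y + x) * (x $ i * ball_weight 1 1 x)\<bar> \<le> (LINT x|lborel. \<bar>h (y + x) * (x $ i * ball_weight 1 1 x)\<bar>)"
    by (rule integral_abs_bound)
  also have "\<dots> \<le> (LINT x|lborel. M * (norm x * ball_weight 1 1 (x::real^'n)))"
  proof (rule integral_mono)
    show "integrable lborel (\<lambda>x. \<bar>h (y + x) * (x $ i * ball_weight 1 1 x)\<bar>)"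
      by (intro integrable_compact_support[of _ 1])
       (auto intro!: continuous_intros continuous_ball_weight continuous_on_compose2[OF harmonic_continuous[OF h]] simp: ball_weight_eq_0)
    show "integrable lborel (\<lambda>x::real^'n. M * (norm x * ball_weight 1 1 x))"
      using iC by simp
    show "\<bar>h (y + x) * (x $ i * ball_weight 1 1 x)\<bar> \<le> M * (norm x * ball_weight 1 1 x)" for x
    proof (cases "norm x > 1")
      case False
      then have "\<bar>h (y + x)\<bar> \<le> M" by (intro M) (simp add: dist_norm)
      then show ?thesis unfolding abs_mult using M0
        by (intro mult_mono) (auto simp: ball_weight_nonneg component_le_norm_cart)
    qed (simp add: ball_weight_eq_0)
  qed
  finally have "\<bar>LINT x|lborel. h (y + x) * (x $ i * ball_weight 1 1 x)\<bar> \<le> M * ?C" by simp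
  moreover have "partial i h y = (4 / ?V) * (LINT x|lborel. h (y + x) * (x $ i * ball_weight 1 1 x))"
    using partial_harmonic_eq[OF h, of 1 1 i y] V by (auto simp: field_simps numeral_2_eq_2[symmetric])
  ultimately show "\<bar>partial i h y\<bar> \<le> 4 * ?C / ?V * M"
    using V by (simp add: abs_mult divide_simps mult_ac)
qed

text \<open>Differences of the \<open>f n\<close> are harmonic, so the gradient estimate turns
  uniform Cauchy convergence on radius \<open>r + 1\<close> into that of the partial derivatives on
  radius \<open>r\<close>. Since those are harmonic too, using this twice yields
  \<open>harmonic_limit\<close>.\<close>

lemma harmonic_limit_C1:
  fixes h :: "real^'n::finite \<Rightarrow> real"
  assumes f: "\<And>n. f n \<in> harmonic_functions"
    and lim: "\<And>r. uniform_limit (cball 0 r) f h sequentially"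
  shows "C1_fun h" "uniform_limit (cball 0 r) (\<lambda>n. partial i (f n)) (partial i h) sequentially"
proof -
  obtain C where C0: "C \<ge> 0" and C': "\<forall>h\<in>harmonic_functions. \<forall>y i M.
     (\<forall>x. dist y x \<le> 1 \<longrightarrow> \<bar>h x\<bar> \<le> M) \<longrightarrow> \<bar>partial i h (y::real^'n::finite)\<bar> \<le> C * M"
    using gradient_estimate[where ?'n='n] by (elim exE conjE that)
  note C = C0 C'[rule_format]
  have "uniformly_convergent_on (cball 0 r) (\<lambda>n. partial i (f n))" for i r
  proof -
    have "uniformly_Cauchy_on (cball 0 r) (\<lambda>n. partial i (f n))"
    proof (rule uniformly_Cauchy_onI)
      fix e :: real assume e: "e > 0"
      have "uniformly_convergent_on (cball 0 (r + 1)) f"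
        unfolding uniformly_convergent_on_def using lim by blast
      then have "uniformly_Cauchy_on (cball 0 (r + 1)) f"
        by (simp only: uniformly_convergent_eq_Cauchy)
      moreover have "e / (C + 1) > 0" using e C0 by simp
      ultimately obtain K where "\<forall>x\<in>cball 0 (r + 1). \<forall>m\<ge>K. \<forall>n\<ge>K. dist (f m x) (f n x) < e / (C + 1)"
        unfolding uniformly_Cauchy_on_def by (elim allE[of _ "e / (C + 1)"] impE exE that)
      note K = this[rule_format]
      have "dist (partial i (f m) x) (partial i (f n) x) < e" if x: "x \<in> cball 0 r" and mn: "m \<ge> K" "n \<ge> K" for x m n
      proof -
        have "\<bar>partial i (\<lambda>x. f m x + (-1) * f n x) x\<bar> \<le> C * (e / (C + 1))"
        proof (rule C(2))
          show "(\<lambda>x. f m x + (-1) * f n x) \<in> harmonic_functions"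
            by (intro harmonic_add harmonic_cmult f)
          show "\<bar>f m z + (-1) * f n z\<bar> \<le> e / (C + 1)" if "dist x z \<le> 1" for z
          proof -
            have "z \<in> cball 0 (r + 1)"
              using x that dist_triangle[of 0 z x] by (simp add: dist_commute)
            from K[OF this mn] show ?thesis by (simp add: dist_real_def)
          qed
        qed
        also have "\<dots> < e" using e C(1) by (simp add: field_simps)
        finally show ?thesis
          unfolding C1_add(2)[OF harmonicD(1)[OF f] C1_cmult(1)[OF harmonicD(1)[OF f]]]
              C1_cmult(2)[OF harmonicD(1)[OF f]] by (simp add: dist_real_def)
      qed
      then show "\<exists>M. \<forall>x\<in>cball 0 r. \<forall>m\<ge>M. \<forall>n\<ge>M. dist (partial i (f m) x) (partial i (f n) x) < e" by blast
    qed
    then show ?thesis by (simp add: uniformly_convergent_eq_Cauchy)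
  qed
  moreover define G where "G i x = lim (\<lambda>n. partial i (f n) x)" for i x
  ultimately have G: "uniform_limit (cball 0 r) (\<lambda>n. partial i (f n)) (G i) sequentially" for i r
    unfolding G_def by (simp add: uniformly_convergent_uniform_limit_iff)
  have cG: "continuous_on UNIV (G i)" for i
  proof -
    have "continuous_on (ball 0 r) (G i)" for r
      by (rule continuous_on_subset[OF uniform_limit_theorem[OF _ G[where r=r]] ball_subset_cball])
        (auto intro!: always_eventually C1_continuous_on_partial[OF harmonicD(1)[OF f]])
    then have "\<forall>z\<in>ball 0 r. isCont (G i) z" for r
      by (simp add: continuous_on_eq_continuous_at)
    then have "isCont (G i) x" for x
      by (rule bspec[where A="ball 0 (norm x + 1)"]) simp
    then show ?thesis by (simp add: continuous_at_imp_continuous_on)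
  qed
  have dh: "(h has_derivative (\<lambda>v. \<Sum>i\<in>UNIV. v $ i * G i x)) (at x)" for x
  proof -
    define S where "S = ball (0::real^'n) (norm x + 1)"
    have xS: "x \<in> S" by (simp add: S_def)
    have "\<exists>g. \<forall>z\<in>S. (\<lambda>n. f n z) \<longlonglongrightarrow> g z \<and> (g has_derivative (\<lambda>v. \<Sum>i\<in>UNIV. v $ i * G i z)) (at z within S)"
    proof (rule has_derivative_sequence[OF _ _ _ xS])
      show "convex S" by (simp add: S_def)
      show "(f n has_derivative (\<lambda>v. \<Sum>i\<in>UNIV. v $ i * partial i (f n) z)) (at z within S)" for n z
        using C1_has_derivative[OF harmonicD(1)[OF f]] has_derivative_at_withinI by blast
      show "(\<lambda>n. f n x) \<longlonglongrightarrow> h x"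
        using tendsto_uniform_limitI[OF lim[of "norm x"]] by simp
      fix e :: real assume e: "e > 0"
      let ?e = "e / real CARD('n)"
      have "\<forall>\<^sub>F n in sequentially. \<forall>i. \<forall>z\<in>S. dist (partial i (f n) z) (G i z) < ?e"
      proof (rule eventually_all_finite)
        fix i
        have "\<forall>\<^sub>F n in sequentially. \<forall>z\<in>cball 0 (norm x + 1). dist (partial i (f n) z) (G i z) < ?e"
          using G e by (intro uniform_limitD) auto
        then show "\<forall>\<^sub>F n in sequentially. \<forall>z\<in>S. dist (partial i (f n) z) (G i z) < ?e"
          by eventually_elim (auto simp: S_def)
      qed
      then show "\<forall>\<^sub>F n in sequentially. \<forall>z\<in>S. \<forall>v. norm ((\<Sum>i\<in>UNIV. v $ i * partial i (f n) z) - (\<Sum>i\<in>UNIV. v $ i * G i z)) \<le> e * norm v"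
      proof eventually_elim
        case (elim n)
        have "norm ((\<Sum>i\<in>UNIV. v $ i * partial i (f n) z) - (\<Sum>i\<in>UNIV. v $ i * G i z)) \<le> e * norm v" if z: "z \<in> S" for z v
        proof -
          have "norm ((\<Sum>i\<in>UNIV. v $ i * partial i (f n) z) - (\<Sum>i\<in>UNIV. v $ i * G i z))
             = norm (\<Sum>i\<in>UNIV. v $ i * (partial i (f n) z - G i z))"
            by (simp add: sum_subtractf right_diff_distrib)
          also have "\<dots> \<le> (\<Sum>i\<in>(UNIV::'n set). norm v * ?e)"
          proof (rule order_trans[OF norm_sum], rule sum_mono)
            fix i :: 'n
            have "\<bar>partial i (f n) z - G i z\<bar> \<le> ?e"
              using elim z by (auto simp: dist_real_def less_imp_le)
            then show "norm (v $ i * (partial i (f n) z - G i z)) \<le> norm v * ?e"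
              unfolding real_norm_def abs_mult by (intro mult_mono component_le_norm_cart) auto
          qed
          finally show ?thesis by (simp add: mult.commute)
        qed
        then show ?case by blast
      qed
    qed
    then obtain g where g: "\<And>z. z \<in> S \<Longrightarrow> (\<lambda>n. f n z) \<longlonglongrightarrow> g z"
       "\<And>z. z \<in> S \<Longrightarrow> (g has_derivative (\<lambda>v. \<Sum>i\<in>UNIV. v $ i * G i z)) (at z within S)" by blast
    have gh: "g z = h z" if "z \<in> S" for z
      using g(1)[OF that] tendsto_uniform_limitI[OF lim[of "norm z"], of z] LIMSEQ_unique by auto
    have "(g has_derivative (\<lambda>v. \<Sum>i\<in>UNIV. v $ i * G i x)) (at x)"
      using g(2)[OF xS] at_within_open[OF xS] by (simp add: S_def)
    then show ?thesis
      by (rule has_derivative_transform_within_open[OF _ _ xS]) (auto simp: S_def gh[unfolded S_def])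
  qed
  show "C1_fun h" by (rule C1_funI(1)[OF dh cG])
  show "uniform_limit (cball 0 r) (\<lambda>n. partial i (f n)) (partial i h) sequentially"
    unfolding C1_funI(2)[OF dh cG] by (rule G)
qed

lemma harmonic_limit:
  fixes h :: "real^'n::finite \<Rightarrow> real"
  assumes f: "\<And>n. f n \<in> harmonic_functions"
    and lim: "\<And>r. uniform_limit (cball 0 r) f h sequentially"
  shows "h \<in> harmonic_functions"
proof (rule harmonicI)
  note 1 = harmonic_limit_C1[OF f lim]
  note 2 = harmonic_limit_C1[OF harmonic_partial[OF f] 1(2)]
  show "C1_fun h" by (rule 1(1))
  show "C1_fun (partial i h)" for i by (rule 2(1))
  fix x :: "real^'n"
  have "(\<lambda>n. \<Sum>i\<in>UNIV. partial i (partial i (f n)) x) \<longlonglongrightarrow> (\<Sum>i\<in>UNIV. partial i (partial i h) x)"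
    by (intro tendsto_sum tendsto_uniform_limitI[OF 2(2)[where r="norm x"]]) auto
  then show "(\<Sum>i\<in>UNIV. partial i (partial i h) x) = 0"
    by (simp add: harmonicD(3)[OF f] LIMSEQ_const_iff)
qed

section \<open>Zonal harmonic polynomials\<close>

abbreviation laplacian :: "(real ^ 'n::finite \<Rightarrow> real) \<Rightarrow> real ^ 'n \<Rightarrow> real" where
  "laplacian f x \<equiv> (\<Sum>i\<in>UNIV. partial i (partial i f) x)"

abbreviation radial_derivative :: "(real ^ 'n::finite \<Rightarrow> real) \<Rightarrow> real ^ 'n \<Rightarrow> real" where
  "radial_derivative f x \<equiv> (\<Sum>i\<in>UNIV. x $ i * partial i f x)"

lemma C2_funD: "C2_fun f \<Longrightarrow> C1_fun f" "C2_fun f \<Longrightarrow> C1_fun (partial i f)"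
  by (auto simp: C2_fun_def)

lemma C2_mult:
  assumes f: "C2_fun f" and g: "C2_fun g"
  shows "C2_fun (\<lambda>x. f x * g x)"
    "laplacian (\<lambda>x. f x * g x) x = laplacian f x * g x
       + 2 * (\<Sum>i\<in>UNIV. partial i f x * partial i g x) + f x * laplacian g x"
proof -
  note p = C1_mult(2)[OF C2_funD(1)[OF f] C2_funD(1)[OF g]]
  note c1 = C1_mult[OF C2_funD(2)[OF f] C2_funD(1)[OF g]]
  note c2 = C1_mult[OF C2_funD(1)[OF f] C2_funD(2)[OF g]]
  show "C2_fun (\<lambda>x. f x * g x)"
    unfolding C2_fun_def p
    by (intro conjI allI C1_mult(1)[OF C2_funD(1)[OF f] C2_funD(1)[OF g]] C1_add(1)[OF c1(1) c2(1)])
  show "laplacian (\<lambda>x. f x * g x) x = laplacian f x * g x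
       + 2 * (\<Sum>i\<in>UNIV. partial i f x * partial i g x) + f x * laplacian g x"
    unfolding p C1_add(2)[OF c1(1) c2(1)] c1(2) c2(2)
    by (simp add: sum.distrib sum_distrib_left sum_distrib_right)
qed

lemma C2_coord: "C2_fun (\<lambda>x::real^'n::finite. x $ k)" "laplacian (\<lambda>x::real^'n::finite. x $ k) x = 0"
  by (auto simp: C2_fun_def partial_coord C1_coord C1_const)

lemma C2_inner_self: "C2_fun (\<lambda>x::real^'n::finite. x \<bullet> x)"
  "laplacian (\<lambda>x::real^'n::finite. x \<bullet> x) x = 2 * real CARD('n)"
  by (auto simp: C2_fun_def C1_inner_self C1_cmult[OF C1_coord] partial_coord)

lemma C2_cmult: assumes "C2_fun f"
  shows "C2_fun (\<lambda>x. c * f x)" "laplacian (\<lambda>x. c * f x) x = c * laplacian f x"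
  using assms by (auto simp: C2_fun_def C1_cmult sum_distrib_left)

lemma C2_add: assumes f: "C2_fun f" and g: "C2_fun g"
  shows "C2_fun (\<lambda>x. f x + g x)" "laplacian (\<lambda>x. f x + g x) x = laplacian f x + laplacian g x"
  using assms by (auto simp: C2_fun_def C1_add sum.distrib)

text \<open>The three-term recurrence of the Gegenbauer polynomials with parameter \<open>N / 2 - 1\<close>, made
  homogeneous and rescaled to have the value \<open>1\<close> at \<open>axis k 1\<close>.\<close>

fun zonal :: "'n::finite \<Rightarrow> nat \<Rightarrow> real ^ 'n \<Rightarrow> real" where
  "zonal k 0 x = 1"
| "zonal k (Suc 0) x = x $ k"
| "zonal k (Suc (Suc n)) x =
    (2 * real n + real CARD('n)) / (real n + real CARD('n) - 1) * (x $ k * zonal k (Suc n) x)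
    + (- ((real n + 1) / (real n + real CARD('n) - 1))) * ((x \<bullet> x) * zonal k n x)"

declare zonal.simps(3) [simp del]

lemma scaled_combination:
  fixes M :: real
  assumes "M \<noteq> 0"
  shows "M * (a / M * A + (- (b / M)) * B) = a * A - b * B"
  using assms by (simp add: field_simps)

text \<open>Cleared of denominators the recurrence also covers \<open>n = 0\<close>, where the
  factor \<open>real n\<close> removes the term with the truncated index
  \<open>n - 1\<close>.\<close>

lemma zonal_rec:
  fixes x :: "real ^ 'n::finite"
  assumes "CARD('n) \<ge> 2"
  shows "(real n + real CARD('n) - 2) * zonal k (Suc n) x =
    (2 * real n + real CARD('n) - 2) * (x $ k * zonal k n x) - real n * ((x \<bullet> x) * zonal k (n - 1) x)"
proof (cases n)
  case (Suc m)
  have "real m + real CARD('n) - 1 \<noteq> 0" using assms by linarith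
  from scaled_combination[OF this] show ?thesis
    by (simp add: Suc zonal.simps(3) add_ac)
qed simp

text \<open>The claims need each other: the Laplacian in degree \<open>n\<close> uses the axis
  derivative and Euler's relation in lower degrees. Hence a single induction for all four.\<close>

lemma zonal_properties:
  fixes k :: "'n::finite"
  assumes N: "CARD('n) \<ge> 2"
  shows "C2_fun (zonal k n) \<and> (\<forall>x. laplacian (zonal k n) x = 0) \<and>
    (\<forall>x. radial_derivative (zonal k n) x = real n * zonal k n x) \<and>
    partial k (zonal k n) = (\<lambda>x. real n * zonal k (n - 1) x)"
proof (induction n rule: less_induct)
  case (less n)
  have z0: "zonal k 0 = (\<lambda>x. 1)" and z1: "zonal k (Suc 0) = (\<lambda>x. x $ k)"
    by (auto simp: fun_eq_iff)
  show ?case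
  proof (cases "n < 2")
    case True
    then consider "n = 0" | "n = Suc 0" by linarith
    then show ?thesis
      by cases (auto simp: z0 z1 C2_fun_def C1_const C1_coord partial_coord if_distrib cong: if_cong)
  next
    case False
    then obtain m where n: "n = Suc (Suc m)" by (metis add_2_eq_Suc le_Suc_ex not_less)
    let ?N = "real CARD('n)"
    let ?c = "(2 * real m + ?N) / (real m + ?N - 1)" and ?d = "- ((real m + 1) / (real m + ?N - 1))"
    let ?P = "zonal k (Suc m)" and ?Q = "zonal k m"
    have pos: "real m + ?N - 1 > 0" using N by linarith
    have P: "C2_fun ?P" "laplacian ?P x = 0" "radial_derivative ?P x = (real m + 1) * ?P x"
        "partial k ?P x = (real m + 1) * ?Q x" for x
      using less.IH[of "Suc m"] n by auto
    have Q: "C2_fun ?Q" "laplacian ?Q x = 0" "radial_derivative ?Q x = real m * ?Q x"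
        "partial k ?Q x = real m * zonal k (m - 1) x" for x
      using less.IH[of m] n by auto
    have z: "zonal k n = (\<lambda>x. ?c * (x $ k * ?P x) + ?d * ((x \<bullet> x) * ?Q x))"
      by (simp add: n zonal.simps(3) fun_eq_iff)
    note a = C2_mult[OF C2_coord(1) P(1), of k] and b = C2_mult[OF C2_inner_self(1) Q(1)]
    have "C2_fun (zonal k n)"
      unfolding z by (intro C2_add C2_cmult a b)
    moreover have "laplacian (zonal k n) x = 0" for x
    proof -
      \<comment> \<open>What survives of the product rule is \<open>2 * partial k ?P\<close> from
        the first summand and \<open>2 * ?N + 4 * m\<close> times \<open>?Q\<close> from the second;
        the coefficients of the recurrence make these cancel.\<close>
      have "laplacian (zonal k n) x = ?c * (2 * ((real m + 1) * ?Q x))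
          + ?d * (2 * ?N * ?Q x + 4 * (real m * ?Q x))"
        unfolding z C2_add(2)[OF C2_cmult(1)[OF a(1)] C2_cmult(1)[OF b(1)]]
          C2_cmult(2)[OF a(1)] C2_cmult(2)[OF b(1)] a(2) b(2) C2_inner_self(2) C2_coord(2)
        by (simp add: P(2) Q(2) partial_coord C1_inner_self(2) P(4)[symmetric] Q(3)[symmetric]
             if_distrib if_distribR sum_distrib_left mult.assoc cong: if_cong)
      also have "\<dots> = 0" using pos by (simp add: field_simps)
      finally show ?thesis .
    qed
    moreover have pz: "partial i (zonal k n) x = ?c * ((if i = k then 1 else 0) * ?P x + x $ k * partial i ?P x)
         + ?d * (2 * x $ i * ?Q x + (x \<bullet> x) * partial i ?Q x)" for i x
    proof -
      note a' = C1_mult[OF C1_coord[of k] C2_funD(1)[OF P(1)]]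
      note b' = C1_mult[OF C1_inner_self(1) C2_funD(1)[OF Q(1)]]
      show ?thesis
        unfolding z C1_add(2)[OF C1_cmult(1)[OF a'(1)] C1_cmult(1)[OF b'(1)]]
          C1_cmult(2)[OF a'(1)] C1_cmult(2)[OF b'(1)] a'(2) b'(2) partial_coord C1_inner_self(2) by simp
    qed
    moreover have "radial_derivative (zonal k n) x = real n * zonal k n x" for x
    proof -
      define c d s where "c = ?c" and "d = ?d" and "s = x \<bullet> x"
      have "radial_derivative (zonal k n) x =
          (\<Sum>i\<in>UNIV. c * ((if i = k then x $ k * ?P x else 0) + x $ k * (x $ i * partial i ?P x))
         + d * (2 * (x $ i * x $ i) * ?Q x + s * (x $ i * partial i ?Q x)))"
        unfolding pz c_def[symmetric] d_def[symmetric] s_def[symmetric]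
        by (intro sum.cong refl) (simp add: algebra_simps)
      also have "\<dots> = c * (x $ k * ?P x + x $ k * radial_derivative ?P x)
          + d * (2 * (\<Sum>i\<in>UNIV. x $ i * x $ i) * ?Q x + s * radial_derivative ?Q x)"
        by (simp add: sum.distrib sum_distrib_left[symmetric] sum_distrib_right[symmetric])
      also have "(\<Sum>i\<in>UNIV. x $ i * x $ i) = s"
        by (simp add: s_def inner_vec_def)
      also have "c * (x $ k * ?P x + x $ k * radial_derivative ?P x)
          + d * (2 * s * ?Q x + s * radial_derivative ?Q x) = real n * zonal k n x"
        unfolding P(3) Q(3) z c_def[symmetric] d_def[symmetric] s_def[symmetric] by (simp add: n algebra_simps)
      finally show ?thesis .
    qed
    moreover have "partial k (zonal k n) x = real n * zonal k (n - 1) x" for x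
    proof -
      have "(real m + ?N - 1) * partial k (zonal k n) x =
         (2 * real m + ?N) * (?P x + x $ k * ((real m + 1) * ?Q x))
         - (real m + 1) * (2 * x $ k * ?Q x + (x \<bullet> x) * (real m * zonal k (m - 1) x))"
        unfolding pz P(4) Q(4) scaled_combination[OF less_imp_neq[OF pos, symmetric]] by simp
      \<comment> \<open>The recurrence in the previous degree eliminates
        \<open>zonal k (m - 1)\<close>.\<close>
      also have "\<dots> = (real m + ?N - 1) * (real n * ?P x)"
        using zonal_rec[OF N, of m k x] by (simp add: n) algebra
      finally show ?thesis using pos by (simp add: n)
    qed
    ultimately show ?thesis by blast
  qed
qed

context
  fixes k :: "'n::finite"
  assumes N: "CARD('n) \<ge> 2"
begin

lemma zonal_harmonic: "zonal k n \<in> harmonic_functions"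
  using zonal_properties[OF N, of k n] by (simp add: harmonic_functions_def)

lemma zonal_partial: "partial k (zonal k n) = (\<lambda>x. real n * zonal k (n - 1) x)"
  using zonal_properties[OF N, of k n] by blast

lemma zonal_radial_derivative: "radial_derivative (zonal k n) x = real n * zonal k n x"
  using zonal_properties[OF N, of k n] by blast

text \<open>The two coefficients of the recurrence are at most 2 and 1 in absolute value, and 2 * 3
  + 1 is at most 3 squared. Any exponential bound will do against the factorials in the series
  below.\<close>

lemma zonal_bound: "\<bar>zonal k n x\<bar> \<le> (3 * norm x) ^ n"
proof (induction n rule: less_induct)
  case (less n)
  consider "n = 0" | "n = Suc 0" | m where "n = Suc (Suc m)"
    by (metis not0_implies_Suc)
  then show ?case
  proof cases
    case 2
    then show ?thesis using component_le_norm_cart[of x k] by (simp add: less_le_trans)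
  next
    case (3 m)
    let ?N = "real CARD('n)"
    have pos: "real m + ?N - 1 > 0" using N by linarith
    define c d where "c = (2 * real m + ?N) / (real m + ?N - 1)"
      and "d = - ((real m + 1) / (real m + ?N - 1))"
    have "\<bar>c\<bar> \<le> 2" "\<bar>d\<bar> \<le> 1"
      using N pos by (simp_all add: c_def d_def divide_simps)
    moreover have "\<bar>x $ k * zonal k (Suc m) x\<bar> \<le> norm x * (3 * norm x) ^ Suc m"
      unfolding abs_mult using less.IH[of "Suc m"] 3
      by (intro mult_mono component_le_norm_cart) auto
    moreover have "\<bar>(x \<bullet> x) * zonal k m x\<bar> \<le> (norm x)\<^sup>2 * (3 * norm x) ^ m"
      unfolding abs_mult using less.IH[of m] 3
      by (intro mult_mono) (auto simp: power2_norm_eq_inner)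
    ultimately have "\<bar>c\<bar> * \<bar>x $ k * zonal k (Suc m) x\<bar> \<le> 2 * (norm x * (3 * norm x) ^ Suc m)"
      "\<bar>d\<bar> * \<bar>(x \<bullet> x) * zonal k m x\<bar> \<le> 1 * ((norm x)\<^sup>2 * (3 * norm x) ^ m)"
      by (intro mult_mono; simp)+
    moreover have "\<bar>zonal k n x\<bar> \<le> \<bar>c\<bar> * \<bar>x $ k * zonal k (Suc m) x\<bar> + \<bar>d\<bar> * \<bar>(x \<bullet> x) * zonal k m x\<bar>"
      unfolding 3 zonal.simps(3) c_def[symmetric] d_def[symmetric] abs_mult[symmetric]
      by (rule abs_triangle_ineq)
    ultimately have "\<bar>zonal k n x\<bar> \<le> 2 * (norm x * (3 * norm x) ^ Suc m) + 1 * ((norm x)\<^sup>2 * (3 * norm x) ^ m)"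
      by linarith
    also have "\<dots> = 7 * ((norm x)\<^sup>2 * (3 * norm x) ^ m)"
      by (simp add: power2_eq_square)
    also have "\<dots> \<le> 9 * ((norm x)\<^sup>2 * (3 * norm x) ^ m)"
      by (intro mult_right_mono) auto
    also have "\<dots> = (3 * norm x) ^ n"
      by (simp add: 3 power2_eq_square)
    finally show ?thesis .
  qed simp
qed

lemma zonal_axis: "zonal k n (t *\<^sub>R axis k 1) = t ^ n"
proof (induction n rule: less_induct)
  case (less n)
  consider "n = 0" | "n = Suc 0" | m where "n = Suc (Suc m)"
    by (metis not0_implies_Suc)
  then show ?case
  proof cases
    case (3 m)
    have pos: "real m + real CARD('n) - 1 > 0" using N by linarith
    have "(real m + real CARD('n) - 1) * zonal k n (t *\<^sub>R axis k 1) =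
        (2 * real m + real CARD('n)) * (t * t ^ Suc m) - (real m + 1) * (t * t * t ^ m)"
      using zonal_rec[OF N, of "Suc m" k "t *\<^sub>R axis k 1"] less.IH[of m] less.IH[of "Suc m"] 3
      by (simp add: inner_axis_axis add_ac)
    also have "\<dots> = (real m + real CARD('n) - 1) * t ^ n"
      by (simp add: 3 algebra_simps)
    finally show ?thesis using pos by simp
  qed (auto simp: axis_def)
qed

lemma zonal_homogeneous: "zonal k n (s *\<^sub>R x) = s ^ n * zonal k n x"
proof (induction n rule: less_induct)
  case (less n)
  consider "n = 0" | "n = Suc 0" | m where "n = Suc (Suc m)"
    by (metis not0_implies_Suc)
  then show ?case
  proof cases
    case (3 m)
    with less.IH[of m] less.IH[of "Suc m"] show ?thesis
      by (simp add: zonal.simps(3) algebra_simps)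
  qed auto
qed

text \<open>One factor of each square in \<open>x \<bullet> x\<close> is integrated by parts, which
  produces the dimension and two radial derivatives. Euler's relation handles that of
  \<open>zonal k n\<close>, and Green's identity shows that under the integral the radial derivative
  of \<open>h\<close> also acts as multiplication by \<open>n\<close>, although \<open>h\<close>
  need not be homogeneous.\<close>

lemma ball_integral_inner_self_zonal:
  assumes h: "h \<in> harmonic_functions" and R: "R > 0" and p: "p \<ge> 1"
  shows "2 * real (Suc p) * ball_integral R p (\<lambda>x. (x \<bullet> x) * (h x * zonal k n x)) =
    (real CARD('n) + 2 * real n) * ball_integral R (Suc p) (\<lambda>x. h x * zonal k n x)"
proof -
  let ?Q = "zonal k n" and ?I = "ball_integral R (Suc p)"
  note hQ = harmonicD(1)[OF h] harmonicD(1)[OF zonal_harmonic, of n]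
  note c [continuous_intros] = C1_continuous_on[OF hQ(1)] C1_continuous_on[OF hQ(2)]
    C1_continuous_on_partial[OF hQ(1)] C1_continuous_on_partial[OF hQ(2)]
  have c1: "C1_fun (\<lambda>x. x $ i * (h x * ?Q x))" for i
    by (intro C1_mult C1_coord hQ)
  have pp: "partial i (\<lambda>x. x $ i * (h x * ?Q x)) =
      (\<lambda>x. h x * ?Q x + (?Q x * (x $ i * partial i h x) + h x * (x $ i * partial i ?Q x)))" for i
    unfolding C1_mult(2)[OF C1_coord C1_mult(1)[OF hQ]] C1_mult(2)[OF hQ] partial_coord
    by (simp add: algebra_simps)
  have eq: "?I (\<lambda>x. ?Q x * radial_derivative h x) = real n * ?I (\<lambda>x. h x * ?Q x)"
  proof -
    have "2 * real (Suc (Suc p)) * ?I (\<lambda>x. ?Q x * radial_derivative h x)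
       = ball_integral R (Suc (Suc p)) (\<lambda>x. \<Sum>i\<in>UNIV. partial i ?Q x * partial i h x)"
      by (intro ball_integral_radial_derivative h hQ R) simp
    also have "\<dots> = ball_integral R (Suc (Suc p)) (\<lambda>x. \<Sum>i\<in>UNIV. partial i h x * partial i ?Q x)"
      by (simp add: mult.commute)
    also have "\<dots> = 2 * real (Suc (Suc p)) * ?I (\<lambda>x. h x * radial_derivative ?Q x)"
      by (intro ball_integral_radial_derivative[symmetric] zonal_harmonic hQ R) simp
    also have "(\<lambda>x. h x * radial_derivative ?Q x) = (\<lambda>x. real n * (h x * ?Q x))"
      by (simp add: zonal_radial_derivative mult_ac)
    finally show ?thesis by (simp add: ball_integral_cmult)
  qed
  have "2 * real (Suc p) * ball_integral R p (\<lambda>x. (x \<bullet> x) * (h x * ?Q x))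
      = 2 * real (Suc p) * ball_integral R p (\<lambda>x. \<Sum>i\<in>UNIV. x $ i * (x $ i * (h x * ?Q x)))"
    by (simp add: inner_vec_def sum_distrib_right mult.assoc)
  also have "\<dots> = (\<Sum>i\<in>UNIV. 2 * real (Suc p) * ball_integral R p (\<lambda>x. x $ i * (x $ i * (h x * ?Q x))))"
    using R p by (subst ball_integral_sum) (auto intro!: continuous_intros simp: sum_distrib_left)
  also have "\<dots> = (\<Sum>i\<in>UNIV. ?I (partial i (\<lambda>x. x $ i * (h x * ?Q x))))"
    by (intro sum.cong refl ball_integral_ibp[symmetric] c1 R p)
  also have "\<dots> = ?I (\<lambda>x. \<Sum>i\<in>UNIV. partial i (\<lambda>x. x $ i * (h x * ?Q x)) x)"
    using R by (intro ball_integral_sum[symmetric] C1_continuous_on_partial c1) auto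
  also have "(\<lambda>x. \<Sum>i\<in>UNIV. partial i (\<lambda>x. x $ i * (h x * ?Q x)) x) =
      (\<lambda>x. real CARD('n) * (h x * ?Q x) + (?Q x * radial_derivative h x + h x * radial_derivative ?Q x))"
    unfolding pp by (simp add: sum.distrib sum_distrib_left)
  also have "\<dots> = (\<lambda>x. (real CARD('n) + real n) * (h x * ?Q x) + ?Q x * radial_derivative h x)"
    by (simp add: zonal_radial_derivative algebra_simps)
  also have "?I \<dots> = (real CARD('n) + real n) * ?I (\<lambda>x. h x * ?Q x) + ?I (\<lambda>x. ?Q x * radial_derivative h x)"
    using R by (subst ball_integral_add) (auto intro!: continuous_intros simp: ball_integral_cmult)
  also have "\<dots> = (real CARD('n) + 2 * real n) * ?I (\<lambda>x. h x * ?Q x)"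
    by (simp add: eq algebra_simps)
  finally show ?thesis .
qed

text \<open>The case \<open>h = 1\<close> in degree 0 of the previous lemma, combined with
  \<open>ball_weight_Suc\<close>.\<close>

lemma ball_integral_1_Suc:
  assumes R: "R > 0" and p: "p \<ge> 1"
  shows "(2 * real (Suc p) + real CARD('n)) * ball_integral R (Suc p) (\<lambda>x::real^'n. 1)
      = 2 * real (Suc p) * R\<^sup>2 * ball_integral R p (\<lambda>x::real^'n. 1)"
proof -
  have h1: "(\<lambda>x::real^'n. 1) \<in> harmonic_functions"
    by (intro harmonicI) (auto simp: C1_const)
  have c: "continuous_on UNIV (\<lambda>x::real^'n. x \<bullet> x)"
    by (intro continuous_intros)
  have "ball_integral R (Suc p) (\<lambda>x::real^'n. 1) = ball_integral R p (\<lambda>x::real^'n. R\<^sup>2 - x \<bullet> x)"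
    unfolding ball_integral_def ball_weight_Suc[OF p] by simp
  also have "\<dots> = R\<^sup>2 * ball_integral R p (\<lambda>x::real^'n. 1) - ball_integral R p (\<lambda>x::real^'n. x \<bullet> x)"
    using ball_integral_diff[OF continuous_on_const[of UNIV "R\<^sup>2"] c R p] ball_integral_cmult[of R p "R\<^sup>2" "\<lambda>x::real^'n. 1"]
    by simp
  finally have "2 * real (Suc p) * ball_integral R (Suc p) (\<lambda>x::real^'n. 1) =
      2 * real (Suc p) * R\<^sup>2 * ball_integral R p (\<lambda>x::real^'n. 1) - 2 * real (Suc p) * ball_integral R p (\<lambda>x::real^'n. x \<bullet> x)"
    by (simp add: right_diff_distrib)
  then show ?thesis
    using ball_integral_inner_self_zonal[OF h1 R p, of 0] unfolding distrib_right by simp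
qed

end

text \<open>The product of the leading coefficients of the recurrence: the coefficient of the
  \<open>n\<close>-th power of \<open>x $ k\<close> when \<open>zonal k n\<close> is written as a
  polynomial in \<open>x $ k\<close> and \<open>x \<bullet> x\<close>.\<close>

fun zonal_factor :: "real \<Rightarrow> nat \<Rightarrow> real" where
  "zonal_factor N 0 = 1"
| "zonal_factor N (Suc 0) = 1"
| "zonal_factor N (Suc (Suc n)) = (2 * real n + N) / (real n + N - 1) * zonal_factor N (Suc n)"

declare zonal_factor.simps(3) [simp del]

lemma zonal_factor_pos: "N \<ge> 2 \<Longrightarrow> zonal_factor N n > 0"
  by (induction N n rule: zonal_factor.induct) (auto simp: zonal_factor.simps(3))

context
  fixes k :: "'n::finite"
  assumes N: "CARD('n) \<ge> 2"
begin

text \<open>Integrating by parts in every term of the recurrence, the lower-order terms cancel because \<open>h\<close>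
  is harmonic.\<close>

lemma ball_integral_zonal_step:
  assumes h: "h \<in> harmonic_functions" and R: "R > 0" and p: "p \<ge> 1"
  shows "zonal_factor (real CARD('n)) n * (2 * real (Suc p) * ball_integral R p (\<lambda>x. h x * zonal k (Suc n) x)) =
    zonal_factor (real CARD('n)) (Suc n) * ball_integral R (Suc p) (\<lambda>x. partial k h x * zonal k n x)"
proof (cases n)
  case 0
  then show ?thesis
    using ball_integral_ibp[OF harmonicD(1)[OF h] R p, of k] by (simp add: mult.commute)
next
  case (Suc m)
  let ?N = "real CARD('n)" and ?I = "ball_integral R (Suc p)"
  have pos: "real m + ?N - 1 > 0" using N by linarith
  note hQ = harmonicD(1)[OF h] harmonicD(1)[OF zonal_harmonic[OF N, of k]]
  note c [continuous_intros] = C1_continuous_on[OF hQ(1)] C1_continuous_on[OF hQ(2)]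
    C1_continuous_on_partial[OF hQ(1)] C1_continuous_on_partial[OF hQ(2)]
  have "2 * real (Suc p) * ball_integral R p (\<lambda>x. x $ k * (h x * zonal k (Suc m) x))
     = ?I (partial k (\<lambda>x. h x * zonal k (Suc m) x))"
    by (intro ball_integral_ibp[symmetric] C1_mult hQ R p)
  also have "partial k (\<lambda>x. h x * zonal k (Suc m) x) =
      (\<lambda>x. partial k h x * zonal k (Suc m) x + (real m + 1) * (h x * zonal k m x))"
    unfolding C1_mult(2)[OF hQ] zonal_partial[OF N] by (simp add: algebra_simps)
  also have "?I \<dots> = ?I (\<lambda>x. partial k h x * zonal k (Suc m) x) + (real m + 1) * ?I (\<lambda>x. h x * zonal k m x)"
    using R by (subst ball_integral_add) (auto intro!: continuous_intros simp: ball_integral_cmult)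
  finally have 1: "2 * real (Suc p) * ball_integral R p (\<lambda>x. x $ k * (h x * zonal k (Suc m) x))
     = ?I (\<lambda>x. partial k h x * zonal k (Suc m) x) + (real m + 1) * ?I (\<lambda>x. h x * zonal k m x)" .
  note 2 = ball_integral_inner_self_zonal[OF N h R p, of k m]
  define c d where "c = (2 * real m + ?N) / (real m + ?N - 1)"
    and "d = - ((real m + 1) / (real m + ?N - 1))"
  have "(\<lambda>x. h x * zonal k (Suc n) x) =
     (\<lambda>x. c * (x $ k * (h x * zonal k (Suc m) x)) + d * ((x \<bullet> x) * (h x * zonal k m x)))"
    unfolding Suc zonal.simps(3) c_def[symmetric] d_def[symmetric] by (simp add: algebra_simps)
  moreover have "ball_integral R p \<dots> = c * ball_integral R p (\<lambda>x. x $ k * (h x * zonal k (Suc m) x))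
       + d * ball_integral R p (\<lambda>x. (x \<bullet> x) * (h x * zonal k m x))"
    using R p by (subst ball_integral_add) (auto intro!: continuous_intros simp: ball_integral_cmult)
  ultimately have "2 * real (Suc p) * ball_integral R p (\<lambda>x. h x * zonal k (Suc n) x) =
      c * (2 * real (Suc p) * ball_integral R p (\<lambda>x. x $ k * (h x * zonal k (Suc m) x)))
       + d * (2 * real (Suc p) * ball_integral R p (\<lambda>x. (x \<bullet> x) * (h x * zonal k m x)))"
    by (simp only:) (simp add: algebra_simps)
  also have "\<dots> = (2 * real m + ?N) / (real m + ?N - 1) * ?I (\<lambda>x. partial k h x * zonal k (Suc m) x)"
  proof -
    \<comment> \<open>Here \<open>Y\<close> is the integral of \<open>h * zonal k m\<close> with
      exponent \<open>Suc p\<close>; it enters through both terms of the recurrence, with opposite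
      coefficients.\<close>
    have "a / M * (X + b * Y) + (- (b / M)) * (a * Y) = a / M * X" for a b M X Y :: real
      by (simp add: distrib_left)
    then show ?thesis unfolding 1 2 c_def d_def add.commute[of ?N "2 * real m"] .
  qed
  finally show ?thesis by (simp add: Suc zonal_factor.simps(3))
qed

text \<open>Each use of \<open>ball_integral_zonal_step\<close> lowers the degree, differentiates
  \<open>h\<close> once and raises the exponent; after \<open>n\<close> of them the polynomial is
  constant and the mean value property applies. The Pochhammer symbol collects the factors
  \<open>q + 1\<close>, ..., \<open>q + n\<close>.\<close>

lemma ball_integral_zonal:
  assumes "h \<in> harmonic_functions" and R: "R > 0" and "q \<ge> 1"
  shows "2 ^ n * pochhammer (real q + 1) n * ball_integral R q (\<lambda>x. h x * zonal k n x) =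
    zonal_factor (real CARD('n)) n * ball_integral R (q + n) (\<lambda>x::real^'n. 1) * (partial k ^^ n) h 0"
  using assms(1,3)
proof (induction n arbitrary: q h)
  case 0
  then show ?case using harmonic_mean_value[OF _ R] by (simp add: mult.commute)
next
  case (Suc n)
  let ?k = "zonal_factor (real CARD('n))"
  have kp: "?k n > 0" using N by (intro zonal_factor_pos) simp
  have IH: "2 ^ n * pochhammer (real q + 2) n * ball_integral R (Suc q) (\<lambda>x. partial k h x * zonal k n x) =
      ?k n * ball_integral R (Suc q + n) (\<lambda>x::real^'n. 1) * (partial k ^^ n) (partial k h) 0"
    using Suc.IH[OF harmonic_partial[OF Suc.prems(1)], of "Suc q"] by (simp add: add_ac)
  have "?k n * (2 ^ Suc n * pochhammer (real q + 1) (Suc n) * ball_integral R q (\<lambda>x. h x * zonal k (Suc n) x))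
    = 2 ^ n * pochhammer (real q + 2) n * (?k n * (2 * real (Suc q) * ball_integral R q (\<lambda>x. h x * zonal k (Suc n) x)))"
    by (simp add: pochhammer_rec algebra_simps)
  also have "\<dots> = ?k (Suc n) * (2 ^ n * pochhammer (real q + 2) n * ball_integral R (Suc q) (\<lambda>x. partial k h x * zonal k n x))"
    unfolding ball_integral_zonal_step[OF Suc.prems(1) R Suc.prems(2)] by simp
  also have "\<dots> = ?k n * (?k (Suc n) * ball_integral R (q + Suc n) (\<lambda>x::real^'n. 1) * (partial k ^^ Suc n) h 0)"
    unfolding IH by (simp add: funpow_Suc_right del: funpow.simps)
  finally show ?case using kp by simp
qed

lemma zonal_funpow_partial:
  "(partial k ^^ j) (zonal k n) = (\<lambda>x. (if j \<le> n then fact n / fact (n - j) * zonal k (n - j) x else 0))"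
proof (induction j)
  case (Suc j)
  show ?case
  proof (cases "Suc j \<le> n")
    case True
    then have "(partial k ^^ Suc j) (zonal k n) = partial k (\<lambda>x. fact n / fact (n - j) * zonal k (n - j) x)"
      by (simp add: Suc)
    also have "\<dots> = (\<lambda>x. fact n / fact (n - j) * (real (n - j) * zonal k (n - j - 1) x))"
      unfolding C1_cmult(2)[OF harmonicD(1)[OF zonal_harmonic[OF N]]] zonal_partial[OF N] ..
    also have "fact (n - j) = real (n - j) * fact (n - Suc j)"
      using True by (metis Suc_diff_Suc Suc_le_eq fact_Suc)
    finally show ?thesis using True by (auto simp: fun_eq_iff)
  next
    case False
    have "(partial k ^^ Suc j) (zonal k n) = (\<lambda>x. 0)"
    proof (cases "j = n")
      case True
      then have "(partial k ^^ j) (zonal k n) = (\<lambda>x. fact n)" using Suc.IH by simp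
      then show ?thesis by simp
    next
      case False
      then show ?thesis using \<open>\<not> Suc j \<le> n\<close> by (simp add: Suc)
    qed
    then show ?thesis using False by simp
  qed
qed auto

lemma zonal_0: "zonal k n 0 = (if n = 0 then 1 else 0)"
  using zonal_homogeneous[OF N, of k n 0 0] by (cases n) auto

text \<open>For \<open>h\<close> a zonal polynomial the derivative at the origin is nonzero in the
  matching degree only. Orthogonality and norms thus come together, without an eigenvalue argument
  on the sphere.\<close>

lemma ball_integral_zonal_zonal:
  assumes R: "R > 0" and q: "q \<ge> 1"
  shows "2 ^ n * pochhammer (real q + 1) n * ball_integral R q (\<lambda>x. zonal k m x * zonal k n x) =
    (if m = n then zonal_factor (real CARD('n)) n * ball_integral R (q + n) (\<lambda>x::real^'n. 1) * fact n else 0)"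
  using ball_integral_zonal[OF zonal_harmonic[OF N, of k m] R q, of n]
  by (auto simp: zonal_funpow_partial zonal_0)

end

section \<open>Polar coordinates\<close>

lemma nn_integral_lborel_scale:
  fixes F :: "'a::euclidean_space \<Rightarrow> ennreal"
  assumes [measurable]: "F \<in> borel_measurable borel" and c: "c > 0"
  shows "(\<integral>\<^sup>+x. F x \<partial>lborel) = ennreal (c ^ DIM('a)) * (\<integral>\<^sup>+x. F (c *\<^sub>R x) \<partial>lborel)"
proof -
  have "(\<integral>\<^sup>+x. F x \<partial>lborel) = (\<integral>\<^sup>+x. F x \<partial>(density (distr lborel borel (\<lambda>x. 0 + c *\<^sub>R x)) (\<lambda>_. \<bar>c\<bar>^DIM('a))))"
    using c by (subst lborel_affine[of c 0]) auto
  also have "\<dots> = ennreal (c ^ DIM('a)) * (\<integral>\<^sup>+x. F (c *\<^sub>R x) \<partial>lborel)"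
    using c by (simp add: nn_integral_density nn_integral_distr nn_integral_cmult)
  finally show ?thesis .
qed

lemma measurable_sphere_surface:
  assumes "F \<in> borel_measurable borel"
  shows "F \<in> borel_measurable (sphere_surface_measure r)"
  using measurable_restrict_space1[OF assms]
  by (simp cong: measurable_cong_sets[OF sets_sphere_surface_measure refl])

lemma nn_integral_sphere_surface:
  fixes F :: "real ^ 'n::finite \<Rightarrow> ennreal"
  assumes F [measurable]: "F \<in> borel_measurable borel" and r: "r > 0"
  shows "(\<integral>\<^sup>+x. F x \<partial>sphere_surface_measure r) = ennreal (real CARD('n) / r) *
     (\<integral>\<^sup>+x. F ((r / norm x) *\<^sub>R x) * indicator (cball 0 r - {0}) x \<partial>lborel)"
proof -
  let ?B = "cball 0 r - {0} :: (real ^ 'n) set" and ?p = "\<lambda>x::real ^ 'n. (r / norm x) *\<^sub>R x"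
  have B: "?B \<in> sets borel" by auto
  have meas: "?p \<in> measurable (restrict_space lborel ?B) (restrict_space borel (sphere 0 r))"
    using r by (intro measurable_restrict_space2 measurable_restrict_space1) auto
  have F': "F \<in> borel_measurable (distr (restrict_space lborel ?B) (restrict_space borel (sphere 0 r)) ?p)"
    using measurable_restrict_space1[OF F] by simp
  have "(\<integral>\<^sup>+x. F x \<partial>sphere_surface_measure r) = ennreal (real CARD('n) / r) *
     (\<integral>\<^sup>+x. F (?p x) \<partial>restrict_space lborel ?B)"
    unfolding sphere_surface_measure_def
    by (subst nn_integral_scale_measure) (use F' in \<open>auto simp: nn_integral_distr[OF meas F']\<close>)
  also have "(\<integral>\<^sup>+x. F (?p x) \<partial>restrict_space lborel ?B) = (\<integral>\<^sup>+x. F (?p x) * indicator ?B x \<partial>lborel)"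
    using B by (intro nn_integral_restrict_space) auto
  finally show ?thesis .
qed

lemma nn_integral_sphere_surface_scale:
  fixes F :: "real ^ 'n::finite \<Rightarrow> ennreal"
  assumes F [measurable]: "F \<in> borel_measurable borel" and r: "r > 0"
  shows "(\<integral>\<^sup>+x. F x \<partial>sphere_surface_measure r) =
     ennreal (r ^ (CARD('n) - 1)) * (\<integral>\<^sup>+x. F (r *\<^sub>R x) \<partial>sphere_surface_measure 1)"
proof -
  let ?N = "CARD('n)"
  have "(\<integral>\<^sup>+x. F x \<partial>sphere_surface_measure r) = ennreal (real ?N / r) *
     (\<integral>\<^sup>+x. F ((r / norm x) *\<^sub>R x) * indicator (cball 0 r - {0}) x \<partial>lborel)"
    by (rule nn_integral_sphere_surface[OF F r])
  also have "(\<integral>\<^sup>+x. F ((r / norm x) *\<^sub>R x) * indicator (cball 0 r - {0}) x \<partial>lborel)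
     = ennreal (r ^ ?N) * (\<integral>\<^sup>+x. F ((r / norm (r *\<^sub>R x)) *\<^sub>R (r *\<^sub>R x)) * indicator (cball 0 r - {0}) (r *\<^sub>R (x::real^'n)) \<partial>lborel)"
    by (subst nn_integral_lborel_scale[of _ r]) (measurable, use r in simp_all)
  also have "(\<lambda>x::real^'n. F ((r / norm (r *\<^sub>R x)) *\<^sub>R (r *\<^sub>R x)) * indicator (cball 0 r - {0}) (r *\<^sub>R x)) =
     (\<lambda>x. F (r *\<^sub>R ((1 / norm x) *\<^sub>R x)) * indicator (cball 0 1 - {0}) x)"
    using r by (auto simp: fun_eq_iff indicator_def)
  also have "ennreal (real ?N / r) * (ennreal (r ^ ?N) * (\<integral>\<^sup>+x. F (r *\<^sub>R ((1 / norm x) *\<^sub>R x)) * indicator (cball 0 1 - {0}) (x::real^'n) \<partial>lborel))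
    = ennreal (r ^ (?N - 1)) * (ennreal (real ?N / 1) * (\<integral>\<^sup>+x. F (r *\<^sub>R ((1 / norm x) *\<^sub>R x)) * indicator (cball 0 1 - {0}) (x::real^'n) \<partial>lborel))"
  proof -
    have "r ^ ?N = r * r ^ (?N - 1)"
      by (metis zero_less_card_finite power_Suc Suc_diff_1)
    then have "real ?N / r * r ^ ?N = r ^ (?N - 1) * (real ?N / 1)"
      using r by simp
    then show ?thesis
      using r by (simp only: mult.assoc[symmetric] ennreal_mult'[symmetric] ennreal_mult[symmetric])
         (simp add: ennreal_mult[symmetric] mult.assoc[symmetric])
  qed
  also have "ennreal (real ?N / 1) * (\<integral>\<^sup>+x. F (r *\<^sub>R ((1 / norm x) *\<^sub>R x)) * indicator (cball 0 1 - {0}) (x::real^'n) \<partial>lborel)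
     = (\<integral>\<^sup>+x. F (r *\<^sub>R x) \<partial>sphere_surface_measure 1)"
    by (subst nn_integral_sphere_surface[of "\<lambda>x. F (r *\<^sub>R x)" 1]) simp_all
  finally show ?thesis .
qed

text \<open>The radial mass left over in the proof of \<open>nn_integral_polar\<close>. That it is
  exactly 1 confirms the factor \<open>N / r\<close> in the cone definition of surface
  measure.\<close>

lemma nn_integral_power_tail:
  assumes "N \<ge> 1"
  shows "(\<integral>\<^sup>+t. ennreal (real N / t ^ Suc N) * indicator {1..} t \<partial>lborel) = 1"
proof -
  have "(\<integral>\<^sup>+t. ennreal (real N / t ^ Suc N) * indicator {1..} t \<partial>lborel) = ennreal (0 - (- (1 / 1 ^ N)))"
  proof (rule nn_integral_FTC_atLeast[where F="\<lambda>t::real. - (1 / t ^ N)" and T=0])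
    show "((\<lambda>t::real. - (1 / t ^ N)) \<longlongrightarrow> 0) at_top"
    proof -
      have "((\<lambda>t::real. inverse (t ^ N)) \<longlongrightarrow> 0) at_top"
        using assms by (intro tendsto_inverse_0_at_top filterlim_pow_at_top filterlim_ident) auto
      from tendsto_minus[OF this] show ?thesis by (simp add: inverse_eq_divide)
    qed
    show "((\<lambda>t. - (1 / t ^ N)) has_field_derivative real N / x ^ Suc N) (at x)" if "1 \<le> x" for x
    proof -
      have "((\<lambda>t. - (1 / t ^ N)) has_field_derivative (real N * x ^ (N - 1)) / (x ^ N * x ^ N)) (at x)"
        using that by (auto intro!: derivative_eq_intros simp: field_simps)
      moreover have "x ^ N = x * x ^ (N - 1)"
        using assms by (cases N) auto
      ultimately show ?thesis using that by (simp add: field_simps)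
    qed
  qed (auto intro!: divide_nonneg_nonneg)
  then show ?thesis by simp
qed

text \<open>Unfolding the cone definition gives a double integral over \<open>r\<close> and
  \<open>x\<close> with \<open>norm x \<le> r\<close>. Exchanging the order, substituting
  \<open>r = norm x * t\<close> and exchanging back, each \<open>t \<ge> 1\<close> contributes the
  whole integral of \<open>F\<close>, weighted by a density of total mass 1.\<close>

lemma nn_integral_polar:
  fixes F :: "real ^ 'n::finite \<Rightarrow> ennreal"
  assumes F [measurable]: "F \<in> borel_measurable borel"
  shows "(\<integral>\<^sup>+x. F x \<partial>lborel) =
    (\<integral>\<^sup>+r. (\<integral>\<^sup>+x. F x \<partial>sphere_surface_measure r) * indicator {0<..} r \<partial>lborel)"
proof -
  let ?N = "CARD('n)"
  let ?G = "\<lambda>r x::real^'n. ennreal (real ?N / r) * F ((r / norm x) *\<^sub>R x) * indicator {0<..} r * indicator {r. norm x \<le> r} r"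
  have ms: "{z::real \<times> (real^'n). norm (snd z) \<le> fst z} \<in> sets (borel \<Otimes>\<^sub>M borel)"
    unfolding borel_prod by (intro borel_closed closed_Collect_le continuous_intros)
  have G [measurable]: "(\<lambda>(r, x). ?G r x) \<in> borel_measurable (borel \<Otimes>\<^sub>M borel)"
  proof -
    have "(\<lambda>(r, x). ?G r x) = (\<lambda>z::real \<times> (real^'n). ennreal (real ?N / fst z) * F ((fst z / norm (snd z)) *\<^sub>R snd z)
       * indicator {0<..} (fst z) * indicator {z. norm (snd z) \<le> fst z} z)"
      by (auto simp: fun_eq_iff indicator_def)
    also have "\<dots> \<in> borel_measurable (borel \<Otimes>\<^sub>M borel)"
      using ms by measurable
    finally show ?thesis .
  qed
  have "(\<integral>\<^sup>+r. (\<integral>\<^sup>+x. F x \<partial>sphere_surface_measure r) * indicator {0<..} r \<partial>lborel)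
      = (\<integral>\<^sup>+r. (\<integral>\<^sup>+x. ?G r x \<partial>lborel) \<partial>lborel)"
  proof (rule nn_integral_cong)
    fix r :: real
    show "(\<integral>\<^sup>+x. F x \<partial>sphere_surface_measure r) * indicator {0<..} r = (\<integral>\<^sup>+x. ?G r x \<partial>lborel)"
    proof (cases "r > 0")
      case True
      have "(\<integral>\<^sup>+x. ?G r x \<partial>lborel) = (\<integral>\<^sup>+x. ennreal (real ?N / r) * (F ((r / norm x) *\<^sub>R x) * indicator (cball 0 r - {0}) x) \<partial>lborel)"
      proof (rule nn_integral_cong_AE)
        have "AE x in lborel. x \<noteq> (0::real^'n)" by (rule AE_lborel_singleton)
        then show "AE x in lborel. ?G r x = ennreal (real ?N / r) * (F ((r / norm x) *\<^sub>R x) * indicator (cball 0 r - {0}) x)"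
          by eventually_elim (use True in \<open>auto simp: indicator_def\<close>)
      qed
      also have "\<dots> = ennreal (real ?N / r) * (\<integral>\<^sup>+x. F ((r / norm x) *\<^sub>R x) * indicator (cball 0 r - {0}) x \<partial>lborel)"
      proof (rule nn_integral_cmult)
        show "(\<lambda>x::real^'n. F ((r / norm x) *\<^sub>R x) * indicator (cball 0 r - {0}) x) \<in> borel_measurable lborel"
        proof (rule borel_measurable_times_ennreal)
          show "(\<lambda>x::real^'n. F ((r / norm x) *\<^sub>R x)) \<in> borel_measurable lborel"
            by measurable
          show "(indicator (cball 0 r - {0}) :: real^'n \<Rightarrow> ennreal) \<in> borel_measurable lborel"
            by (rule borel_measurable_indicator) auto
        qed
      qed
      finally show ?thesis
        using True by (simp add: nn_integral_sphere_surface[OF F True])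
    qed simp
  qed
  also have "\<dots> = (\<integral>\<^sup>+x. (\<integral>\<^sup>+r. ?G r x \<partial>lborel) \<partial>lborel)"
    by (rule lborel_pair.Fubini') (use G in simp)
  also have "\<dots> = (\<integral>\<^sup>+x. (\<integral>\<^sup>+t. ennreal (real ?N / t) * F (t *\<^sub>R x) * indicator {1..} t \<partial>lborel) \<partial>lborel)"
  proof (rule nn_integral_cong_AE)
    have "AE x in lborel. x \<noteq> (0::real^'n)" by (rule AE_lborel_singleton)
    then show "AE x in lborel. (\<integral>\<^sup>+r. ?G r x \<partial>lborel) =
        (\<integral>\<^sup>+t. ennreal (real ?N / t) * F (t *\<^sub>R x) * indicator {1..} t \<partial>lborel)"
    proof eventually_elim
      fix x :: "real^'n" assume x: "x \<noteq> 0"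
      then have nx: "norm x > 0" by simp
      have "(\<integral>\<^sup>+r. ?G r x \<partial>lborel) = ennreal (norm x) * (\<integral>\<^sup>+t. ?G (0 + norm x * t) x \<partial>lborel)"
        using nx by (subst nn_integral_real_affine[of _ "norm x" 0]) auto
      also have "\<dots> = (\<integral>\<^sup>+t. ennreal (norm x) * ?G (0 + norm x * t) x \<partial>lborel)"
        by (rule nn_integral_cmult[symmetric]) measurable
      also have "\<dots> = (\<integral>\<^sup>+t. ennreal (real ?N / t) * F (t *\<^sub>R x) * indicator {1..} t \<partial>lborel)"
      proof (rule nn_integral_cong)
        fix t :: real
        show "ennreal (norm x) * ?G (0 + norm x * t) x = ennreal (real ?N / t) * F (t *\<^sub>R x) * indicator {1..} t"
        proof (cases "t \<ge> 1")
          case True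
          then have "norm x * t > 0" "norm x \<le> norm x * t" using nx by auto
          moreover have "ennreal (norm x) * ennreal (real ?N / (norm x * t)) = ennreal (real ?N / t)"
            using nx True by (subst ennreal_mult[symmetric]) auto
          ultimately show ?thesis using True nx by (simp add: mult.assoc[symmetric])
        next
          case False
          then have "\<not> norm x \<le> norm x * t" using nx by auto
          then show ?thesis using False by simp
        qed
      qed
      finally show "(\<integral>\<^sup>+r. ?G r x \<partial>lborel) = (\<integral>\<^sup>+t. ennreal (real ?N / t) * F (t *\<^sub>R x) * indicator {1..} t \<partial>lborel)" .
    qed
  qed
  also have "\<dots> = (\<integral>\<^sup>+t. (\<integral>\<^sup>+x. ennreal (real ?N / t) * F (t *\<^sub>R x) * indicator {1..} t \<partial>lborel) \<partial>lborel)"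
    by (rule lborel_pair.Fubini') measurable
  also have "\<dots> = (\<integral>\<^sup>+t. (\<integral>\<^sup>+x. F x \<partial>lborel) * (ennreal (real ?N / t ^ Suc ?N) * indicator {1..} t) \<partial>lborel)"
  proof (rule nn_integral_cong)
    fix t :: real
    show "(\<integral>\<^sup>+x. ennreal (real ?N / t) * F (t *\<^sub>R x) * indicator {1..} t \<partial>lborel)
        = (\<integral>\<^sup>+x. F x \<partial>lborel) * (ennreal (real ?N / t ^ Suc ?N) * indicator {1..} t)"
    proof (cases "t \<ge> 1")
      case True
      then have "(\<integral>\<^sup>+x. F x \<partial>lborel) = ennreal (t ^ ?N) * (\<integral>\<^sup>+x. F (t *\<^sub>R x) \<partial>lborel)"
        by (subst nn_integral_lborel_scale[OF F, of t]) auto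
      then have "(\<integral>\<^sup>+x. F x \<partial>lborel) * ennreal (real ?N / t ^ Suc ?N)
          = (ennreal (real ?N / t ^ Suc ?N) * ennreal (t ^ ?N)) * (\<integral>\<^sup>+x. F (t *\<^sub>R x) \<partial>lborel)"
        by (simp add: mult_ac)
      also have "ennreal (real ?N / t ^ Suc ?N) * ennreal (t ^ ?N) = ennreal (real ?N / t)"
        using True by (subst ennreal_mult[symmetric]) auto
      finally show ?thesis using True by (simp add: nn_integral_cmult)
    qed simp
  qed
  also have "\<dots> = (\<integral>\<^sup>+x. F x \<partial>lborel) * 1"
    by (subst nn_integral_cmult, measurable, subst nn_integral_power_tail) auto
  finally show ?thesis by simp
qed

definition sphere_area :: "'n::finite itself \<Rightarrow> real" where
  "sphere_area _ = measure (sphere_surface_measure 1 :: (real ^ 'n) measure) (sphere 0 1)"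

lemma emeasure_unit_sphere:
  "emeasure (sphere_surface_measure 1 :: (real ^ 'n::finite) measure) (sphere 0 1) = ennreal (sphere_area TYPE('n))"
  and sphere_area_pos: "sphere_area TYPE('n) > 0"
proof -
  let ?M = "sphere_surface_measure 1 :: (real ^ 'n) measure"
  have S: "sphere 0 1 \<in> sets ?M"
    by (metis sets.top space_sphere_surface_measure)
  interpret prob_space "normalised_sphere_measure 1 :: (real ^ 'n) measure"
    by (rule prob_space_normalised_sphere_measure) simp
  \<comment> \<open>In the extended nonnegative reals a quotient \<open>a / a\<close> equals 1 only
    if \<open>a\<close> is neither zero nor infinite.\<close>
  have e: "emeasure ?M (sphere 0 1) / emeasure ?M (sphere 0 1) = 1"
    using emeasure_space_1 S unfolding normalised_sphere_measure_def
    by simp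
  have e0: "emeasure ?M (sphere 0 1) \<noteq> 0"
    using e by auto
  have "emeasure ?M (sphere 0 1) \<noteq> \<top>"
    using e by auto
  from emeasure_eq_ennreal_measure[OF this]
  show *: "emeasure ?M (sphere 0 1) = ennreal (sphere_area TYPE('n))"
    by (simp add: sphere_area_def)
  show "sphere_area TYPE('n) > 0"
    using e0 unfolding * by (simp add: ennreal_eq_0_iff)
qed

lemma nn_integral_normalised_sphere:
  fixes F :: "real ^ 'n::finite \<Rightarrow> ennreal"
  assumes F [measurable]: "F \<in> borel_measurable borel" and r: "r > 0"
  shows "ennreal (sphere_area TYPE('n)) * (\<integral>\<^sup>+x. F x \<partial>normalised_sphere_measure r)
     = (\<integral>\<^sup>+x. F (r *\<^sub>R x) \<partial>sphere_surface_measure 1)"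
proof -
  let ?M = "sphere_surface_measure r :: (real ^ 'n) measure" and ?a = "sphere_area TYPE('n)"
  let ?c = "r ^ (CARD('n) - 1)" and ?J = "\<integral>\<^sup>+x. F (r *\<^sub>R x) \<partial>sphere_surface_measure 1"
  have S: "sphere 0 r \<in> sets ?M"
    by (metis sets.top space_sphere_surface_measure)
  have c: "?c > 0" using r by simp
  have m: "emeasure ?M (sphere 0 r) = ennreal (?c * ?a)"
  proof -
    have "emeasure ?M (sphere 0 r) = (\<integral>\<^sup>+x. 1 \<partial>?M)" by simp
    also have "\<dots> = ennreal ?c * emeasure (sphere_surface_measure 1 :: (real^'n) measure) (sphere 0 1)"
      by (subst nn_integral_sphere_surface_scale[OF _ r]) simp_all
    finally show ?thesis using c by (simp add: emeasure_unit_sphere ennreal_mult sphere_area_pos less_imp_le)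
  qed
  have "(\<integral>\<^sup>+x. F x \<partial>normalised_sphere_measure r) = (\<integral>\<^sup>+x. F x * indicator (sphere 0 r) x \<partial>?M) / emeasure ?M (sphere 0 r)"
    unfolding normalised_sphere_measure_def
    by (rule nn_integral_uniform_measure[OF measurable_sphere_surface[OF F] S])
  also have "(\<integral>\<^sup>+x. F x * indicator (sphere 0 r) x \<partial>?M) = (\<integral>\<^sup>+x. F x \<partial>?M)"
    by (rule nn_integral_cong) simp
  also have "\<dots> = ennreal ?c * ?J"
    by (rule nn_integral_sphere_surface_scale[OF F r])
  finally have "ennreal ?a * (\<integral>\<^sup>+x. F x \<partial>normalised_sphere_measure r) = ennreal ?a * ((ennreal ?c * ?J) / ennreal (?c * ?a))"
    using m by simp
  also have "\<dots> = ((ennreal ?c * ennreal ?a) * ?J) / ennreal (?c * ?a)"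
    by (simp add: ennreal_times_divide mult_ac)
  also have "ennreal ?c * ennreal ?a = ennreal (?c * ?a)"
    using c sphere_area_pos[where ?'n='n] by (simp add: ennreal_mult less_imp_le)
  also have "(ennreal (?c * ?a) * ?J) / ennreal (?c * ?a) = ?J"
    using mult_pos_pos[OF c sphere_area_pos[where ?'n='n]]
    by (subst mult.commute[of _ ?J]) (rule ennreal_mult_divide_eq, use r sphere_area_pos[where ?'n='n] in auto)
  finally show ?thesis .
qed

lemma nn_integral_polar_normalised:
  fixes F :: "real ^ 'n::finite \<Rightarrow> ennreal"
  assumes F [measurable]: "F \<in> borel_measurable borel"
  shows "(\<integral>\<^sup>+x. F x \<partial>lborel) = (\<integral>\<^sup>+r. ennreal (sphere_area TYPE('n) * r ^ (CARD('n) - 1)) *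
     (\<integral>\<^sup>+x. F x \<partial>normalised_sphere_measure r) * indicator {0<..} r \<partial>lborel)"
  unfolding nn_integral_polar[OF F]
proof (rule nn_integral_cong)
  fix r :: real
  show "(\<integral>\<^sup>+x. F x \<partial>sphere_surface_measure r) * indicator {0<..} r =
    ennreal (sphere_area TYPE('n) * r ^ (CARD('n) - 1)) *
     (\<integral>\<^sup>+x. F x \<partial>normalised_sphere_measure r) * indicator {0<..} r"
  proof (cases "r > 0")
    case True
    have "(\<integral>\<^sup>+x. F x \<partial>sphere_surface_measure r) = ennreal (r ^ (CARD('n) - 1)) *
        (ennreal (sphere_area TYPE('n)) * (\<integral>\<^sup>+x. F x \<partial>normalised_sphere_measure r))"
      unfolding nn_integral_normalised_sphere[OF F True] by (rule nn_integral_sphere_surface_scale[OF F True])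
    also have "\<dots> = ennreal (sphere_area TYPE('n) * r ^ (CARD('n) - 1)) * (\<integral>\<^sup>+x. F x \<partial>normalised_sphere_measure r)"
      using sphere_area_pos[where ?'n='n] True
      by (simp add: ennreal_mult less_imp_le mult.assoc mult.left_commute)
    finally show ?thesis using True by simp
  qed simp
qed

lemma nn_integral_normalised_sphere_scale:
  fixes F :: "real ^ 'n::finite \<Rightarrow> ennreal"
  assumes F [measurable]: "F \<in> borel_measurable borel" and r: "r > 0"
  shows "(\<integral>\<^sup>+x. F x \<partial>normalised_sphere_measure r) = (\<integral>\<^sup>+x. F (r *\<^sub>R x) \<partial>normalised_sphere_measure 1)"
proof -
  have "ennreal (sphere_area TYPE('n)) * (\<integral>\<^sup>+x. F x \<partial>normalised_sphere_measure r)
    = ennreal (sphere_area TYPE('n)) * (\<integral>\<^sup>+x. F (r *\<^sub>R x) \<partial>normalised_sphere_measure 1)"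
    using nn_integral_normalised_sphere[OF F r] nn_integral_normalised_sphere[of "\<lambda>x. F (r *\<^sub>R x)" 1] by simp
  then show ?thesis
    using sphere_area_pos[where ?'n='n] by (auto simp: ennreal_mult_cancel_left)
qed

lemma measurable_normalised_sphere:
  assumes "F \<in> borel_measurable borel"
  shows "F \<in> borel_measurable (normalised_sphere_measure r)"
  using measurable_sphere_surface[OF assms] unfolding normalised_sphere_measure_def
  by (simp cong: measurable_cong_sets[OF sets_uniform_measure refl])

lemma space_normalised_sphere [simp]: "space (normalised_sphere_measure r) = sphere 0 r"
  by (simp add: normalised_sphere_measure_def)

lemma integrable_normalised_sphere:
  fixes f :: "real ^ 'n::finite \<Rightarrow> real"
  assumes f: "continuous_on UNIV f" and r: "r > 0"
  shows "integrable (normalised_sphere_measure r) f"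
proof -
  interpret prob_space "normalised_sphere_measure r :: (real ^ 'n) measure"
    by (rule prob_space_normalised_sphere_measure[OF r])
  have "bounded (f ` sphere 0 r)"
    by (intro compact_imp_bounded compact_continuous_image continuous_on_subset[OF f]) auto
  then obtain B where "\<And>x. x \<in> sphere 0 r \<Longrightarrow> \<bar>f x\<bar> \<le> B"
    unfolding bounded_iff by (metis imageI real_norm_def)
  then show ?thesis
    by (intro integrable_const_bound[of _ B] measurable_normalised_sphere borel_measurable_continuous_onI f) auto
qed

lemma M2_power2:
  fixes h :: "real ^ 'n::finite \<Rightarrow> real"
  assumes h: "continuous_on UNIV h" and r: "r > 0"
  shows "ennreal ((M2 h r)\<^sup>2) = (\<integral>\<^sup>+x. ennreal ((h x)\<^sup>2) \<partial>normalised_sphere_measure r)"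
proof -
  have "(M2 h r)\<^sup>2 = (LINT x|normalised_sphere_measure r. (h x)\<^sup>2)"
    unfolding M2_def by (simp add: integral_nonneg_AE)
  also have "ennreal \<dots> = (\<integral>\<^sup>+x. ennreal ((h x)\<^sup>2) \<partial>normalised_sphere_measure r)"
    by (intro nn_integral_eq_integral[symmetric] integrable_normalised_sphere continuous_intros h r) auto
  finally show ?thesis .
qed

section \<open>Bessel inequality for zonal coefficients\<close>

context
  fixes k :: "'n::finite"
  assumes N: "CARD('n) \<ge> 2"
begin

lemma continuous_zonal: "continuous_on S (zonal k n)"
  by (rule harmonic_continuous[OF zonal_harmonic[OF N]])

text \<open>\<open>ball_integral_zonal\<close> evaluates both sides: for \<open>g\<close> it gives
  the derivative at the origin, for \<open>zonal k n\<close> the norm. So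
  \<open>(partial k ^^ n) g 0 / fact n\<close> is the Fourier coefficient of any harmonic
  \<open>g\<close>, axially symmetric or not.\<close>

lemma ball_integral_harmonic_zonal:
  assumes g: "g \<in> harmonic_functions" and R: "R > 0"
  shows "ball_integral R 1 (\<lambda>x. g x * zonal k n x) = (partial k ^^ n) g 0 / fact n * ball_integral R 1 (\<lambda>x. (zonal k n x)\<^sup>2)"
proof -
  have p: "2 ^ n * pochhammer (2::real) n > 0" by (simp add: pochhammer_pos)
  have "(2 ^ n * pochhammer 2 n) * ((partial k ^^ n) g 0 / fact n * ball_integral R 1 (\<lambda>x. (zonal k n x)\<^sup>2))
      = (partial k ^^ n) g 0 / fact n * (2 ^ n * pochhammer 2 n * ball_integral R 1 (\<lambda>x. (zonal k n x)\<^sup>2))"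
    by (simp only: mult_ac)
  also have "\<dots> = zonal_factor (real CARD('n)) n * ball_integral R (Suc n) (\<lambda>x::real^'n. 1) * (partial k ^^ n) g 0"
    using ball_integral_zonal_zonal[OF N R, of 1 n k n] by (simp add: power2_eq_square)
  also have "\<dots> = (2 ^ n * pochhammer 2 n) * ball_integral R 1 (\<lambda>x. g x * zonal k n x)"
    using ball_integral_zonal[OF N g R, of 1 n k] by simp
  finally have "(2 ^ n * pochhammer 2 n) * ball_integral R 1 (\<lambda>x. g x * zonal k n x) =
      (2 ^ n * pochhammer 2 n) * ((partial k ^^ n) g 0 / fact n * ball_integral R 1 (\<lambda>x. (zonal k n x)\<^sup>2))"
    by (rule sym)
  from mult_left_cancel[THEN iffD1, OF less_imp_neq[OF p, symmetric] this] show ?thesis .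
qed

lemma ball_integral_zonal_orthogonal:
  assumes R: "R > 0" and "m \<noteq> n"
  shows "ball_integral R 1 (\<lambda>x. zonal k m x * zonal k n x) = 0"
  using ball_integral_zonal_zonal[OF N R, of 1 n k m] assms pochhammer_pos[of "2::real" n] by simp

lemma zonal_bessel:
  assumes g: "g \<in> harmonic_functions" and R: "R > 0"
  shows "(\<Sum>n<K. ((partial k ^^ n) g 0 / fact n)\<^sup>2 * ball_integral R 1 (\<lambda>x. (zonal k n x)\<^sup>2)) \<le> ball_integral R 1 (\<lambda>x. (g x)\<^sup>2)"
proof -
  note [continuous_intros] = harmonic_continuous[OF g] continuous_zonal
  define c where "c n = (partial k ^^ n) g 0 / fact n" for n
  define s where "s n = ball_integral R 1 (\<lambda>x. (zonal k n x)\<^sup>2)" for n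
  define P where "P x = (\<Sum>n<K. c n * zonal k n x)" for x
  have cP [continuous_intros]: "continuous_on UNIV P"
    unfolding P_def by (intro continuous_intros)
  have gP: "ball_integral R 1 (\<lambda>x. g x * P x) = (\<Sum>n<K. (c n)\<^sup>2 * s n)"
  proof -
    have "ball_integral R 1 (\<lambda>x. g x * P x) = ball_integral R 1 (\<lambda>x. \<Sum>n<K. c n * (g x * zonal k n x))"
      by (simp add: P_def sum_distrib_left mult_ac)
    also have "\<dots> = (\<Sum>n<K. ball_integral R 1 (\<lambda>x. c n * (g x * zonal k n x)))"
      using R by (intro ball_integral_sum) (auto intro!: continuous_intros)
    also have "\<dots> = (\<Sum>n<K. (c n)\<^sup>2 * s n)"
      unfolding ball_integral_cmult ball_integral_harmonic_zonal[OF g R] c_def[symmetric] s_def[symmetric]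
      by (simp add: power2_eq_square mult.assoc)
    finally show ?thesis .
  qed
  have "ball_integral R 1 (\<lambda>x. P x * P x) = ball_integral R 1 (\<lambda>x. \<Sum>n<K. c n * (\<Sum>m<K. c m * (zonal k m x * zonal k n x)))"
    by (simp add: P_def sum_distrib_left sum_distrib_right mult_ac)
  also have "\<dots> = (\<Sum>n<K. ball_integral R 1 (\<lambda>x. c n * (\<Sum>m<K. c m * (zonal k m x * zonal k n x))))"
    using R by (intro ball_integral_sum) (auto intro!: continuous_intros)
  also have "\<dots> = (\<Sum>n<K. c n * (\<Sum>m<K. c m * ball_integral R 1 (\<lambda>x. zonal k m x * zonal k n x)))"
    using R by (simp add: ball_integral_cmult) (subst ball_integral_sum, auto intro!: continuous_intros simp: ball_integral_cmult)
  also have "\<dots> = (\<Sum>n<K. c n * (\<Sum>m<K. if m = n then c m * s n else 0))"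
    by (intro sum.cong arg_cong2[where f="(*)"] refl)
       (use ball_integral_zonal_orthogonal[OF R] in \<open>auto simp: s_def power2_eq_square\<close>)
  also have "\<dots> = (\<Sum>n<K. (c n)\<^sup>2 * s n)"
    by (simp add: power2_eq_square mult.assoc)
  finally have PP: "ball_integral R 1 (\<lambda>x. P x * P x) = (\<Sum>n<K. (c n)\<^sup>2 * s n)" .
  have "0 \<le> ball_integral R 1 (\<lambda>x. (g x - P x)\<^sup>2)"
    by (rule ball_integral_nonneg) simp
  also have "(\<lambda>x. (g x - P x)\<^sup>2) = (\<lambda>x. (g x)\<^sup>2 + (- 2 * (g x * P x) + P x * P x))"
    by (simp add: power2_eq_square algebra_simps)
  also have "ball_integral R 1 \<dots> = ball_integral R 1 (\<lambda>x. (g x)\<^sup>2) + (- 2 * ball_integral R 1 (\<lambda>x. g x * P x) + ball_integral R 1 (\<lambda>x. P x * P x))"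
  proof -
    have c: "continuous_on UNIV (\<lambda>x. (g x)\<^sup>2)" "continuous_on UNIV (\<lambda>x. - 2 * (g x * P x))"
      "continuous_on UNIV (\<lambda>x. P x * P x)"
      by (intro continuous_intros)+
    show ?thesis
      unfolding ball_integral_cmult[symmetric]
      by (subst ball_integral_add[OF c(1) continuous_on_add[OF c(2,3)] R], simp, subst ball_integral_add[OF c(2,3) R], simp_all)
  qed
  finally show ?thesis unfolding gP PP c_def s_def by simp
qed

end

text \<open>The square norm of \<open>zonal k n / fact n\<close>, up to a factor independent of \<open>n\<close>; see
  \<open>ball_integral_zonal_norm\<close>. Likewise \<open>sphere_weight\<close> below for the norm on the unit sphere.\<close>

definition zonal_weight :: "nat \<Rightarrow> nat \<Rightarrow> real" where
  "zonal_weight N n = zonal_factor (real N) n / (2 ^ n * fact n * fact (Suc n)) *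
     (\<Prod>j<n. 2 * (real j + 2) / (2 * (real j + 2) + real N))"

lemma zonal_weight_pos: "N \<ge> 2 \<Longrightarrow> zonal_weight N n > 0"
  unfolding zonal_weight_def by (intro mult_pos_pos divide_pos_pos prod_pos zonal_factor_pos) auto

lemma zonal_weight_Suc:
  assumes "N \<ge> 2" "n \<ge> 1"
  shows "zonal_weight N (Suc n) * ((real n + N - 2) * (2 * (real n + 2) + N) * (real n + 1)) =
    zonal_weight N n * (2 * real n + N - 2)"
proof -
  obtain m where n: "n = Suc m" using assms by (cases n) auto
  have pos: "real m + real N - 1 > 0" "real m * 2 + real N > 0" using assms by linarith+
  have "zonal_factor (real N) (Suc n) = (2 * real m + N) / (real m + N - 1) * zonal_factor (real N) n"
    by (simp add: n zonal_factor.simps(3))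
  moreover have "(2::real) ^ Suc n * fact (Suc n) * fact (Suc (Suc n)) =
      (2 ^ n * fact n * fact (Suc n)) * (2 * (real n + 1) * (real n + 2))"
    by (simp add: algebra_simps)
  ultimately have "zonal_weight N (Suc n) = zonal_weight N n *
     ((2 * real m + N) / (real m + N - 1) / (2 * (real n + 1) * (real n + 2)) * (2 * (real n + 2) / (2 * (real n + 2) + real N)))"
    unfolding zonal_weight_def prod.lessThan_Suc by (simp only: times_divide_eq_left times_divide_eq_right divide_divide_eq_left mult_ac)
  also have "\<dots> = zonal_weight N n * ((2 * real m + N) / ((real m + N - 1) * (2 * (real n + 2) + real N) * (real n + 1)))"
  proof -
    have g: "a / b / (2 * x * y) * (2 * y / w) = a / (b * w * x)" if "y \<noteq> 0" for a b w x y :: real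
      using that by simp
    have "real n + 2 \<noteq> 0" by linarith
    from g[OF this] show ?thesis by (simp only:)
  qed
  finally show ?thesis using pos assms by (simp add: n add_ac)
qed

lemma ball_integral_1_power:
  assumes N: "CARD('n::finite) \<ge> 2" and R: "R > 0"
  shows "ball_integral R (Suc n) (\<lambda>x::real^'n. 1) = R ^ (2 * n) * (\<Prod>j<n. 2 * (real j + 2) / (2 * (real j + 2) + real CARD('n)))
     * ball_integral R 1 (\<lambda>x::real^'n. 1)"
proof (induction n)
  case (Suc n)
  have "(2 * (real n + 2) + real CARD('n)) * ball_integral R (Suc (Suc n)) (\<lambda>x::real^'n. 1) =
      2 * (real n + 2) * R\<^sup>2 * ball_integral R (Suc n) (\<lambda>x::real^'n. 1)"
    using ball_integral_1_Suc[OF N R, of "Suc n"] by (simp add: algebra_simps)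
  moreover have "2 * (real n + 2) + real CARD('n) > 0" by (simp add: add_pos_nonneg)
  ultimately have "ball_integral R (Suc (Suc n)) (\<lambda>x::real^'n. 1) =
      2 * (real n + 2) / (2 * (real n + 2) + real CARD('n)) * R\<^sup>2 * ball_integral R (Suc n) (\<lambda>x::real^'n. 1)"
    by (simp add: field_simps)
  then show ?case unfolding Suc by (simp add: power2_eq_square mult_ac)
qed simp

lemma ball_integral_zonal_norm:
  assumes N: "CARD('n::finite) \<ge> 2" and R: "R > 0"
  shows "ball_integral R 1 (\<lambda>x. (zonal (k::'n) n x)\<^sup>2) / (fact n)\<^sup>2 =
     zonal_weight CARD('n) n * R ^ (2 * n) * ball_integral R 1 (\<lambda>x::real^'n. 1)"
proof -
  have poch: "pochhammer (2::real) n = fact (Suc n)"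
    using pochhammer_rec[of "1::real" n] by (simp add: pochhammer_fact[symmetric])
  have "2 ^ n * fact (Suc n) * ball_integral R 1 (\<lambda>x. (zonal k n x)\<^sup>2)
      = zonal_factor (real CARD('n)) n * ball_integral R (Suc n) (\<lambda>x::real^'n. 1) * fact n"
    using ball_integral_zonal_zonal[OF N R, of 1 n k n] by (simp add: power2_eq_square poch)
  then have "ball_integral R 1 (\<lambda>x. (zonal k n x)\<^sup>2) =
      zonal_factor (real CARD('n)) n * ball_integral R (Suc n) (\<lambda>x::real^'n. 1) * fact n / (2 ^ n * fact (Suc n))"
    by (simp add: field_simps del: fact_Suc)
  then show ?thesis
    unfolding ball_integral_1_power[OF N R] zonal_weight_def
    by (simp add: power2_eq_square field_simps del: fact_Suc)
qed

lemma ball_integral_1_lower: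
  "\<exists>c>0. \<forall>R>0. c * R ^ (CARD('n) + 2) \<le> ball_integral R 1 (\<lambda>x::real^'n::finite. 1)"
proof (intro exI conjI allI impI)
  let ?v = "unit_ball_vol (real CARD('n))"
  show "3/4 * ?v / 2 ^ CARD('n) > 0" by (simp add: unit_ball_vol_pos)
  fix R :: real assume R: "R > 0"
  have "3/4 * ?v / 2 ^ CARD('n) * R ^ (CARD('n) + 2) = (R\<^sup>2 * 3/4) * measure lborel (ball 0 (R/2) :: (real^'n) set)"
    using R by (simp add: content_ball power_divide power_add power2_eq_square)
  also have "\<dots> \<le> ball_integral R 1 (\<lambda>x::real^'n. 1)"
    using ball_integral_1_ge[OF R, of 1, where ?'n='n] by simp
  finally show "3/4 * ?v / 2 ^ CARD('n) * R ^ (CARD('n) + 2) \<le> ball_integral R 1 (\<lambda>x::real^'n. 1)" .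
qed

text \<open>Multiplying the Bessel inequality by a power of \<open>R\<close> times an exponential and integrating over
  \<open>R\<close> turns \<open>zonal_weight\<close> into the following numbers. They are bounded below: the ratio of
  consecutive ones is a rational function that is at least \<open>1\<close>.\<close>

definition gamma_weight :: "nat \<Rightarrow> nat \<Rightarrow> real" where
  "gamma_weight N n = zonal_weight N n * Gamma (2 * real n + real N + 3/2) / 2 powr (2 * real n + real N + 1/2)"

lemma gamma_weight_pos: "N \<ge> 2 \<Longrightarrow> gamma_weight N n > 0"
  unfolding gamma_weight_def by (intro divide_pos_pos mult_pos_pos zonal_weight_pos Gamma_real_pos) (auto simp: add_nonneg_pos)

text \<open>With \<open>x\<close> and \<open>y\<close> for \<open>n\<close> and \<open>N\<close>,
  the difference of the sides is
  \<open>(y - 4) * (y - 2) * (2 * x + y + 4) + 15/4 * (2 * x + y - 2)\<close>. Only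
  \<open>N = 3\<close> makes the first product negative; there the sum is
  \<open>11/2 * x - 13/4\<close>, nonnegative because \<open>n \<ge> 1\<close>.\<close>

lemma gamma_ratio_polynomial:
  fixes n N :: nat
  assumes "n \<ge> 1" "N \<ge> 2"
  shows "4 * ((real n + N - 2) * (2 * (real n + 2) + N) * (real n + 1)) \<le>
    (2 * real n + N - 2) * ((2 * real n + N + 3/2) * (2 * real n + N + 5/2))"
proof -
  define x y where "x = real n" and "y = real N"
  have "(2 * x + y - 2) * ((2 * x + y + 3/2) * (2 * x + y + 5/2)) - 4 * ((x + y - 2) * (2 * (x + 2) + y) * (x + 1))
     = (y - 4) * (y - 2) * (2 * x + y + 4) + 15/4 * (2 * x + y - 2)"
    by (simp add: algebra_simps)
  moreover have "(y - 4) * (y - 2) * (2 * x + y + 4) + 15/4 * (2 * x + y - 2) \<ge> 0"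
  proof (cases "N = 3")
    case True
    then have "(y - 4) * (y - 2) * (2 * x + y + 4) + 15/4 * (2 * x + y - 2) = 11/2 * x - 13/4"
      by (simp add: y_def field_simps)
    moreover have "x \<ge> 1" using assms by (simp add: x_def)
    ultimately show ?thesis by linarith
  next
    case False
    then have "y = 2 \<or> y \<ge> 4" using assms by (auto simp: y_def)
    then have "(y - 4) * (y - 2) \<ge> 0" by auto
    then have "(y - 4) * (y - 2) * (2 * x + y + 4) \<ge> 0"
      by (rule mult_nonneg_nonneg) (simp add: x_def y_def)
    moreover have "2 * x + y - 2 \<ge> 0" using assms by (simp add: x_def y_def)
    ultimately show ?thesis by simp
  qed
  ultimately show ?thesis by (simp add: x_def y_def)
qed

lemma gamma_weight_mono: assumes "N \<ge> 2" "n \<ge> 1" shows "gamma_weight N n \<le> gamma_weight N (Suc n)"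
proof -
  define z where "z = 2 * real n + real N + 3/2"
  define A where "A = (real n + N - 2) * (2 * (real n + 2) + N) * (real n + 1)"
  define B where "B = 2 * real n + N - 2"
  define G where "G = Gamma z / 2 powr (z - 1)"
  have zpos: "z > 0" by (simp add: z_def add_nonneg_pos)
  have G: "G > 0" using zpos by (simp add: G_def Gamma_real_pos)
  have A: "A > 0" using assms by (auto simp: A_def intro!: mult_pos_pos)
  have AB: "4 * A \<le> B * (z * (z + 1))"
    using gamma_ratio_polynomial[OF assms(2,1)] by (simp add: A_def B_def z_def add_ac)
  have S: "zonal_weight N (Suc n) = zonal_weight N n * B / A"
    using zonal_weight_Suc[OF assms] A by (simp add: A_def B_def field_simps)
  have "Gamma (z + 2) = (z + 1) * (z * Gamma z)"
    using Gamma_plus1[of z] Gamma_plus1[of "z + 1"] zpos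
    by (simp add: nonpos_Ints_def add_ac)
  moreover have "2 powr (z + 1) = 4 * (2::real) powr (z - 1)"
    using powr_add[of 2 "z - 1" 2] by (simp add: add.commute)
  moreover have "2 * real (Suc n) + real N + 3/2 = z + 2" "2 * real (Suc n) + real N + 1/2 = z + 1"
    by (simp_all add: z_def)
  ultimately have "gamma_weight N (Suc n) = zonal_weight N n * B / A * ((z + 1) * z * G / 4)"
    unfolding gamma_weight_def S G_def by (simp only:) (simp add: mult_ac)
  also have "\<dots> = (zonal_weight N n * G) * (B * (z * (z + 1)) / (4 * A))"
    by (simp add: mult_ac)
  also have "\<dots> \<ge> (zonal_weight N n * G) * 1"
    using AB A G zonal_weight_pos[OF assms(1), of n] by (intro mult_left_mono) (auto simp: field_simps)
  also have "zonal_weight N n * G = gamma_weight N n"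
  proof -
    have "z - 1 = 2 * real n + real N + 1/2" by (simp add: z_def)
    then show ?thesis unfolding gamma_weight_def G_def by (simp only:) (simp add: z_def)
  qed
  finally show ?thesis by simp
qed

lemma gamma_weight_lower: assumes "N \<ge> 2" shows "\<exists>t>0. \<forall>n. t \<le> gamma_weight N n"
proof (intro exI conjI allI)
  \<comment> \<open>Monotonicity starts at index 1, so index 0 enters separately.\<close>
  show "min (gamma_weight N 0) (gamma_weight N 1) > 0" using gamma_weight_pos[OF assms] by simp
  fix n
  have "gamma_weight N 1 \<le> gamma_weight N n" if "n \<ge> 1"
    using that
  proof (induction n rule: dec_induct)
    case (step m)
    then show ?case using gamma_weight_mono[OF assms, of m] by simp
  qed simp
  then show "min (gamma_weight N 0) (gamma_weight N 1) \<le> gamma_weight N n"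
    by (cases "n = 0") (auto simp: min_le_iff_disj)
qed

section \<open>Averaged bounds for the iterated derivatives at the origin\<close>

lemma has_integral_exp_weighted_sum:
  fixes a z :: "nat \<Rightarrow> real"
  assumes a: "\<And>n. n < K \<Longrightarrow> a n \<ge> 0" and z: "\<And>n. n < K \<Longrightarrow> z n > 1" and l: "l > 2"
    and le: "\<And>R. R > 0 \<Longrightarrow> (\<Sum>n<K. a n * R powr (z n - 1)) \<le> C * exp (2 * R)"
    and C: "C \<ge> 0"
  shows "(\<Sum>n<K. a n * Gamma (z n) / l powr (z n - 1)) \<le> C / (1 - 2 / l)"
proof -
  \<comment> \<open>Integration against \<open>exp (- l * R)\<close> in the variable
    \<open>s = l * R\<close>: every power becomes a Gamma value, and the majorant stays integrable
    because \<open>l > 2\<close>.\<close>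
  have "((\<lambda>s. \<Sum>n<K. (a n / l powr (z n - 1)) * (s powr (z n - 1) / exp s)) has_integral
     (\<Sum>n<K. (a n / l powr (z n - 1)) * Gamma (z n))) {0..}"
    by (intro has_integral_sum has_integral_mult_right Gamma_integral_real) (use z in force)+
  moreover have "((\<lambda>s. C * exp (- (1 - 2 / l) * s)) has_integral C * (exp (- (1 - 2 / l) * 0) / (1 - 2 / l))) {0..}"
    using l by (intro has_integral_mult_right has_integral_exp_minus_to_infinity) auto
  ultimately have "(\<Sum>n<K. (a n / l powr (z n - 1)) * Gamma (z n)) \<le> C * (exp (- (1 - 2 / l) * 0) / (1 - 2 / l))"
  proof (rule has_integral_le)
    fix s :: real assume s: "s \<in> {0..}"
    show "(\<Sum>n<K. (a n / l powr (z n - 1)) * (s powr (z n - 1) / exp s)) \<le> C * exp (- (1 - 2 / l) * s)"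
    proof (cases "s = 0")
      case True
      have "(\<Sum>n<K. (a n / l powr (z n - 1)) * (s powr (z n - 1) / exp s)) = 0"
        using True by simp
      then show ?thesis using C True by simp
    next
      case False
      then have s: "s > 0" using s by simp
      have "(\<Sum>n<K. (a n / l powr (z n - 1)) * (s powr (z n - 1) / exp s)) =
          (\<Sum>n<K. a n * (s / l) powr (z n - 1)) / exp s"
        using s l by (simp add: sum_divide_distrib powr_divide)
      also have "\<dots> \<le> C * exp (2 * (s / l)) / exp s"
        using s l le[of "s / l"] by (intro divide_right_mono) auto
      also have "\<dots> = C * exp (- (1 - 2 / l) * s)"
      proof -
        have "- (1 - 2 / l) * s = 2 * (s / l) - s" by (simp add: algebra_simps)
        then show ?thesis by (simp only: exp_diff times_divide_eq_right)
      qed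
      finally show ?thesis .
    qed
  qed
  then show ?thesis by simp
qed

lemma derivative_square_sum:
  fixes k :: "'n::finite"
  assumes N: "CARD('n) \<ge> 2"
  shows "\<exists>M\<ge>0. \<forall>g\<in>harmonic_functions. \<forall>C\<ge>0.
     (\<forall>R\<ge>1. ball_integral R 1 (\<lambda>x. (g x)\<^sup>2) \<le> C * exp (2 * R) * R powr (3/2)) \<longrightarrow>
     (\<forall>K\<ge>1. (\<Sum>n<K. ((partial k ^^ n) g 0)\<^sup>2) \<le> M * C * real K)"
proof -
  let ?N = "real CARD('n)"
  obtain c where c: "c > 0" "\<And>R. R > 0 \<Longrightarrow> c * R ^ (CARD('n) + 2) \<le> ball_integral R 1 (\<lambda>x::real^'n. 1)"
    using ball_integral_1_lower by blast
  obtain t where t: "t > 0" "\<And>n. t \<le> gamma_weight CARD('n) n"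
    using gamma_weight_lower[OF N] by blast
  define M where "M = exp 2 / c * 2 / (t * exp (- (?N + 5/2)))"
  have "(\<Sum>n<K. ((partial k ^^ n) g 0)\<^sup>2) \<le> M * C * real K"
    if g: "g \<in> harmonic_functions" and C: "C \<ge> 0"
      and le: "\<forall>R\<ge>1. ball_integral R 1 (\<lambda>x. (g x)\<^sup>2) \<le> C * exp (2 * R) * R powr (3/2)" and K: "K \<ge> 1" for g C K
  proof -
    define d where "d n = ((partial k ^^ n) g 0)\<^sup>2" for n
    \<comment> \<open>The exponent \<open>z n - 1\<close> is what remains of \<open>2 * n\<close>
      from homogeneity and \<open>N + 2\<close> from the total weight of the ball after
      \<open>3/2\<close> from the growth hypothesis is divided off; the shift by 1 is that of the
      Gamma integral.\<close>
    define z where "z n = 2 * real n + ?N + 3/2" for n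
    let ?w = "zonal_weight CARD('n)"
    have wp: "?w n > 0" for n by (rule zonal_weight_pos[OF N])
    have d0: "d n \<ge> 0" for n by (simp add: d_def)
    have b1: "(\<Sum>n<K. d n * ?w n * (R ^ (2 * n) * R ^ (CARD('n) + 2))) \<le> C / c * exp (2 * R) * R powr (3/2)"
      if R: "R \<ge> 1" for R
    proof -
      let ?W = "ball_integral R 1 (\<lambda>x::real^'n. 1)"
      have R0: "R > 0" using R by simp
      have "c * (\<Sum>n<K. d n * ?w n * (R ^ (2 * n) * R ^ (CARD('n) + 2)))
         = (\<Sum>n<K. d n * ?w n * R ^ (2 * n) * (c * R ^ (CARD('n) + 2)))"
        by (simp add: sum_distrib_left mult_ac)
      also have "\<dots> \<le> (\<Sum>n<K. d n * ?w n * R ^ (2 * n) * ?W)"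
        using R0 wp d0 by (intro sum_mono mult_left_mono c(2)) (auto simp: less_imp_le)
      also have "\<dots> = (\<Sum>n<K. ((partial k ^^ n) g 0 / fact n)\<^sup>2 * ball_integral R 1 (\<lambda>x. (zonal k n x)\<^sup>2))"
      proof (intro sum.cong refl)
        fix n
        have "d n * ?w n * R ^ (2 * n) * ?W = d n * (?w n * R ^ (2 * n) * ?W)" by simp
        also have "\<dots> = ((partial k ^^ n) g 0 / fact n)\<^sup>2 * ball_integral R 1 (\<lambda>x. (zonal k n x)\<^sup>2)"
          unfolding ball_integral_zonal_norm[OF N R0, of k n, symmetric] d_def by (simp add: power_divide)
        finally show "d n * ?w n * R ^ (2 * n) * ?W = ((partial k ^^ n) g 0 / fact n)\<^sup>2 * ball_integral R 1 (\<lambda>x. (zonal k n x)\<^sup>2)" .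
      qed
      also have "\<dots> \<le> C * exp (2 * R) * R powr (3/2)"
        using zonal_bessel[OF N g R0, of k K] le R by (meson order_trans)
      finally show ?thesis using c(1) by (simp add: field_simps)
    qed
    have b2: "(\<Sum>n<K. d n * ?w n * R powr (z n - 1)) \<le> C / c * exp 2 * exp (2 * R)" if R: "R > 0" for R
    proof -
      have e: "R ^ (2 * n) * R ^ (CARD('n) + 2) = R powr (z n - 1) * R powr (3/2)" for n
      proof -
        have "R ^ (2 * n) * R ^ (CARD('n) + 2) = R powr real (2 * n + (CARD('n) + 2))"
          using R by (simp only: power_add[symmetric] powr_realpow)
        also have "real (2 * n + (CARD('n) + 2)) = (z n - 1) + 3/2" by (simp add: z_def)
        finally show ?thesis by (simp only: powr_add)
      qed
      have eq: "(\<Sum>n<K. d n * ?w n * (R ^ (2 * n) * R ^ (CARD('n) + 2))) = (\<Sum>n<K. d n * ?w n * R powr (z n - 1)) * R powr (3/2)"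
        unfolding e sum_distrib_right by (simp add: mult.assoc)
      have "(\<Sum>n<K. d n * ?w n * R powr (z n - 1)) * R powr (3/2) \<le> (C / c * exp 2 * exp (2 * R)) * R powr (3/2)"
      proof (cases "R \<ge> 1")
        case True
        have "C / c * exp (2 * R) \<le> C / c * exp 2 * exp (2 * R)"
          using mult_left_mono[of 1 "exp 2" "C / c"] C c(1) by (intro mult_right_mono) auto
        then show ?thesis unfolding eq[symmetric] using b1[OF True]
          by (meson mult_right_mono order_trans powr_ge_zero)
      next
        \<comment> \<open>Below radius 1 the growth hypothesis says nothing. The bound at radius 1
          takes its place, since every power of \<open>R\<close> that occurs is at most
          \<open>R powr (3/2)\<close>; this is the origin of the factor
          \<open>exp 2\<close>.\<close>
        case False
        have "(\<Sum>n<K. d n * ?w n * (R ^ (2 * n) * R ^ (CARD('n) + 2))) \<le> (\<Sum>n<K. d n * ?w n * R powr (3/2))"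
        proof (intro sum_mono mult_left_mono)
          fix n
          have "R ^ (2 * n) * R ^ (CARD('n) + 2) = R powr (z n - 1 + 3/2)"
            using R by (simp only: e powr_add)
          also have "\<dots> \<le> R powr (3/2)"
            using R False by (intro powr_mono') (auto simp: z_def)
          finally show "R ^ (2 * n) * R ^ (CARD('n) + 2) \<le> R powr (3/2)" .
        qed (use wp d0 in \<open>auto simp: less_imp_le\<close>)
        also have "\<dots> = (\<Sum>n<K. d n * ?w n) * R powr (3/2)" by (simp add: sum_distrib_right)
        also have "\<dots> \<le> (C / c * exp 2 * 1) * R powr (3/2)"
          using b1[of 1] by (intro mult_right_mono) auto
        also have "\<dots> \<le> (C / c * exp 2 * exp (2 * R)) * R powr (3/2)"
          using R C c(1) by (intro mult_right_mono mult_left_mono) auto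
        finally show ?thesis unfolding eq .
      qed
      then show ?thesis by (rule mult_right_le_imp_le) (use R in simp)
    qed
    \<comment> \<open>The rate approaches the critical value 2 as \<open>K\<close> grows. It makes
      \<open>1 - 2 / l\<close> equal to \<open>1 / (real K + 1)\<close>, an admissible loss for
      \<open>K\<close> summands, while passing from \<open>2\<close> to \<open>l\<close> in the
      powers costs only \<open>(1 + 1 / real K) powr (z n - 1)\<close>, which is bounded uniformly
      for \<open>n < K\<close>.\<close>
    define l where "l = 2 * (1 + 1 / real K)"
    have l2: "l > 2" using K by (simp add: l_def)
    have "(\<Sum>n<K. d n * ?w n * Gamma (z n) / l powr (z n - 1)) \<le> (C / c * exp 2) / (1 - 2 / l)"
      using wp d0 C c(1) l2 b2
      by (intro has_integral_exp_weighted_sum) (auto simp: z_def less_imp_le add_nonneg_pos)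
    also have "1 - 2 / l = 1 / (real K + 1)"
      using K by (simp add: l_def field_simps)
    also have "(C / c * exp 2) / (1 / (real K + 1)) = C / c * exp 2 * (real K + 1)" by simp
    also have "\<dots> \<le> C / c * exp 2 * (2 * real K)"
      using K C c(1) by (intro mult_left_mono) auto
    finally have up: "(\<Sum>n<K. d n * ?w n * Gamma (z n) / l powr (z n - 1)) \<le> C / c * exp 2 * (2 * real K)" .
    have "(\<Sum>n<K. d n) * (t * exp (- (?N + 5/2))) = (\<Sum>n<K. d n * (t * exp (- (?N + 5/2))))"
      by (simp add: sum_distrib_right)
    also have "\<dots> \<le> (\<Sum>n<K. d n * ?w n * Gamma (z n) / l powr (z n - 1))"
    proof (intro sum_mono)
      fix n assume n: "n \<in> {..<K}"
      have "(1 + 1 / real K) powr (z n - 1) \<le> exp (1 / real K) powr (z n - 1)"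
        by (intro powr_mono2) (auto simp: z_def exp_ge_add_one_self)
      also have "\<dots> = exp ((z n - 1) / real K)"
        by (simp add: exp_powr_real)
      also have "\<dots> \<le> exp (?N + 5/2)"
      proof -
        have "z n - 1 \<le> (?N + 5/2) * real K"
        proof -
          have "(?N + 1/2) * 1 \<le> (?N + 1/2) * real K" using K by (intro mult_left_mono) auto
          moreover have "2 * real n \<le> 2 * real K" using n by simp
          ultimately show ?thesis by (simp add: z_def algebra_simps)
        qed
        then show ?thesis using K by (simp add: field_simps)
      qed
      finally have p: "(1 + 1 / real K) powr (z n - 1) \<le> exp (?N + 5/2)" .
      have gw: "?w n * Gamma (z n) / l powr (z n - 1) = gamma_weight CARD('n) n / (1 + 1 / real K) powr (z n - 1)"
        unfolding l_def gamma_weight_def by (subst powr_mult) (auto simp: z_def algebra_simps)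
      have "t * exp (- (?N + 5/2)) = t / exp (?N + 5/2)"
        by (simp only: exp_minus divide_inverse)
      also have "\<dots> \<le> gamma_weight CARD('n) n / (1 + 1 / real K) powr (z n - 1)"
      proof (rule frac_le)
        show "0 \<le> gamma_weight CARD('n) n" by (rule less_imp_le[OF gamma_weight_pos[OF N]])
        have "1 + 1 / real K > 0" by (simp add: add_pos_nonneg)
        then show "0 < (1 + 1 / real K) powr (z n - 1)" by simp
      qed (rule t(2), rule p)
      finally have "t * exp (- (?N + 5/2)) \<le> ?w n * Gamma (z n) / l powr (z n - 1)"
        unfolding gw .
      from mult_left_mono[OF this d0[of n]]
      show "d n * (t * exp (- (?N + 5/2))) \<le> d n * ?w n * Gamma (z n) / l powr (z n - 1)"
        by (simp add: mult.assoc)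
    qed
    also note up
    finally have "(\<Sum>n<K. d n) \<le> C / c * exp 2 * (2 * real K) / (t * exp (- (?N + 5/2)))"
      using t(1) by (subst pos_le_divide_eq) auto
    also have "\<dots> = M * C * real K"
      by (simp add: M_def mult_ac)
    finally show ?thesis unfolding d_def .
  qed
  moreover have "M \<ge> 0" using c t by (simp add: M_def)
  ultimately show ?thesis by blast
qed

section \<open>Growth prevents distributional irregularity\<close>

lemma nn_integral_exp_Icc:
  assumes "a \<le> b"
  shows "(\<integral>\<^sup>+r. ennreal (exp (2 * r)) * indicator {a..b} r \<partial>lborel) = ennreal (exp (2 * b) / 2 - exp (2 * a) / 2)"
  by (rule nn_integral_FTC_Icc[where F="\<lambda>r. exp (2 * r) / 2"])
     (use assms in \<open>auto intro!: derivative_eq_intros\<close>)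

text \<open>On the sphere of radius \<open>r\<close> the squared bound times the area factor is of
  order \<open>sqrt r * exp (2 * r)\<close>, and integrating the exponential up to \<open>t\<close>
  costs no further power of \<open>t\<close>. Since \<open>exp (2 * t) * sqrt (1 + t)\<close> is at
  least 1, a larger constant absorbs the radii where the growth bound is not yet in force.\<close>

lemma ball_growth:
  fixes h :: "real ^ 'n::finite \<Rightarrow> real"
  assumes h: "continuous_on UNIV h" and c: "c > 0"
    and M: "\<forall>\<^sub>F r in at_top. M2 h r \<le> c * (exp r / r powr (real CARD('n) / 2 - 3 / 4))"
  shows "\<exists>C\<ge>0. \<forall>t\<ge>0. (\<integral>\<^sup>+x. ennreal ((h x)\<^sup>2) * indicator (cball 0 t) x \<partial>lborel)
     \<le> ennreal (C * (exp (2 * t) * sqrt (1 + t)))"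
proof -
  let ?N = "CARD('n)" and ?a = "sphere_area TYPE('n)"
  have a: "?a > 0" by (rule sphere_area_pos)
  have [measurable]: "h \<in> borel_measurable borel"
    by (rule borel_measurable_continuous_onI[OF h])
  obtain r0 where "\<And>r. r \<ge> r0 \<Longrightarrow> M2 h r \<le> c * (exp r / r powr (real ?N / 2 - 3 / 4))"
    using M unfolding eventually_at_top_linorder by blast
  then obtain r1 where r1: "r1 \<ge> 1" "\<And>r. r \<ge> r1 \<Longrightarrow> M2 h r \<le> c * (exp r / r powr (real ?N / 2 - 3 / 4))"
    by (meson max.cobounded1 max.cobounded2 order_trans)
  have inner: "ennreal (?a * r ^ (?N - 1)) * (\<integral>\<^sup>+x. ennreal ((h x)\<^sup>2) \<partial>normalised_sphere_measure r)
      \<le> ennreal (?a * c\<^sup>2 * sqrt r * exp (2 * r))" if r: "r \<ge> r1" for r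
  proof -
    have r0: "r > 0" using r r1 by simp
    have "0 \<le> M2 h r" by (simp add: M2_def integral_nonneg_AE)
    then have "(M2 h r)\<^sup>2 \<le> (c * (exp r / r powr (real ?N / 2 - 3 / 4)))\<^sup>2"
      by (intro power_mono r1 r)
    also have "\<dots> = c\<^sup>2 * (exp (2 * r) / r powr (real ?N - 3 / 2))"
    proof -
      have "(r powr (real ?N / 2 - 3 / 4))\<^sup>2 = r powr (real ?N - 3 / 2)"
        by (simp add: power2_eq_square powr_add[symmetric])
      then show ?thesis by (simp add: power_mult_distrib power_divide exp_double)
    qed
    finally have "?a * r ^ (?N - 1) * (M2 h r)\<^sup>2 \<le> ?a * r ^ (?N - 1) * (c\<^sup>2 * (exp (2 * r) / r powr (real ?N - 3 / 2)))"
      using a r0 by (intro mult_left_mono) auto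
    also have "\<dots> = ?a * c\<^sup>2 * exp (2 * r) * (r ^ (?N - 1) / r powr (real ?N - 3 / 2))"
      by simp
    also have "r ^ (?N - 1) / r powr (real ?N - 3 / 2) = sqrt r"
    proof -
      have "r ^ (?N - 1) = r powr real (?N - 1)" using r0 by (rule powr_realpow[symmetric])
      also have "real (?N - 1) = real ?N - 1"
        using zero_less_card_finite[where 'a='n] by (simp add: of_nat_diff Suc_leI)
      finally show ?thesis using r0 by (simp add: powr_diff[symmetric] powr_half_sqrt)
    qed
    finally have "?a * r ^ (?N - 1) * (M2 h r)\<^sup>2 \<le> ?a * c\<^sup>2 * sqrt r * exp (2 * r)"
      by (simp add: mult_ac)
    then show ?thesis
      unfolding M2_power2[OF h r0, symmetric] using a r0
      by (subst ennreal_mult[symmetric]) (auto intro!: ennreal_leI)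
  qed
  \<comment> \<open>The part of the ball where nothing but continuity is known.\<close>
  define C0 where "C0 = (\<integral>\<^sup>+x. ennreal ((h x)\<^sup>2) * indicator (cball 0 r1) x \<partial>lborel)"
  have "C0 < \<top>"
  proof -
    have "compact (h ` cball 0 r1)"
      by (intro compact_continuous_image continuous_on_subset[OF h]) auto
    then obtain B where B: "\<And>x. x \<in> cball 0 r1 \<Longrightarrow> \<bar>h x\<bar> \<le> B"
      unfolding compact_eq_bounded_closed bounded_iff by (metis imageI real_norm_def)
    have "C0 \<le> (\<integral>\<^sup>+x. ennreal (B\<^sup>2) * indicator (cball 0 r1) (x::real^'n) \<partial>lborel)"
      unfolding C0_def
    proof (intro nn_integral_mono)
      fix x :: "real^'n"
      show "ennreal ((h x)\<^sup>2) * indicator (cball 0 r1) x \<le> ennreal (B\<^sup>2) * indicator (cball 0 r1) x"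
        using power_mono[OF B abs_ge_zero, of x 2] by (cases "x \<in> cball 0 r1") (auto intro: ennreal_leI)
    qed
    also have "\<dots> = ennreal (B\<^sup>2) * emeasure lborel (cball 0 r1 :: (real^'n) set)"
      by (rule nn_integral_cmult_indicator) simp
    also have "\<dots> < \<top>"
      using emeasure_lborel_cball_finite[of "0::real^'n" r1] by (simp add: ennreal_mult_less_top)
    finally show ?thesis .
  qed
  then obtain c0 where c0: "c0 \<ge> 0" "C0 = ennreal c0"
    by (cases C0) auto
  have "(\<integral>\<^sup>+x. ennreal ((h x)\<^sup>2) * indicator (cball 0 t) x \<partial>lborel)
     \<le> ennreal ((c0 + ?a * c\<^sup>2) * (exp (2 * t) * sqrt (1 + t)))" if t: "t \<ge> 0" for t
  proof -
    let ?F = "\<lambda>x. ennreal ((h x)\<^sup>2) * indicator (cball 0 t - cball 0 r1) x"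
    have [measurable]: "?F \<in> borel_measurable borel"
      by (intro borel_measurable_times_ennreal borel_measurable_indicator) auto
    have "(\<integral>\<^sup>+x. ?F x \<partial>lborel) = (\<integral>\<^sup>+r. ennreal (?a * r ^ (?N - 1)) *
        (\<integral>\<^sup>+x. ?F x \<partial>normalised_sphere_measure r) * indicator {0<..} r \<partial>lborel)"
      by (rule nn_integral_polar_normalised) measurable
    \<comment> \<open>If \<open>t < r1\<close>, then \<open>max r1 t\<close> leaves a one-point
      interval and hence no contribution.\<close>
    also have "\<dots> \<le> (\<integral>\<^sup>+r. ennreal (?a * c\<^sup>2 * sqrt t) * (ennreal (exp (2 * r)) * indicator {r1..max r1 t} r) \<partial>lborel)"
    proof (rule nn_integral_mono)
      fix r :: real
      show "ennreal (?a * r ^ (?N - 1)) * (\<integral>\<^sup>+x. ?F x \<partial>normalised_sphere_measure r) * indicator {0<..} r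
         \<le> ennreal (?a * c\<^sup>2 * sqrt t) * (ennreal (exp (2 * r)) * indicator {r1..max r1 t} r)"
      proof (cases "r1 \<le> r \<and> r \<le> t")
        case True
        have "(\<integral>\<^sup>+x. ?F x \<partial>normalised_sphere_measure r) \<le> (\<integral>\<^sup>+x. ennreal ((h x)\<^sup>2) \<partial>normalised_sphere_measure r)"
          by (intro nn_integral_mono) (auto simp: indicator_def)
        then have "ennreal (?a * r ^ (?N - 1)) * (\<integral>\<^sup>+x. ?F x \<partial>normalised_sphere_measure r)
           \<le> ennreal (?a * r ^ (?N - 1)) * (\<integral>\<^sup>+x. ennreal ((h x)\<^sup>2) \<partial>normalised_sphere_measure r)"
          by (rule mult_left_mono) simp
        also have "\<dots> \<le> ennreal (?a * c\<^sup>2 * sqrt r * exp (2 * r))"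
          using inner True by blast
        also have "\<dots> \<le> ennreal (?a * c\<^sup>2 * sqrt t * exp (2 * r))"
          using True a by (intro ennreal_leI mult_right_mono mult_left_mono) auto
        also have "\<dots> = ennreal (?a * c\<^sup>2 * sqrt t) * ennreal (exp (2 * r))"
          using a t by (intro ennreal_mult) auto
        finally show ?thesis using True r1(1) by simp
      next
        case False
        have "(\<integral>\<^sup>+x. ?F x \<partial>normalised_sphere_measure r) = (\<integral>\<^sup>+x. 0 \<partial>(normalised_sphere_measure r :: (real^'n) measure))"
          using False by (intro nn_integral_cong) auto
        then show ?thesis by simp
      qed
    qed
    also have "\<dots> = ennreal (?a * c\<^sup>2 * sqrt t) * (\<integral>\<^sup>+r. ennreal (exp (2 * r)) * indicator {r1..max r1 t} r \<partial>lborel)"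
      by (rule nn_integral_cmult) measurable
    also have "\<dots> \<le> ennreal (?a * c\<^sup>2 * (exp (2 * t) * sqrt (1 + t)))"
    proof (cases "r1 \<le> t")
      case True
      have "(\<integral>\<^sup>+r. ennreal (exp (2 * r)) * indicator {r1..max r1 t} r \<partial>lborel) = ennreal (exp (2 * t) / 2 - exp (2 * r1) / 2)"
        using nn_integral_exp_Icc[OF True] True by (simp add: max_def)
      also have "\<dots> \<le> ennreal (exp (2 * t))"
        using exp_gt_zero[of "2 * t"] exp_gt_zero[of "2 * r1"] by (intro ennreal_leI) linarith
      finally have "ennreal (?a * c\<^sup>2 * sqrt t) * (\<integral>\<^sup>+r. ennreal (exp (2 * r)) * indicator {r1..max r1 t} r \<partial>lborel)
          \<le> ennreal (?a * c\<^sup>2 * sqrt t) * ennreal (exp (2 * t))"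
        by (rule mult_left_mono) simp
      also have "\<dots> = ennreal (?a * c\<^sup>2 * (exp (2 * t) * sqrt t))"
        using a t by (subst ennreal_mult[symmetric]) (auto simp: mult_ac)
      also have "\<dots> \<le> ennreal (?a * c\<^sup>2 * (exp (2 * t) * sqrt (1 + t)))"
        using a t by (intro ennreal_leI mult_left_mono) auto
      finally show ?thesis .
    next
      case False
      then have "max r1 t = r1" by simp
      then show ?thesis using nn_integral_exp_Icc[of r1 r1] by simp
    qed
    finally have F: "(\<integral>\<^sup>+x. ?F x \<partial>lborel) \<le> ennreal (?a * c\<^sup>2 * (exp (2 * t) * sqrt (1 + t)))" .
    have "(\<integral>\<^sup>+x. ennreal ((h x)\<^sup>2) * indicator (cball 0 t) x \<partial>lborel)
       \<le> (\<integral>\<^sup>+x. ennreal ((h x)\<^sup>2) * indicator (cball 0 r1) x + ?F x \<partial>lborel)"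
      by (intro nn_integral_mono) (auto simp: indicator_def)
    also have "\<dots> = C0 + (\<integral>\<^sup>+x. ?F x \<partial>lborel)"
      unfolding C0_def by (rule nn_integral_add) (intro borel_measurable_times_ennreal borel_measurable_indicator, auto)+
    also have "\<dots> \<le> ennreal (c0 * (exp (2 * t) * sqrt (1 + t))) + ennreal (?a * c\<^sup>2 * (exp (2 * t) * sqrt (1 + t)))"
    proof (rule add_mono[OF _ F])
      have "1 * 1 \<le> exp (2 * t) * sqrt (1 + t)" using t by (intro mult_mono) auto
      from mult_left_mono[OF this c0(1)] show "C0 \<le> ennreal (c0 * (exp (2 * t) * sqrt (1 + t)))"
        unfolding c0(2) by (intro ennreal_leI) simp
    qed
    also have "\<dots> = ennreal ((c0 + ?a * c\<^sup>2) * (exp (2 * t) * sqrt (1 + t)))"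
      using c0 a t by (subst ennreal_plus[symmetric]) (auto simp: distrib_right)
    finally show ?thesis .
  qed
  moreover have "c0 + ?a * c\<^sup>2 \<ge> 0" using c0 a by simp
  ultimately show ?thesis by blast
qed

lemma nn_integral_translate_ball:
  fixes h :: "real ^ 'n::finite \<Rightarrow> real"
  assumes [measurable]: "h \<in> borel_measurable borel"
  shows "(\<integral>\<^sup>+x. ennreal ((h (y + x))\<^sup>2) * indicator (cball 0 t) x \<partial>lborel)
    \<le> (\<integral>\<^sup>+x. ennreal ((h x)\<^sup>2) * indicator (cball 0 (t + norm y)) x \<partial>lborel)"
proof -
  have m: "(\<lambda>x. ennreal ((h x)\<^sup>2) * indicator (cball 0 (t + norm y)) x) \<in> borel_measurable borel"
    by (intro borel_measurable_times_ennreal borel_measurable_indicator) auto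
  have "(\<integral>\<^sup>+x. ennreal ((h (y + x))\<^sup>2) * indicator (cball 0 t) x \<partial>lborel)
    \<le> (\<integral>\<^sup>+x. ennreal ((h (y + x))\<^sup>2) * indicator (cball 0 (t + norm y)) (y + x) \<partial>lborel)"
  proof (intro nn_integral_mono mult_left_mono)
    fix x show "(indicator (cball 0 t) x :: ennreal) \<le> indicator (cball 0 (t + norm y)) (y + x)"
      using norm_triangle_ineq[of y x] by (auto simp: indicator_def)
  qed simp
  also have "\<dots> = (\<integral>\<^sup>+x. ennreal ((h x)\<^sup>2) * indicator (cball 0 (t + norm y)) x \<partial>distr lborel borel ((+) y))"
    using m by (subst nn_integral_distr) auto
  also have "\<dots> = (\<integral>\<^sup>+x. ennreal ((h x)\<^sup>2) * indicator (cball 0 (t + norm y)) x \<partial>lborel)"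
    by (simp add: lborel_distr_plus)
  finally show ?thesis .
qed

text \<open>Layer-cake formula: \<open>R\<^sup>2 - x \<bullet> x\<close> is the integral of
  \<open>2 * t\<close> over \<open>t\<close> from \<open>norm x\<close> to \<open>R\<close>, so the
  weighted integral superposes integrals over smaller balls. As the exponential is concentrated near
  \<open>t = R\<close>, the weight costs a single factor \<open>R\<close> instead of
  \<open>R\<^sup>2\<close>, whence the exponent \<open>3/2\<close>.\<close>

lemma ball_integral_square_le:
  fixes g :: "real ^ 'n::finite \<Rightarrow> real"
  assumes g: "continuous_on UNIV g" and R: "R \<ge> 1" and C: "C \<ge> 0"
    and le: "\<And>t. t \<ge> 0 \<Longrightarrow> (\<integral>\<^sup>+x. ennreal ((g x)\<^sup>2) * indicator (cball 0 t) x \<partial>lborel)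
     \<le> ennreal (C * (exp (2 * t) * sqrt (1 + t)))"
  shows "ball_integral R 1 (\<lambda>x. (g x)\<^sup>2) \<le> 2 * C * exp (2 * R) * R powr (3/2)"
proof -
  have [measurable]: "g \<in> borel_measurable borel"
    by (rule borel_measurable_continuous_onI[OF g])
  let ?G = "\<lambda>(x::real^'n) t. ennreal ((g x)\<^sup>2) * (ennreal (2 * t) * indicator {norm x..R} t)"
  have G: "(\<lambda>(x, t). ?G x t) \<in> borel_measurable (borel \<Otimes>\<^sub>M borel)"
  proof -
    have "{z::(real^'n) \<times> real. norm (fst z) \<le> snd z \<and> snd z \<le> R} \<in> sets borel"
      by (intro borel_closed closed_Collect_conj closed_Collect_le continuous_intros)
    then have s [measurable]: "{z::(real^'n) \<times> real. norm (fst z) \<le> snd z \<and> snd z \<le> R} \<in> sets (borel \<Otimes>\<^sub>M borel)"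
      unfolding borel_prod .
    have "(\<lambda>(x, t). ?G x t) = (\<lambda>z. ennreal ((g (fst z))\<^sup>2) * (ennreal (2 * snd z) *
        indicator {z. norm (fst z) \<le> snd z \<and> snd z \<le> R} z))"
      by (auto simp: fun_eq_iff indicator_def)
    also have "\<dots> \<in> borel_measurable (borel \<Otimes>\<^sub>M borel)"
      by (intro borel_measurable_times_ennreal borel_measurable_indicator s) measurable
    finally show ?thesis .
  qed
  have layer: "ennreal (ball_weight R 1 x) = (\<integral>\<^sup>+t. ennreal (2 * t) * indicator {norm x..R} t \<partial>lborel)" for x :: "real^'n"
  proof (cases "norm x \<le> R")
    case True
    have "(\<integral>\<^sup>+t. ennreal (2 * t) * indicator {norm x..R} t \<partial>lborel) = ennreal (R\<^sup>2 - (norm x)\<^sup>2)"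
    proof (rule nn_integral_FTC_Icc[where F="\<lambda>t. t\<^sup>2"])
      show "0 \<le> 2 * t" if "t \<in> {norm x..R}" for t
        using that norm_ge_zero[of x] by (simp del: norm_ge_zero)
    qed (use True in \<open>auto intro!: derivative_eq_intros\<close>)
    moreover have "x \<bullet> x \<le> R\<^sup>2"
      using True by (simp add: power2_norm_eq_inner[symmetric] power_mono)
    ultimately show ?thesis by (simp add: ball_weight_def power2_norm_eq_inner)
  next
    case False
    then show ?thesis using R by (simp add: ball_weight_eq_0)
  qed
  have "ennreal (ball_integral R 1 (\<lambda>x. (g x)\<^sup>2)) = (\<integral>\<^sup>+x. ennreal ((g x)\<^sup>2 * ball_weight R 1 x) \<partial>lborel)"
    unfolding ball_integral_def using R g
    by (intro nn_integral_eq_integral[symmetric] ball_integral_integrable) (auto intro!: continuous_intros simp: ball_weight_nonneg)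
  also have "\<dots> = (\<integral>\<^sup>+x. (\<integral>\<^sup>+t. ?G x t \<partial>lborel) \<partial>lborel)"
    by (intro nn_integral_cong) (simp add: ennreal_mult ball_weight_nonneg layer[unfolded One_nat_def] nn_integral_cmult)
  also have "\<dots> = (\<integral>\<^sup>+t. (\<integral>\<^sup>+x. ?G x t \<partial>lborel) \<partial>lborel)"
    by (rule lborel_pair.Fubini'[symmetric]) (use G in simp)
  also have "\<dots> \<le> (\<integral>\<^sup>+t. ennreal (2 * R * C * sqrt (1 + R)) * (ennreal (exp (2 * t)) * indicator {0..R} t) \<partial>lborel)"
  proof (rule nn_integral_mono)
    fix t :: real
    show "(\<integral>\<^sup>+x. ?G x t \<partial>lborel) \<le> ennreal (2 * R * C * sqrt (1 + R)) * (ennreal (exp (2 * t)) * indicator {0..R} t)"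
    proof (cases "0 \<le> t \<and> t \<le> R")
      case True
      have "(\<integral>\<^sup>+x. ?G x t \<partial>lborel) = (\<integral>\<^sup>+x. ennreal (2 * t) * (ennreal ((g x)\<^sup>2) * indicator (cball 0 t) x) \<partial>lborel)"
        using True by (intro nn_integral_cong) (auto simp: indicator_def mult_ac)
      also have "\<dots> = ennreal (2 * t) * (\<integral>\<^sup>+x. ennreal ((g x)\<^sup>2) * indicator (cball 0 t) x \<partial>lborel)"
      proof (rule nn_integral_cmult)
        show "(\<lambda>x. ennreal ((g x)\<^sup>2) * indicator (cball 0 t) x) \<in> borel_measurable lborel"
          by (intro borel_measurable_times_ennreal borel_measurable_indicator) auto
      qed
      also have "\<dots> \<le> ennreal (2 * t) * ennreal (C * (exp (2 * t) * sqrt (1 + t)))"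
        using True by (intro mult_left_mono le) auto
      also have "\<dots> \<le> ennreal (2 * R) * ennreal (C * (exp (2 * t) * sqrt (1 + R)))"
        using True C by (intro mult_mono ennreal_leI mult_left_mono) auto
      also have "\<dots> = ennreal (2 * R * C * sqrt (1 + R)) * ennreal (exp (2 * t))"
        using R C by (simp add: ennreal_mult[symmetric] mult_ac)
      finally show ?thesis using True by simp
    next
      case False
      have "(\<integral>\<^sup>+x. ?G x t \<partial>lborel) = (\<integral>\<^sup>+x. 0 \<partial>(lborel :: (real^'n) measure))"
      proof (intro nn_integral_cong)
        fix x :: "real^'n"
        show "?G x t = 0" using False norm_ge_zero[of x] by (auto simp: indicator_def simp del: norm_ge_zero)
      qed
      then show ?thesis by simp
    qed
  qed
  also have "\<dots> = ennreal (2 * R * C * sqrt (1 + R)) * ennreal (exp (2 * R) / 2 - 1 / 2)"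
    using R nn_integral_exp_Icc[of 0 R] by (subst nn_integral_cmult) auto
  also have "\<dots> = ennreal (2 * R * C * sqrt (1 + R) * (exp (2 * R) / 2 - 1 / 2))"
    using R C by (intro ennreal_mult[symmetric]) auto
  finally have "ball_integral R 1 (\<lambda>x. (g x)\<^sup>2) \<le> 2 * R * C * sqrt (1 + R) * (exp (2 * R) / 2 - 1 / 2)"
    using R C by (subst (asm) ennreal_le_iff) auto
  also have "\<dots> \<le> 2 * R * C * (2 * sqrt R) * (exp (2 * R) / 2)"
  proof (intro mult_mono mult_left_mono)
    have "sqrt (1 + R) \<le> sqrt (4 * R)" using R by simp
    then show "sqrt (1 + R) \<le> 2 * sqrt R" by (simp add: real_sqrt_mult)
  qed (use R C in auto)
  also have "\<dots> = 2 * C * exp (2 * R) * (R * sqrt R)" by simp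
  also have "R * sqrt R = R powr (3/2)"
    using R powr_add[of R 1 "1/2"] by (simp add: powr_half_sqrt)
  finally show ?thesis .
qed

lemma funpow_partial_translate:
  assumes h: "h \<in> harmonic_functions"
  shows "(partial k ^^ n) (\<lambda>x. h (y + x)) = (\<lambda>x. (partial k ^^ n) h (y + x))"
    and harmonic_funpow_partial: "(partial k ^^ n) h \<in> harmonic_functions"
proof -
  have 1: "(partial k ^^ n) h \<in> harmonic_functions" for n
    using h by (induction n) (auto intro: harmonic_partial)
  show "(partial k ^^ n) h \<in> harmonic_functions" by (rule 1)
  show "(partial k ^^ n) (\<lambda>x. h (y + x)) = (\<lambda>x. (partial k ^^ n) h (y + x))"
    by (induction n) (use C1_translate(2)[OF harmonicD(1)[OF 1]] in auto)
qed

text \<open>Recentring at \<open>y\<close> enlarges balls about the origin by at most \<rho>, which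
  changes the growth bound by a constant depending on \<rho> only. Uniformity in \<open>y\<close> is
  essential because the suprema over spheres are attained at points that vary with
  \<open>n\<close>.\<close>

lemma local_square_sum:
  fixes k :: "'n::finite" and h :: "real ^ 'n \<Rightarrow> real"
  assumes N: "CARD('n) \<ge> 2" and h: "h \<in> harmonic_functions" and c: "c > 0"
    and M: "\<forall>\<^sub>F r in at_top. M2 h r \<le> c * (exp r / r powr (real CARD('n) / 2 - 3 / 4))"
    and \<rho>: "\<rho> \<ge> 0"
  shows "\<exists>C\<ge>0. \<forall>y K. norm y \<le> \<rho> \<longrightarrow> K \<ge> 1 \<longrightarrow> (\<Sum>n<K. ((partial k ^^ n) h y)\<^sup>2) \<le> C * real K"
proof -
  have ch: "continuous_on UNIV h" by (rule harmonic_continuous[OF h])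
  obtain C where C: "C \<ge> 0" "\<And>t. t \<ge> 0 \<Longrightarrow> (\<integral>\<^sup>+x. ennreal ((h x)\<^sup>2) * indicator (cball 0 t) x \<partial>lborel)
     \<le> ennreal (C * (exp (2 * t) * sqrt (1 + t)))"
    using ball_growth[OF ch c M] by blast
  obtain B where B: "B \<ge> 0" "\<And>g C K. g \<in> harmonic_functions \<Longrightarrow> C \<ge> 0 \<Longrightarrow>
     (\<forall>R\<ge>1. ball_integral R 1 (\<lambda>x. (g x)\<^sup>2) \<le> C * exp (2 * R) * R powr (3/2)) \<Longrightarrow>
     K \<ge> 1 \<Longrightarrow> (\<Sum>n<K. ((partial k ^^ n) g 0)\<^sup>2) \<le> B * C * real K"
    using derivative_square_sum[OF N, of k] by blast
  define C' where "C' = C * (exp (2 * \<rho>) * sqrt (1 + \<rho>))"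
  have C': "C' \<ge> 0" using C(1) \<rho> by (simp add: C'_def)
  have "(\<Sum>n<K. ((partial k ^^ n) h y)\<^sup>2) \<le> B * (2 * C') * real K" if y: "norm y \<le> \<rho>" and K: "K \<ge> 1" for y K
  proof -
    let ?g = "\<lambda>x. h (y + x)"
    have cg: "continuous_on UNIV ?g" by (rule harmonic_continuous[OF harmonic_translate[OF h]])
    have gb: "(\<integral>\<^sup>+x. ennreal ((?g x)\<^sup>2) * indicator (cball 0 t) x \<partial>lborel) \<le> ennreal (C' * (exp (2 * t) * sqrt (1 + t)))"
      if t: "t \<ge> 0" for t
    proof -
      have "(\<integral>\<^sup>+x. ennreal ((?g x)\<^sup>2) * indicator (cball 0 t) x \<partial>lborel)
         \<le> (\<integral>\<^sup>+x. ennreal ((h x)\<^sup>2) * indicator (cball 0 (t + norm y)) x \<partial>lborel)"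
        by (intro nn_integral_translate_ball borel_measurable_continuous_onI ch)
      also have "\<dots> \<le> ennreal (C * (exp (2 * (t + norm y)) * sqrt (1 + (t + norm y))))"
        using t by (intro C(2)) simp
      also have "\<dots> \<le> ennreal (C' * (exp (2 * t) * sqrt (1 + t)))"
      proof (rule ennreal_leI)
        have "1 + (t + norm y) \<le> (1 + \<rho>) * (1 + t)"
          using y mult_nonneg_nonneg[OF \<rho> t] by (simp add: distrib_left distrib_right)
        then have "sqrt (1 + (t + norm y)) \<le> sqrt (1 + \<rho>) * sqrt (1 + t)"
          by (simp add: real_sqrt_mult[symmetric])
        moreover have "exp (2 * (t + norm y)) \<le> exp (2 * \<rho>) * exp (2 * t)"
          using y by (simp add: exp_add[symmetric])
        ultimately have "exp (2 * (t + norm y)) * sqrt (1 + (t + norm y)) \<le>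
            (exp (2 * \<rho>) * exp (2 * t)) * (sqrt (1 + \<rho>) * sqrt (1 + t))"
          using t by (intro mult_mono) auto
        from mult_left_mono[OF this C(1)]
        show "C * (exp (2 * (t + norm y)) * sqrt (1 + (t + norm y))) \<le> C' * (exp (2 * t) * sqrt (1 + t))"
          by (simp add: C'_def mult_ac)
      qed
      finally show ?thesis .
    qed
    have "ball_integral R 1 (\<lambda>x. (?g x)\<^sup>2) \<le> (2 * C') * exp (2 * R) * R powr (3/2)" if "R \<ge> 1" for R
      by (rule ball_integral_square_le[OF cg that C' gb])
    then have "(\<Sum>n<K. ((partial k ^^ n) ?g 0)\<^sup>2) \<le> B * (2 * C') * real K"
      using C' K by (intro B(2) harmonic_translate h) auto
    then show ?thesis by (simp add: funpow_partial_translate[OF h])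
  qed
  moreover have "B * (2 * C') \<ge> 0" using B(1) C' by simp
  ultimately show ?thesis by blast
qed

text \<open>Variance argument: a mean of squares is at least the square of the mean, which is
  \<open>u x\<close>. The fixed ball of radius \<open>\<rho> + 1\<close> contains the unit ball
  about every admissible \<open>x\<close>, so the bound no longer depends on
  \<open>x\<close>.\<close>

lemma harmonic_square_le:
  fixes u :: "real ^ 'n::finite \<Rightarrow> real"
  assumes u: "u \<in> harmonic_functions" and x: "norm x \<le> \<rho>"
  shows "(u x)\<^sup>2 * ball_integral 1 1 (\<lambda>x::real^'n. 1) \<le> (LINT z:cball 0 (\<rho> + 1)|lborel. (u z)\<^sup>2)"
proof -
  let ?W = "ball_integral 1 1 (\<lambda>x::real^'n. 1)"
  have cu [continuous_intros]: "continuous_on UNIV (\<lambda>z. u (x + z))"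
    by (rule harmonic_continuous[OF harmonic_translate[OF u]])
  have mv: "ball_integral 1 1 (\<lambda>z. u (x + z)) = u x * ?W"
    using harmonic_mean_value[OF harmonic_translate[OF u, of x], of 1 1] by simp
  have "0 \<le> ball_integral 1 1 (\<lambda>z. (u (x + z) - u x)\<^sup>2)" by (rule ball_integral_nonneg) simp
  also have "(\<lambda>z. (u (x + z) - u x)\<^sup>2) = (\<lambda>z. (u (x + z))\<^sup>2 - ((2 * u x) * u (x + z) - (u x)\<^sup>2 * 1))"
    by (simp add: power2_eq_square algebra_simps)
  also have "ball_integral 1 1 \<dots> = ball_integral 1 1 (\<lambda>z. (u (x + z))\<^sup>2) - ((2 * u x) * (u x * ?W) - (u x)\<^sup>2 * ?W)"
  proof -
    have c: "continuous_on UNIV (\<lambda>z. (u (x + z))\<^sup>2)" "continuous_on UNIV (\<lambda>z. (2 * u x) * u (x + z))"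
      "continuous_on UNIV (\<lambda>z::real^'n. (u x)\<^sup>2 * 1)"
      by (intro continuous_intros)+
    have "ball_integral 1 1 (\<lambda>z. (2 * u x) * u (x + z)) = (2 * u x) * (u x * ?W)"
      "ball_integral 1 1 (\<lambda>z::real^'n. (u x)\<^sup>2 * 1) = (u x)\<^sup>2 * ?W"
      by (simp_all only: ball_integral_cmult mv)
    then show ?thesis
      using ball_integral_diff[OF c(1) continuous_on_diff[OF c(2,3)], of 1 1] ball_integral_diff[OF c(2,3), of 1 1] by simp
  qed
  finally have "(u x)\<^sup>2 * ?W \<le> ball_integral 1 1 (\<lambda>z. (u (x + z))\<^sup>2)"
    by (simp add: power2_eq_square)
  also have "\<dots> = (LINT z|lborel. (u z)\<^sup>2 * ball_weight 1 1 (z - x))"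
  proof -
    have "(LINT z|lborel. (u z)\<^sup>2 * ball_weight 1 1 (z - x)) = (LINT z|distr lborel borel ((+) x). (u z)\<^sup>2 * ball_weight 1 1 (z - x))"
      by (simp add: lborel_distr_plus)
    also have "\<dots> = (LINT z|lborel. (u (x + z))\<^sup>2 * ball_weight 1 1 (x + z - x))"
      by (rule integral_distr)
        (auto intro!: borel_measurable_continuous_onI continuous_intros harmonic_continuous[OF u]
          continuous_on_compose2[OF continuous_ball_weight])
    finally show ?thesis by (simp add: ball_integral_def)
  qed
  also have "\<dots> \<le> (LINT z:cball 0 (\<rho> + 1)|lborel. (u z)\<^sup>2)"
    unfolding set_lebesgue_integral_def
  proof (rule integral_mono)
    have z: "norm z \<le> \<rho> + 1" if "norm (z - x) \<le> 1" for z
      using that x norm_triangle_ineq[of "z - x" x] by simp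
    show "integrable lborel (\<lambda>z. (u z)\<^sup>2 * ball_weight 1 1 (z - x))"
    proof (rule integrable_compact_support[of _ "\<rho> + 1"])
      show "(u y)\<^sup>2 * ball_weight 1 1 (y - x) = 0" if "\<rho> + 1 < norm y" for y
        using z[of y] that ball_weight_eq_0[of 1 1 "y - x"] by force
    qed (auto intro!: continuous_intros harmonic_continuous[OF u] continuous_on_compose2[OF continuous_ball_weight])
    show "integrable lborel (\<lambda>z. indicat_real (cball 0 (\<rho> + 1)) z *\<^sub>R (u z)\<^sup>2)"
      by (rule borel_integrable_compact) (auto intro!: continuous_intros harmonic_continuous[OF u])
    show "(u y)\<^sup>2 * ball_weight 1 1 (y - x) \<le> indicat_real (cball 0 (\<rho> + 1)) y *\<^sub>R (u y)\<^sup>2" for y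
    proof (cases "norm (y - x) \<le> 1")
      case True
      have "ball_weight 1 1 (y - x) \<le> 1" by (simp add: ball_weight_def)
      from mult_left_mono[OF this, of "(u y)\<^sup>2"] show ?thesis using z[OF True] by simp
    next
      case False
      then show ?thesis by (simp add: ball_weight_eq_0)
    qed
  qed
  finally show ?thesis .
qed

lemma abs_le_sphere_seminorm:
  fixes u :: "real ^ 'n::finite \<Rightarrow> real"
  assumes u: "continuous_on UNIV u" and x: "norm x = real m"
  shows "\<bar>u x\<bar> \<le> sphere_seminorm m u"
proof -
  have "bounded ((\<lambda>x. \<bar>u x\<bar>) ` sphere 0 (real m))"
    by (intro compact_imp_bounded compact_continuous_image continuous_intros continuous_on_subset[OF u]) auto
  then have "bdd_above ((\<lambda>x. \<bar>u x\<bar>) ` sphere 0 (real m))" by (rule bounded_imp_bdd_above)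
  then show ?thesis
    unfolding sphere_seminorm_def using x by (intro cSUP_upper) auto
qed

lemma sphere_nonempty: "axis k (real m) \<in> sphere (0 :: real ^ 'n::finite) (real m)"
  by (simp add: norm_eq_sqrt_inner inner_axis_axis)

text \<open>The supremum over the sphere sits at a different point for each \<open>n\<close>.
  Replacing it by an integral over a fixed ball allows the sum to be taken under the integral, where
  the pointwise averages of \<open>local_square_sum\<close> apply.\<close>

lemma sphere_seminorm_square_sum:
  fixes k :: "'n::finite" and h :: "real ^ 'n \<Rightarrow> real"
  assumes N: "CARD('n) \<ge> 2" and h: "h \<in> harmonic_functions" and c: "c > 0"
    and M: "\<forall>\<^sub>F r in at_top. M2 h r \<le> c * (exp r / r powr (real CARD('n) / 2 - 3 / 4))"
  shows "\<exists>C\<ge>0. \<forall>K\<ge>1. (\<Sum>n<K. (sphere_seminorm m ((partial k ^^ n) h))\<^sup>2) \<le> C * real K"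
proof -
  let ?W = "ball_integral 1 1 (\<lambda>x::real^'n. 1)" and ?B = "cball 0 (real m + 1) :: (real^'n) set"
  have W: "?W > 0" by (rule ball_integral_1_pos) auto
  obtain C where C: "C \<ge> 0" "\<And>y K. norm y \<le> real m + 1 \<Longrightarrow> K \<ge> 1 \<Longrightarrow> (\<Sum>n<K. ((partial k ^^ n) h y)\<^sup>2) \<le> C * real K"
    using local_square_sum[OF N h c M, of "real m + 1" k] by fastforce
  have iu: "set_integrable lborel ?B (\<lambda>z. ((partial k ^^ n) h z)\<^sup>2)" for n
    unfolding set_integrable_def
    by (rule borel_integrable_compact)
       (auto intro!: continuous_on_power harmonic_continuous[OF harmonic_funpow_partial[OF h]])
  have "(\<Sum>n<K. (sphere_seminorm m ((partial k ^^ n) h))\<^sup>2) \<le> (C * measure lborel ?B / ?W) * real K" if K: "K \<ge> 1" for K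
  proof -
    have "(\<Sum>n<K. (sphere_seminorm m ((partial k ^^ n) h))\<^sup>2 * ?W) \<le> (\<Sum>n<K. LINT z:?B|lborel. ((partial k ^^ n) h z)\<^sup>2)"
    proof (rule sum_mono)
      fix n
      let ?u = "(partial k ^^ n) h"
      let ?I = "LINT z:?B|lborel. (?u z)\<^sup>2"
      note u = harmonic_funpow_partial[OF h, of n k]
      have le: "\<bar>?u x\<bar> \<le> sqrt (?I / ?W)" if "norm x \<le> real m" for x
      proof -
        have "(?u x)\<^sup>2 \<le> ?I / ?W"
          using harmonic_square_le[OF u that] W by (simp add: pos_le_divide_eq)
        then show ?thesis by (metis real_sqrt_abs real_sqrt_le_iff)
      qed
      have "sphere_seminorm m ?u \<le> sqrt (?I / ?W)"
        unfolding sphere_seminorm_def using sphere_nonempty[of k m] le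
        by (intro cSUP_least) auto
      moreover have "0 \<le> sphere_seminorm m ?u"
        using order_trans[OF abs_ge_zero abs_le_sphere_seminorm[OF harmonic_continuous[OF u]]] sphere_nonempty[of k m] by simp
      ultimately have "(sphere_seminorm m ?u)\<^sup>2 \<le> (sqrt (?I / ?W))\<^sup>2" by (intro power_mono)
      also have "\<dots> = ?I / ?W"
        using W by (intro real_sqrt_pow2 divide_nonneg_pos)
          (auto simp: set_lebesgue_integral_def intro!: integral_nonneg_AE)
      finally show "(sphere_seminorm m ?u)\<^sup>2 * ?W \<le> ?I" using W by (simp add: pos_le_divide_eq)
    qed
    also have "\<dots> = (LINT z:?B|lborel. (\<Sum>n<K. ((partial k ^^ n) h z)\<^sup>2))"
      unfolding set_lebesgue_integral_def scaleR_sum_right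
      by (rule Bochner_Integration.integral_sum[symmetric]) (rule iu[unfolded set_integrable_def])
    also have "\<dots> \<le> (LINT z:?B|lborel. C * real K)"
    proof (rule set_integral_mono)
      show "set_integrable lborel ?B (\<lambda>z. \<Sum>n<K. ((partial k ^^ n) h z)\<^sup>2)"
        unfolding set_integrable_def scaleR_sum_right
        by (rule Bochner_Integration.integrable_sum) (rule iu[unfolded set_integrable_def])
      show "set_integrable lborel ?B (\<lambda>z. C * real K)"
        unfolding set_integrable_def by (rule borel_integrable_compact) auto
    qed (use C(2) K in auto)
    also have "\<dots> = C * real K * measure lborel ?B"
      by (simp add: set_lebesgue_integral_def)
    finally have "(\<Sum>n<K. (sphere_seminorm m ((partial k ^^ n) h))\<^sup>2) * ?W \<le> C * real K * measure lborel ?B"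
      unfolding sum_distrib_right .
    then show ?thesis using W by (simp add: pos_le_divide_eq mult_ac)
  qed
  moreover have "C * measure lborel ?B / ?W \<ge> 0" using C(1) W by simp
  ultimately show ?thesis by blast
qed

section \<open>Upper density one against bounded averages\<close>

lemma upper_density_frequently:
  assumes "upper_density B = 1" and "d < 1"
  shows "\<exists>K\<ge>K0. real (card (B \<inter> {1..K})) > d * real K"
proof (rule ccontr)
  assume "\<not> ?thesis"
  then have "\<forall>K\<ge>K0. real (card (B \<inter> {1..K})) \<le> d * real K" by (auto simp: not_less)
  then have "\<forall>\<^sub>F K in sequentially. ereal (real (card (B \<inter> {1..K})) / real K) \<le> ereal d"
    unfolding eventually_sequentially
    by (intro exI[of _ "max 1 K0"]) (auto simp: field_simps)
  then have "upper_density B \<le> ereal d"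
    unfolding upper_density_def by (rule Limsup_bounded)
  with assms show False by simp
qed

lemma not_distributionally_irregular:
  fixes k :: "'n::finite" and h :: "real ^ 'n \<Rightarrow> real"
  assumes N: "CARD('n) \<ge> 2" and h: "h \<in> harmonic_functions" and c: "c > 0"
    and M: "\<forall>\<^sub>F r in at_top. M2 h r \<le> c * (exp r / r powr (real CARD('n) / 2 - 3 / 4))"
  shows "\<not> distributionally_irregular sphere_seminorm (partial k) h"
proof
  assume "distributionally_irregular sphere_seminorm (partial k) h"
  then obtain m B where B: "upper_density B = 1"
    and lim: "filterlim (\<lambda>n. sphere_seminorm m ((partial k ^^ n) h)) at_top (inf sequentially (principal B))"
    unfolding distributionally_irregular_def by blast
  let ?p = "\<lambda>n. sphere_seminorm m ((partial k ^^ n) h)"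
  obtain C where C: "C \<ge> 0" "\<And>K. K \<ge> 1 \<Longrightarrow> (\<Sum>n<K. (?p n)\<^sup>2) \<le> C * real K"
    using sphere_seminorm_square_sum[OF N h c M, of m k] by blast
  \<comment> \<open>Tuned to the final contradiction: at least \<open>K / 4\<close> indices up to
    \<open>K\<close> carry \<open>L\<^sup>2\<close> each, in total \<open>2 * (C + 1) * K\<close>,
    against the upper bound \<open>C * real (Suc K)\<close>, which is at most
    \<open>2 * C * K\<close>.\<close>
  define L where "L = sqrt (8 * (C + 1))"
  have L: "L\<^sup>2 = 8 * (C + 1)" "L \<ge> 0" using C(1) by (simp_all add: L_def)
  have "eventually (\<lambda>n. L \<le> ?p n) (inf sequentially (principal B))"
    using lim by (simp add: filterlim_at_top)
  then obtain n0 where n0: "\<And>n. n \<ge> n0 \<Longrightarrow> n \<in> B \<Longrightarrow> L \<le> ?p n"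
    unfolding eventually_inf_principal eventually_sequentially by blast
  \<comment> \<open>A proportion above 1/2 allows the indices below \<open>n0\<close>, at most
    \<open>K / 4\<close> of them, to be discarded while \<open>K / 4\<close> remain.\<close>
  obtain K where K: "K \<ge> 4 * n0 + 4" "real (card (B \<inter> {1..K})) > 1/2 * real K"
    using upper_density_frequently[OF B, of "1/2" "4 * n0 + 4"] by auto
  have "card (B \<inter> {1..K}) \<le> card (B \<inter> {n0..K} \<union> {..<n0})"
    by (intro card_mono) auto
  also have "\<dots> \<le> card (B \<inter> {n0..K}) + card {..<n0}" by (rule card_Un_le)
  finally have "real (card (B \<inter> {n0..K})) \<ge> real (card (B \<inter> {1..K})) - real n0" by simp
  then have cK: "real (card (B \<inter> {n0..K})) \<ge> real K / 4" using K by linarith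
  have "8 * (C + 1) * (real K / 4) \<le> L\<^sup>2 * real (card (B \<inter> {n0..K}))"
    unfolding L using cK C(1) by (intro mult_left_mono) auto
  also have "\<dots> = (\<Sum>n\<in>B \<inter> {n0..K}. L\<^sup>2)" by simp
  also have "\<dots> \<le> (\<Sum>n\<in>B \<inter> {n0..K}. (?p n)\<^sup>2)"
    using n0 L by (intro sum_mono power_mono) auto
  also have "\<dots> \<le> (\<Sum>n<Suc K. (?p n)\<^sup>2)"
    by (intro sum_mono2) auto
  also have "\<dots> \<le> C * real (Suc K)" by (intro C(2)) simp
  also have "\<dots> \<le> C * (2 * real K)" using K C(1) by (intro mult_left_mono) auto
  finally have "2 * real K \<le> 0" by (simp add: algebra_simps)
  then show False using K by simp
qed

section \<open>Norms of zonal polynomials on the sphere\<close>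

lemma radial_moment:
  fixes a :: real
  assumes N: "N \<ge> 1" and a: "a \<ge> 0"
  shows "(\<integral>\<^sup>+r. ennreal (a * r ^ (N - 1) * (r ^ d * max 0 (1 - r\<^sup>2))) * indicator {0<..} r \<partial>lborel)
     = ennreal (a * (2 / ((real N + real d) * (real N + real d + 2))))"
proof -
  have "(\<integral>\<^sup>+r. ennreal (a * r ^ (N - 1) * (r ^ d * max 0 (1 - r\<^sup>2))) * indicator {0<..} r \<partial>lborel)
      = (\<integral>\<^sup>+r. ennreal (a * (r ^ (N + d - 1) - r ^ (N + d + 1))) * indicator {0..1} r \<partial>lborel)"
  proof (rule nn_integral_cong_AE)
    have "AE r in lborel. r \<noteq> (0::real)" by (rule AE_lborel_singleton)
    then show "AE r in lborel. ennreal (a * r ^ (N - 1) * (r ^ d * max 0 (1 - r\<^sup>2))) * indicator {0<..} r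
        = ennreal (a * (r ^ (N + d - 1) - r ^ (N + d + 1))) * indicator {0..1} r"
    proof eventually_elim
      case (elim r)
      consider "r < 0" | "0 < r \<and> r \<le> 1" | "r > 1" using elim by linarith
      then show ?case
      proof cases
        case 2
        then have "max 0 (1 - r\<^sup>2) = 1 - r\<^sup>2" by (simp add: power_le_one)
        moreover have "r ^ (N - 1) * (r ^ d * (1 - r\<^sup>2)) = r ^ (N + d - 1) - r ^ (N + d + 1)"
        proof -
          obtain M where "N = Suc M" using N by (cases N) auto
          then show ?thesis by (simp add: power_add power2_eq_square algebra_simps)
        qed
        ultimately show ?thesis using 2 by (simp add: mult.assoc)
      next
        case 3
        then have "1 - r\<^sup>2 \<le> 0" by (simp add: less_imp_le one_le_power)
        then have "max 0 (1 - r\<^sup>2) = 0" by simp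
        then show ?thesis using 3 by simp
      qed simp
    qed
  qed
  also have "\<dots> = ennreal (a * (1 ^ (N + d) / real (N + d) - 1 ^ (N + d + 2) / real (N + d + 2))
       - a * (0 ^ (N + d) / real (N + d) - 0 ^ (N + d + 2) / real (N + d + 2)))"
  proof (rule nn_integral_FTC_Icc[where F="\<lambda>r. a * (r ^ (N + d) / real (N + d) - r ^ (N + d + 2) / real (N + d + 2))"])
    fix r :: real assume r: "r \<in> {0..1}"
    have "((\<lambda>r. a * (r ^ (N + d) / real (N + d) - r ^ (N + d + 2) / real (N + d + 2))) has_field_derivative
        a * (real (N + d) * r ^ (N + d - 1) / real (N + d) - real (N + d + 2) * r ^ (N + d + 2 - 1) / real (N + d + 2))) (at r)"
      using DERIV_pow[of "N + d" r] DERIV_pow[of "N + d + 2" r]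
      by (intro DERIV_cmult DERIV_diff DERIV_cdivide) simp_all
    then show "((\<lambda>r. a * (r ^ (N + d) / real (N + d) - r ^ (N + d + 2) / real (N + d + 2))) has_field_derivative
        a * (r ^ (N + d - 1) - r ^ (N + d + 1))) (at r)"
      using N by simp
    have "r ^ (N + d + 1) \<le> r ^ (N + d - 1)" using r by (intro power_decreasing) auto
    then show "0 \<le> a * (r ^ (N + d - 1) - r ^ (N + d + 1))" using a by simp
  qed auto
  also have "a * (1 ^ (N + d) / real (N + d) - 1 ^ (N + d + 2) / real (N + d + 2))
       - a * (0 ^ (N + d) / real (N + d) - 0 ^ (N + d + 2) / real (N + d + 2))
     = a * (2 / ((real N + real d) * (real N + real d + 2)))"
  proof -
    define u where "u = real N + real d"
    have u: "real (N + d) = u" "real (N + d + 2) = u + 2" by (simp_all add: u_def)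
    have "u > 0" using N by (simp add: u_def)
    then have "1 / u - 1 / (u + 2) = 2 / (u * (u + 2))" by (simp add: divide_simps)
    then show ?thesis unfolding u u_def[symmetric] using N by (simp add: zero_power)
  qed
  finally show ?thesis .
qed

lemma nn_integral_homogeneous:
  fixes f :: "real ^ 'n::finite \<Rightarrow> real"
  assumes f: "continuous_on UNIV f" and hom: "\<And>s x. s > 0 \<Longrightarrow> f (s *\<^sub>R x) = s ^ d * f x"
  shows "(\<integral>\<^sup>+x. ennreal (f x * ball_weight 1 1 x) \<partial>lborel) =
    ennreal (sphere_area TYPE('n) * (2 / ((real CARD('n) + real d) * (real CARD('n) + real d + 2)))) *
    (\<integral>\<^sup>+x. ennreal (f x) \<partial>normalised_sphere_measure 1)"
proof -
  let ?a = "sphere_area TYPE('n)" and ?N = "CARD('n)"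
  let ?J = "\<integral>\<^sup>+x. ennreal (f x) \<partial>normalised_sphere_measure 1"
  have [measurable]: "f \<in> borel_measurable borel" "(ball_weight 1 1 :: real^'n \<Rightarrow> real) \<in> borel_measurable borel"
    by (intro borel_measurable_continuous_onI f continuous_ball_weight)+
  have "(\<integral>\<^sup>+x. ennreal (f x * ball_weight 1 1 x) \<partial>lborel) = (\<integral>\<^sup>+r. ennreal (?a * r ^ (?N - 1)) *
     (\<integral>\<^sup>+x. ennreal (f x * ball_weight 1 1 x) \<partial>normalised_sphere_measure r) * indicator {0<..} r \<partial>lborel)"
    by (rule nn_integral_polar_normalised) measurable
  also have "\<dots> = (\<integral>\<^sup>+r. (ennreal (?a * r ^ (?N - 1) * (r ^ d * max 0 (1 - r\<^sup>2))) * indicator {0<..} r) * ?J \<partial>lborel)"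
  proof (rule nn_integral_cong)
    fix r :: real
    show "ennreal (?a * r ^ (?N - 1)) *
     (\<integral>\<^sup>+x. ennreal (f x * ball_weight 1 1 x) \<partial>normalised_sphere_measure r) * indicator {0<..} r =
      (ennreal (?a * r ^ (?N - 1) * (r ^ d * max 0 (1 - r\<^sup>2))) * indicator {0<..} r) * ?J"
    proof (cases "r > 0")
      case True
      let ?v = "r ^ d * max 0 (1 - r\<^sup>2)"
      have v: "?v \<ge> 0" using True by simp
      have "(\<integral>\<^sup>+x. ennreal (f x * ball_weight 1 1 x) \<partial>normalised_sphere_measure r)
         = (\<integral>\<^sup>+x. ennreal (f (r *\<^sub>R x) * ball_weight 1 1 (r *\<^sub>R x)) \<partial>normalised_sphere_measure 1)"
        by (rule nn_integral_normalised_sphere_scale[OF _ True]) measurable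
      also have "\<dots> = (\<integral>\<^sup>+x. ennreal ?v * ennreal (f x) \<partial>normalised_sphere_measure 1)"
      proof (rule nn_integral_cong)
        fix x :: "real^'n" assume "x \<in> space (normalised_sphere_measure 1)"
        then have "x \<bullet> x = 1" by (simp add: norm_eq_1)
        then have "f (r *\<^sub>R x) * ball_weight 1 1 (r *\<^sub>R x) = ?v * f x"
          by (simp add: hom[OF True] ball_weight_def power2_eq_square)
        then show "ennreal (f (r *\<^sub>R x) * ball_weight 1 1 (r *\<^sub>R x)) = ennreal ?v * ennreal (f x)"
          using v by (simp add: ennreal_mult')
      qed
      also have "\<dots> = ennreal ?v * ?J"
        by (rule nn_integral_cmult) (rule measurable_normalised_sphere, measurable)
      finally show ?thesis
        using True v sphere_area_pos[where ?'n='n] by (simp add: ennreal_mult mult.assoc)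
    qed simp
  qed
  also have "\<dots> = (\<integral>\<^sup>+r. ennreal (?a * r ^ (?N - 1) * (r ^ d * max 0 (1 - r\<^sup>2))) * indicator {0<..} r \<partial>lborel) * ?J"
    by (rule nn_integral_multc) measurable
  also have "\<dots> = ennreal (?a * (2 / ((real ?N + real d) * (real ?N + real d + 2)))) * ?J"
    using sphere_area_pos[where ?'n='n] by (subst radial_moment) (auto simp: Suc_leI)
  finally show ?thesis .
qed

text \<open>Polar coordinates split off the elementary moment \<open>radial_moment\<close>. This
  carries the ball identities for products of zonal polynomials, which are homogeneous of degree
  \<open>m + n\<close>, over to the sphere without any calculus on the sphere itself.\<close>

lemma ball_integral_homogeneous:
  fixes f :: "real ^ 'n::finite \<Rightarrow> real"
  assumes f: "continuous_on UNIV f" and hom: "\<And>s x. s > 0 \<Longrightarrow> f (s *\<^sub>R x) = s ^ d * f x"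
  shows "ball_integral 1 1 f = sphere_area TYPE('n) * (2 / ((real CARD('n) + real d) * (real CARD('n) + real d + 2))) *
    (LINT x|normalised_sphere_measure 1. f x)"
proof -
  let ?c = "sphere_area TYPE('n) * (2 / ((real CARD('n) + real d) * (real CARD('n) + real d + 2)))"
  have c: "?c \<ge> 0" using sphere_area_pos[where ?'n='n] by simp
  have f': "continuous_on UNIV (\<lambda>x. - f x)" by (intro continuous_intros f)
  have hom': "\<And>s x. s > 0 \<Longrightarrow> - f (s *\<^sub>R x) = s ^ d * - f x" by (simp add: hom)
  \<comment> \<open>Since \<open>ennreal\<close> truncates at zero, the nonnegative integrals of
    \<open>f\<close> and \<open>- f\<close> are those of its positive and negative parts.\<close>
  have "ball_integral 1 1 f = enn2real (\<integral>\<^sup>+x. ennreal (f x * ball_weight 1 1 x) \<partial>lborel)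
      - enn2real (\<integral>\<^sup>+x. ennreal (- f x * ball_weight 1 1 x) \<partial>lborel)"
    unfolding ball_integral_def using ball_integral_integrable[OF f, of 1 1] by (subst real_lebesgue_integral_def) auto
  also have "(\<integral>\<^sup>+x. ennreal (f x * ball_weight 1 1 x) \<partial>lborel) = ennreal ?c * (\<integral>\<^sup>+x. ennreal (f x) \<partial>normalised_sphere_measure 1)"
    by (rule nn_integral_homogeneous[OF f hom])
  also have "(\<integral>\<^sup>+x. ennreal (- f x * ball_weight 1 1 x) \<partial>lborel) = ennreal ?c * (\<integral>\<^sup>+x. ennreal (- f x) \<partial>normalised_sphere_measure 1)"
    by (rule nn_integral_homogeneous[OF f' hom'])
  also have "enn2real (ennreal ?c * (\<integral>\<^sup>+x. ennreal (f x) \<partial>normalised_sphere_measure 1))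
      - enn2real (ennreal ?c * (\<integral>\<^sup>+x. ennreal (- f x) \<partial>normalised_sphere_measure 1)) = ?c * (enn2real (\<integral>\<^sup>+x. ennreal (f x) \<partial>normalised_sphere_measure 1)
      - enn2real (\<integral>\<^sup>+x. ennreal (- f x) \<partial>normalised_sphere_measure 1))"
    unfolding enn2real_mult enn2real_ennreal[OF c] by (rule right_diff_distrib[symmetric])
  also have "\<dots> = ?c * (LINT x|normalised_sphere_measure 1. f x)"
    using integrable_normalised_sphere[OF f, of 1] by (subst real_lebesgue_integral_def) auto
  finally show ?thesis .
qed

definition sphere_weight :: "nat \<Rightarrow> nat \<Rightarrow> real" where
  "sphere_weight N n = zonal_weight N n * ((real N + 2 * real n) * (real N + 2 * real n + 2))"

lemma sphere_weight_pos: "N \<ge> 2 \<Longrightarrow> sphere_weight N n > 0"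
  unfolding sphere_weight_def by (intro mult_pos_pos zonal_weight_pos) auto

lemma sphere_weight_Suc:
  assumes "N \<ge> 2" "n \<ge> 1"
  shows "sphere_weight N (Suc n) * ((real n + N - 2) * (real n + 1) * (2 * real n + N)) =
    sphere_weight N n * (2 * real n + N - 2)"
proof -
  have "(2 * (real n + 2) + N) * (sphere_weight N (Suc n) * ((real n + N - 2) * (real n + 1) * (2 * real n + N)))
      = (zonal_weight N (Suc n) * ((real n + N - 2) * (2 * (real n + 2) + N) * (real n + 1)))
         * ((N + 2 * real n) * (N + 2 * real n + 2) * (2 * (real n + 2) + N))"
    by (simp add: sphere_weight_def algebra_simps)
  also have "\<dots> = (2 * (real n + 2) + N) * (sphere_weight N n * (2 * real n + N - 2))"
    unfolding zonal_weight_Suc[OF assms] sphere_weight_def by (simp add: algebra_simps)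
  finally show ?thesis
    using assms by (simp add: add_nonneg_eq_0_iff)
qed

text \<open>The sequence \<open>x n * exp (K / n)\<close> is decreasing.\<close>

lemma bounded_of_ratio:
  fixes x :: "nat \<Rightarrow> real"
  assumes pos: "\<And>n. x n > 0" and K: "K \<ge> 0"
    and step: "\<And>n. n \<ge> 1 \<Longrightarrow> x (Suc n) \<le> x n * (1 + K / (real n * (real n + 1)))"
  shows "\<exists>B>0. \<forall>n. x n \<le> B"
proof -
  have dec: "x (Suc n) * exp (K / real (Suc n)) \<le> x n * exp (K / real n)" if n: "n \<ge> 1" for n
  proof -
    have "K / (real n * (real n + 1)) = K / real n - K / real (Suc n)"
      using n by (simp add: field_simps)
    then have "1 + K / (real n * (real n + 1)) \<le> exp (K / real n - K / real (Suc n))"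
      using exp_ge_add_one_self by metis
    then have "x (Suc n) \<le> x n * exp (K / real n - K / real (Suc n))"
      using step[OF n] mult_left_mono[OF _ less_imp_le[OF pos[of n]]] by (meson order_trans)
    then have "x (Suc n) * exp (K / real (Suc n)) \<le> x n * exp (K / real n - K / real (Suc n)) * exp (K / real (Suc n))"
      by (rule mult_right_mono) simp
    then show ?thesis by (simp add: mult.assoc exp_add[symmetric])
  qed
  have le: "x n * exp (K / real n) \<le> x 1 * exp (K / real 1)" if "n \<ge> 1" for n
    using that
  proof (induction n rule: dec_induct)
    case (step m)
    then show ?case using dec[of m] by simp
  qed simp
  have "x n \<le> max (x 0) (x 1 * exp K)" for n
  proof (cases "n = 0")
    case False
    have "x n * 1 \<le> x n * exp (K / real n)"
      using pos[of n] K by (intro mult_left_mono) auto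
    also have "\<dots> \<le> x 1 * exp K" using le[of n] False by simp
    finally show ?thesis by simp
  qed simp
  moreover have "max (x 0) (x 1 * exp K) > 0" using pos[of 0] by (simp add: less_max_iff_disj)
  ultimately show ?thesis by blast
qed

text \<open>With \<open>y\<close>, \<open>e\<close> and \<open>p\<close> as in the proof,
  \<open>4 * p = y\<^sup>2 - 2 * y - e\<close>, so the left-hand side differs from
  \<open>(4 * p)\<^sup>2\<close> by
  \<open>2 * e * (y\<^sup>2 - 2 * y) - e\<^sup>2 - (y - 2)\<^sup>2\<close>, which is two orders
  smaller. Only a positive \<open>e\<close> needs compensation, and the last term on the right
  provides it.\<close>

lemma sphere_ratio_polynomial:
  fixes n N :: nat
  assumes n: "n \<ge> 1" and N: "N \<ge> 2"
  shows "(2 * real n + N - 2)\<^sup>2 * ((2 * real n + N)\<^sup>2 - 1)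
     \<le> 16 * ((real n + N - 2) * (real n + 1))\<^sup>2 * (1 + (real N)\<^sup>2 / (real n * (real n + 1)))"
proof -
  define y e p where "y = 2 * real n + real N" and "e = (real N - 2) * (real N - 4)" and "p = (real n + N - 2) * (real n + 1)"
  have p4: "4 * p = y\<^sup>2 - 2 * y - e"
    by (simp add: y_def e_def p_def power2_eq_square algebra_simps)
  have id: "(y - 2)\<^sup>2 * (y\<^sup>2 - 1) = (4 * p)\<^sup>2 + (2 * e * (y\<^sup>2 - 2 * y) - e\<^sup>2 - (y - 2)\<^sup>2)"
    unfolding p4 by (simp add: power2_eq_square algebra_simps)
  have y4: "y \<ge> 4" using n N by (simp add: y_def)
  have yy: "y\<^sup>2 - 2 * y \<ge> 0" using y4 by (simp add: power2_eq_square)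
  have q0: "real n * (real n + 1) > 0" using n by simp
  have "2 * e * (y\<^sup>2 - 2 * y) - e\<^sup>2 - (y - 2)\<^sup>2 \<le> 16 * p\<^sup>2 * ((real N)\<^sup>2 / (real n * (real n + 1)))"
  proof (cases "e \<le> 0")
    case True
    then have "2 * e * (y\<^sup>2 - 2 * y) \<le> 0" using yy by (simp add: mult_nonpos_nonneg)
    moreover have "16 * p\<^sup>2 * ((real N)\<^sup>2 / (real n * (real n + 1))) \<ge> 0" by simp
    ultimately show ?thesis using zero_le_power2[of e] zero_le_power2[of "y - 2"] by linarith
  next
    case False
    have N4: "real N \<ge> 4"
    proof (rule ccontr)
      assume "\<not> real N \<ge> 4"
      then have "real N - 4 \<le> 0" "real N - 2 \<ge> 0" using N by auto
      then have "e \<le> 0" unfolding e_def by (simp add: mult_nonneg_nonpos)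
      then show False using False by simp
    qed
    have "y\<^sup>2 - 2 * y \<le> (2 * (real n + N - 2))\<^sup>2"
    proof -
      have "y\<^sup>2 \<le> (2 * (real n + N - 2))\<^sup>2"
        using N4 y4 by (intro power_mono) (auto simp: y_def)
      then show ?thesis using y4 by linarith
    qed
    moreover have "e \<le> (real N)\<^sup>2"
      using N4 by (simp add: e_def power2_eq_square algebra_simps)
    ultimately have "2 * e * (y\<^sup>2 - 2 * y) \<le> 2 * (real N)\<^sup>2 * (2 * (real n + N - 2))\<^sup>2"
      using yy False by (intro mult_mono) auto
    also have "\<dots> = 8 * (real N)\<^sup>2 * (real n + N - 2)\<^sup>2"
      by (simp only: power_mult_distrib) simp
    also have "\<dots> \<le> 16 * p\<^sup>2 * ((real N)\<^sup>2 / (real n * (real n + 1)))"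
    proof -
      have "8 * (real N)\<^sup>2 * (real n + N - 2)\<^sup>2 * (real n * (real n + 1)) \<le> 16 * (real N)\<^sup>2 * (real n + N - 2)\<^sup>2 * ((real n + 1) * (real n + 1))"
        using n by (intro mult_mono) auto
      also have "\<dots> = 16 * p\<^sup>2 * (real N)\<^sup>2" by (simp add: p_def power2_eq_square)
      finally show ?thesis using q0 by (simp add: pos_le_divide_eq)
    qed
    finally show ?thesis using zero_le_power2[of e] zero_le_power2[of "y - 2"] by linarith
  qed
  then have "(y - 2)\<^sup>2 * (y\<^sup>2 - 1) \<le> 16 * p\<^sup>2 * (1 + (real N)\<^sup>2 / (real n * (real n + 1)))"
    unfolding id by (simp add: power_mult_distrib distrib_left)
  then show ?thesis by (simp add: y_def p_def)
qed

text \<open>The exponent \<open>N - 3/2\<close> asks for a factorial at the half-integer 2n + N -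
  3/2. Squaring replaces it by the product of the two neighbouring integer factorials, so that
  consecutive ratios are the rational functions of \<open>sphere_ratio_polynomial\<close>.\<close>

lemma sphere_weight_bound:
  assumes N: "N \<ge> 2"
  shows "\<exists>B>0. \<forall>n. (sphere_weight N n)\<^sup>2 * (fact (2 * n + N - 2) * fact (2 * n + N - 1)) \<le> B * 16 ^ n"
proof -
  define x where "x n = (sphere_weight N n)\<^sup>2 * (fact (2 * n + N - 2) * fact (2 * n + N - 1)) / 16 ^ n" for n
  have xpos: "x n > 0" for n
    using sphere_weight_pos[OF N, of n] by (simp add: x_def)
  have "\<exists>B>0. \<forall>n. x n \<le> B"
  proof (rule bounded_of_ratio[of _ "(real N)\<^sup>2"])
    fix n :: nat assume n: "n \<ge> 1"
    define y p where "y = 2 * real n + real N" and "p = (real n + N - 2) * (real n + 1)"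
    have y: "y \<ge> 4" using n N by (simp add: y_def)
    have p: "p > 0" using n N by (auto simp: p_def intro!: mult_pos_pos)
    obtain M where M: "2 * n + N = Suc (Suc M)"
      using N by (metis add_2_eq_Suc' le_add_diff_inverse2 trans_le_add2)
    have yM: "y = real M + 2" using M by (simp add: y_def)
    have w: "sphere_weight N (Suc n) = sphere_weight N n * ((y - 2) / (p * y))"
    proof -
      have "sphere_weight N (Suc n) * (p * y) = sphere_weight N n * (y - 2)"
        using sphere_weight_Suc[OF N n] by (simp add: y_def p_def mult.assoc)
      then show ?thesis using p y by (simp add: field_simps)
    qed
    have e: "2 * Suc n + N - 2 = Suc (Suc M)" "2 * Suc n + N - 1 = Suc (Suc (Suc M))"
        "2 * n + N - 2 = M" "2 * n + N - 1 = Suc M"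
      using M by auto
    have "fact (2 * Suc n + N - 2) * fact (2 * Suc n + N - 1) =
        (fact (2 * n + N - 2) * fact (2 * n + N - 1)) * (y\<^sup>2 * (y\<^sup>2 - 1))"
      unfolding e by (simp add: yM power2_eq_square algebra_simps)
    then have "x (Suc n) = (sphere_weight N n)\<^sup>2 * ((y - 2) / (p * y))\<^sup>2 *
       ((fact (2 * n + N - 2) * fact (2 * n + N - 1)) * (y\<^sup>2 * (y\<^sup>2 - 1))) / (16 * 16 ^ n)"
      unfolding x_def w power_mult_distrib[of "sphere_weight N n"] power_Suc by (simp only:)
    also have "\<dots> = x n * ((y - 2)\<^sup>2 * (y\<^sup>2 - 1) / (16 * p\<^sup>2))"
      using y by (simp add: x_def power_divide power_mult_distrib mult_ac)
    also have "\<dots> \<le> x n * (1 + (real N)\<^sup>2 / (real n * (real n + 1)))"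
    proof (rule mult_left_mono)
      show "(y - 2)\<^sup>2 * (y\<^sup>2 - 1) / (16 * p\<^sup>2) \<le> 1 + (real N)\<^sup>2 / (real n * (real n + 1))"
      proof -
        have "(y - 2)\<^sup>2 * (y\<^sup>2 - 1) \<le> 16 * p\<^sup>2 * (1 + (real N)\<^sup>2 / (real n * (real n + 1)))"
          using sphere_ratio_polynomial[OF n N] unfolding y_def p_def .
        then show ?thesis using p by (subst pos_divide_le_eq) (simp_all add: mult_ac)
      qed
    qed (use xpos in \<open>auto intro: less_imp_le\<close>)
    finally show "x (Suc n) \<le> x n * (1 + (real N)\<^sup>2 / (real n * (real n + 1)))" .
  qed (use xpos in auto)
  then show ?thesis by (auto simp: x_def field_simps)
qed

context
  fixes k :: "'n::finite"
  assumes N: "CARD('n) \<ge> 2"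
begin

lemma sphere_zonal_orthogonal:
  assumes "m \<noteq> n"
  shows "(LINT x|normalised_sphere_measure 1. zonal k m x * zonal k n x) = 0"
proof -
  have "ball_integral 1 1 (\<lambda>x. zonal k m x * zonal k n x) = sphere_area TYPE('n) *
      (2 / ((real CARD('n) + real (m + n)) * (real CARD('n) + real (m + n) + 2))) *
    (LINT x|normalised_sphere_measure 1. zonal k m x * zonal k n x)"
    by (intro ball_integral_homogeneous continuous_intros continuous_zonal[OF N])
       (simp add: zonal_homogeneous[OF N] power_add)
  moreover have "ball_integral 1 1 (\<lambda>x. zonal k m x * zonal k n x) = 0"
    by (rule ball_integral_zonal_orthogonal[OF N]) (use assms in auto)
  moreover have "real CARD('n) + real (m + n) > 0" by (simp add: add_pos_nonneg)
  ultimately show ?thesis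
    using sphere_area_pos[where ?'n='n] by auto
qed

lemma sphere_zonal_norm:
  "(LINT x|normalised_sphere_measure 1. (zonal k n x)\<^sup>2) / (fact n)\<^sup>2 =
    sphere_weight CARD('n) n * (ball_integral 1 1 (\<lambda>x::real^'n. 1) / (2 * sphere_area TYPE('n)))"
proof -
  let ?A = "LINT x|normalised_sphere_measure 1. (zonal k n x)\<^sup>2" and ?N = "real CARD('n)" and ?a = "sphere_area TYPE('n)"
  have "ball_integral 1 1 (\<lambda>x. (zonal k n x)\<^sup>2) = ?a * (2 / ((?N + real (2 * n)) * (?N + real (2 * n) + 2))) * ?A"
    by (intro ball_integral_homogeneous continuous_intros continuous_zonal[OF N])
       (simp add: zonal_homogeneous[OF N] power_mult_distrib power_mult[symmetric] mult.commute)
  moreover have "?N + 2 * real n > 0" "?N + 2 * real n + 2 > 0" by (simp_all add: add_pos_nonneg)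
  ultimately have "?A = ball_integral 1 1 (\<lambda>x. (zonal k n x)\<^sup>2) * ((?N + 2 * real n) * (?N + 2 * real n + 2)) / (2 * ?a)"
    using sphere_area_pos[where ?'n='n] by simp
  moreover have "ball_integral 1 1 (\<lambda>x. (zonal k n x)\<^sup>2) = zonal_weight CARD('n) n * ball_integral 1 1 (\<lambda>x::real^'n. 1) * (fact n)\<^sup>2"
    using ball_integral_zonal_norm[OF N, of 1 k n] by (simp add: divide_eq_eq)
  ultimately show ?thesis by (simp add: sphere_weight_def)
qed

lemma sphere_norm_zonal_sum:
  assumes r: "r > 0"
  shows "(LINT x|normalised_sphere_measure 1. (\<Sum>n<K. c n * zonal k n (r *\<^sub>R x))\<^sup>2) =
     (\<Sum>n<K. (c n)\<^sup>2 * r ^ (2 * n) * (LINT x|normalised_sphere_measure 1. (zonal k n x)\<^sup>2))"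
proof -
  let ?M = "normalised_sphere_measure 1 :: (real^'n) measure"
  define d where "d n = c n * r ^ n" for n
  have int: "integrable ?M (\<lambda>x. zonal k m x * zonal k n x)" for m n
    by (intro integrable_normalised_sphere continuous_intros continuous_zonal[OF N]) simp
  have "(\<lambda>x. (\<Sum>n<K. c n * zonal k n (r *\<^sub>R x))\<^sup>2) = (\<lambda>x. \<Sum>m<K. \<Sum>n<K. d m * d n * (zonal k m x * zonal k n x))"
    by (simp add: fun_eq_iff zonal_homogeneous[OF N] power2_eq_square sum_product d_def mult_ac)
  then have "(LINT x|?M. (\<Sum>n<K. c n * zonal k n (r *\<^sub>R x))\<^sup>2) =
      (\<Sum>m<K. \<Sum>n<K. d m * d n * (LINT x|?M. zonal k m x * zonal k n x))"
    using int by (simp add: Bochner_Integration.integral_sum)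
  also have "\<dots> = (\<Sum>m<K. \<Sum>n<K. if n = m then d m * d m * (LINT x|?M. (zonal k m x)\<^sup>2) else 0)"
    using sphere_zonal_orthogonal by (intro sum.cong refl) (auto simp: power2_eq_square)
  also have "\<dots> = (\<Sum>m<K. d m * d m * (LINT x|?M. (zonal k m x)\<^sup>2))"
    by simp
  also have "\<dots> = (\<Sum>n<K. (c n)\<^sup>2 * r ^ (2 * n) * (LINT x|?M. (zonal k n x)\<^sup>2))"
    by (intro sum.cong refl) (simp add: d_def power2_eq_square power_mult power_mult_distrib mult_ac)
  finally show ?thesis .
qed

end

section \<open>Comparison with the exponential series\<close>

lemma sum_pairs: "(\<Sum>j<2 * L. g j) = (\<Sum>n<L. g (2 * n) + g (Suc (2 * n)))"
  for g :: "nat \<Rightarrow> real"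
  by (induction L) (auto simp: add_ac)

text \<open>The exponential series at \<open>x\<close> has its mass near index \<open>x\<close>, so
  an extra factor \<open>m\<close> costs a factor \<open>x\<close>. With \<open>x = 2 * r\<close>
  and slope \<open>1 / r\<close>, as used below, a linearly growing coefficient costs only a
  constant.\<close>

lemma sum_power_fact_le:
  fixes x K e :: real
  assumes x: "x \<ge> 0" and K: "K \<ge> 0" and e: "e \<ge> 0"
  shows "(\<Sum>m<M. (K + e * real m) * (x ^ m / fact m)) \<le> (K + e * x) * exp x"
proof -
  have ex: "(\<Sum>m<M. x ^ m / fact m) \<le> exp x" for M
  proof -
    have "(\<lambda>m. x ^ m / fact m) sums exp x"
      using exp_converges[of x] by (simp add: divide_inverse mult.commute)
    then show ?thesis
      using x sum_le_suminf[of "\<lambda>m. x ^ m / fact m" "{..<M}"] by (auto simp: sums_iff)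
  qed
  have "(\<Sum>m<M. real m * (x ^ m / fact m)) \<le> x * exp x"
  proof (cases M)
    case (Suc L)
    have "(\<Sum>m<M. real m * (x ^ m / fact m)) = (\<Sum>m<L. x * (x ^ m / fact m))"
      unfolding Suc sum.lessThan_Suc_shift by (simp add: field_simps del: of_nat_Suc)
    also have "\<dots> \<le> x * exp x"
      unfolding sum_distrib_left[symmetric] using ex x by (intro mult_left_mono)
    finally show ?thesis .
  qed (use x in simp)
  then have "K * (\<Sum>m<M. x ^ m / fact m) + e * (\<Sum>m<M. real m * (x ^ m / fact m)) \<le> K * exp x + e * (x * exp x)"
    using ex K e by (intro add_mono mult_left_mono)
  moreover have "(\<Sum>m<M. (K + e * real m) * (x ^ m / fact m)) =
      K * (\<Sum>m<M. x ^ m / fact m) + e * (\<Sum>m<M. real m * (x ^ m / fact m))"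
    unfolding sum_distrib_left sum.distrib[symmetric] by (simp only: distrib_right mult.assoc)
  ultimately show ?thesis by (simp add: distrib_right mult.assoc)
qed

text \<open>\<open>sphere_weight N n\<close> is of order \<open>4\<^sup>n\<close> over the geometric mean of two consecutive factorials, so each
  term is bounded by two consecutive terms of the exponential series at \<open>2 * r\<close>.\<close>

lemma weighted_sphere_sum:
  assumes N: "N \<ge> 2"
  shows "\<exists>B>0. \<forall>r>0. \<forall>K\<ge>0. \<forall>J L. (\<forall>n. 0 \<le> J n \<and> J n \<le> K + 2 * real n / r) \<longrightarrow>
     (\<Sum>n<L. J n * sphere_weight N n * r ^ (2 * n)) \<le> B * (K + 2) * exp (2 * r) / r powr (real N - 3/2)"
proof -
  obtain B where B: "B > 0" "\<And>n. (sphere_weight N n)\<^sup>2 * (fact (2 * n + N - 2) * fact (2 * n + N - 1)) \<le> B * 16 ^ n"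
    using sphere_weight_bound[OF N] by blast
  define B' where "B' = sqrt B"
  have B'0: "B' > 0" using B by (simp add: B'_def)
  have "(\<Sum>n<L. J n * sphere_weight N n * r ^ (2 * n)) \<le> B' * (K + 2) * exp (2 * r) / r powr (real N - 3/2)"
    if r: "r > 0" and K: "K \<ge> 0" and J: "\<And>n. 0 \<le> J n" "\<And>n. J n \<le> K + 2 * real n / r" for r K J L
  proof -
    define X where "X m = (2 * r) ^ m / fact m" for m
    have X0: "X m \<ge> 0" for m using r by (simp add: X_def)
    let ?\<rho> = "r powr (real N - 3/2)"
    have \<rho>: "?\<rho> > 0" using r by simp
    have bound: "sphere_weight N n * r ^ (2 * n) \<le> B' / ?\<rho> * (X (2 * n + (N - 2)) + X (Suc (2 * n) + (N - 2)))" for n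
    proof -
      let ?p = "2 * n + N - 2"
      have p: "2 * n + N - 1 = Suc ?p" "2 * n + (N - 2) = ?p" "Suc (2 * n) + (N - 2) = Suc ?p" using N by auto
      have two: "(2::real) ^ (2 * ?p + 1) \<ge> 16 ^ n"
      proof -
        have "(16::real) ^ n = 2 ^ (4 * n)" by (simp add: power_mult)
        also have "\<dots> \<le> 2 ^ (2 * ?p + 1)" using N by (intro power_increasing) auto
        finally show ?thesis .
      qed
      \<comment> \<open>The exponent \<open>N - 3/2\<close> is exactly the one that matches the
        powers of \<open>r\<close> in two consecutive terms of the exponential series.\<close>
      have rr: "r ^ (4 * n) * ?\<rho>\<^sup>2 = r ^ (2 * ?p + 1)"
      proof -
        have "?\<rho>\<^sup>2 = r powr (2 * real N - 3)" by (simp add: power2_eq_square powr_add[symmetric])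
        moreover have "r ^ (4 * n) = r powr real (4 * n)" "r ^ (2 * ?p + 1) = r powr real (2 * ?p + 1)"
          using r by (simp_all only: powr_realpow)
        moreover have "real (2 * ?p + 1) = real (4 * n) + (2 * real N - 3)" using N by (simp add: of_nat_diff)
        ultimately show ?thesis by (simp only: powr_add)
      qed
      have "(sphere_weight N n * r ^ (2 * n) * ?\<rho>)\<^sup>2 * (fact ?p * fact (Suc ?p))
         = ((sphere_weight N n)\<^sup>2 * (fact ?p * fact (Suc ?p))) * (r ^ (4 * n) * ?\<rho>\<^sup>2)"
        by (simp add: power_mult_distrib power_mult[symmetric] mult_ac)
      also have "\<dots> \<le> (B * 16 ^ n) * r ^ (2 * ?p + 1)"
        unfolding rr using B(2)[of n] r unfolding p(1) by (intro mult_right_mono) auto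
      also have "\<dots> \<le> (B * 2 ^ (2 * ?p + 1)) * r ^ (2 * ?p + 1)"
        using two B(1) r by (intro mult_right_mono mult_left_mono) auto
      also have "\<dots> = B * ((2 * r) ^ ?p * (2 * r) ^ Suc ?p)"
      proof -
        have "(2 * r) ^ ?p * (2 * r) ^ Suc ?p = (2 * r) ^ (2 * ?p + 1)"
          unfolding power_add[symmetric] by (rule arg_cong[where f="(^) (2 * r)"]) simp
        then show ?thesis by (simp only: power_mult_distrib mult.assoc)
      qed
      finally have "(sphere_weight N n * r ^ (2 * n) * ?\<rho>)\<^sup>2 \<le> B * ((2 * r) ^ ?p * (2 * r) ^ Suc ?p) / (fact ?p * fact (Suc ?p))"
        by (subst pos_le_divide_eq) (simp_all del: fact_Suc power_Suc)
      also have "\<dots> = B * (X ?p * X (Suc ?p))"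
        unfolding X_def by (simp del: fact_Suc power_Suc)
      \<comment> \<open>A geometric mean is at most the sum, and sums of consecutive terms can be
        collected into a single exponential series.\<close>
      also have "\<dots> \<le> B * (X ?p + X (Suc ?p))\<^sup>2"
      proof (rule mult_left_mono)
        show "X ?p * X (Suc ?p) \<le> (X ?p + X (Suc ?p))\<^sup>2"
          using X0[of ?p] X0[of "Suc ?p"] by (simp add: power2_sum mult_nonneg_nonneg add_nonneg_nonneg)
      qed (use B in simp)
      also have "\<dots> = (B' * (X ?p + X (Suc ?p)))\<^sup>2"
        using B(1) by (simp add: B'_def power_mult_distrib)
      finally have "sphere_weight N n * r ^ (2 * n) * ?\<rho> \<le> B' * (X ?p + X (Suc ?p))"
        by (rule power2_le_imp_le) (intro mult_nonneg_nonneg add_nonneg_nonneg X0 less_imp_le[OF B'0])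
      then have "sphere_weight N n * r ^ (2 * n) \<le> B' * (X ?p + X (Suc ?p)) / ?\<rho>"
        by (simp only: pos_le_divide_eq[OF \<rho>])
      then show ?thesis unfolding p by (simp only: times_divide_eq_left)
    qed
    let ?g = "\<lambda>m. (K + 1 / r * real m) * X m"
    have g0: "?g m \<ge> 0" for m using K r X0 by simp
    have "(\<Sum>n<L. J n * sphere_weight N n * r ^ (2 * n)) \<le>
        (\<Sum>n<L. B' / ?\<rho> * (?g (2 * n + (N - 2)) + ?g (Suc (2 * n) + (N - 2))))"
    proof (rule sum_mono)
      fix n
      have w0: "sphere_weight N n * r ^ (2 * n) \<ge> 0"
        using r sphere_weight_pos[OF N, of n] by simp
      let ?q = "2 * n + (N - 2)"
      \<comment> \<open>\<open>2 * n\<close> is at most either index in the exponential series, so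
        the slope in \<open>n\<close> becomes a slope in that index.\<close>
      have Kq: "K + 2 * real n / r \<le> K + 1 / r * real ?q" "K + 2 * real n / r \<le> K + 1 / r * real (Suc (2 * n) + (N - 2))"
        using r by (auto simp: divide_simps)
      have "J n * sphere_weight N n * r ^ (2 * n) \<le> (K + 2 * real n / r) * (sphere_weight N n * r ^ (2 * n))"
        using J(2)[of n] w0 by (simp add: mult.assoc mult_right_mono)
      also have "\<dots> \<le> (K + 2 * real n / r) * (B' / ?\<rho> * (X ?q + X (Suc (2 * n) + (N - 2))))"
        using K r by (intro mult_left_mono bound) auto
      also have "\<dots> = B' / ?\<rho> * ((K + 2 * real n / r) * X ?q + (K + 2 * real n / r) * X (Suc (2 * n) + (N - 2)))"
        by (simp only: distrib_left mult_ac)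
      also have "\<dots> \<le> B' / ?\<rho> * (?g ?q + ?g (Suc (2 * n) + (N - 2)))"
        using B'0 \<rho> X0 Kq by (intro mult_left_mono add_mono mult_right_mono) auto
      finally show "J n * sphere_weight N n * r ^ (2 * n) \<le> B' / ?\<rho> * (?g (2 * n + (N - 2)) + ?g (Suc (2 * n) + (N - 2)))" .
    qed
    also have "\<dots> = B' / ?\<rho> * (\<Sum>j<2 * L. ?g (j + (N - 2)))"
      unfolding sum_pairs sum_distrib_left ..
    \<comment> \<open>Adding the \<open>N - 2\<close> missing initial terms completes a partial sum
      of the exponential series.\<close>
    also have "(\<Sum>j<2 * L. ?g (j + (N - 2))) \<le> (\<Sum>m<2 * L + (N - 2). ?g m)"
    proof -
      have "(\<Sum>j<2 * L. ?g (j + (N - 2))) = (\<Sum>m\<in>(\<lambda>j. j + (N - 2)) ` {..<2 * L}. ?g m)"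
        by (subst sum.reindex) (auto simp: inj_on_def)
      also have "\<dots> \<le> (\<Sum>m<2 * L + (N - 2). ?g m)"
        by (rule sum_mono2) (use g0 in auto)
      finally show ?thesis .
    qed
    also have "\<dots> \<le> (K + 1 / r * (2 * r)) * exp (2 * r)"
      unfolding X_def using r K by (intro sum_power_fact_le) auto
    also have "K + 1 / r * (2 * r) = K + 2" using r by simp
    finally show ?thesis using B'0 \<rho> by (simp add: mult_left_mono divide_simps mult_ac)
  qed
  with B'0 show ?thesis by blast
qed

section \<open>Distributionally irregular zonal series\<close>

definition zonal_series :: "'n::finite \<Rightarrow> (nat \<Rightarrow> real) \<Rightarrow> real ^ 'n \<Rightarrow> real" where
  "zonal_series k a x = (\<Sum>n. a n / fact n * zonal k n x)"

lemma sphere_seminorm_le: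
  fixes u :: "real ^ 'n::finite \<Rightarrow> real"
  assumes "\<And>x. norm x = real m \<Longrightarrow> \<bar>u x\<bar> \<le> M"
  shows "sphere_seminorm m u \<le> M"
  unfolding sphere_seminorm_def
  using assms sphere_nonempty[of "SOME k. True" m] by (intro cSUP_least) auto

text \<open>Exponentially bounded coefficients form a class closed under shifts, so every iterate of
  the derivative is again a zonal series.\<close>

lemma shifted_bound:
  fixes a :: "nat \<Rightarrow> real"
  assumes "\<And>n. \<bar>a n\<bar> \<le> C * 2 ^ n"
  shows "\<bar>a (n + j)\<bar> \<le> (C * 2 ^ j) * 2 ^ n"
  using assms[of "n + j"] by (simp add: power_add mult_ac)

lemma summable_zonal_bound: "summable (\<lambda>n. C * ((6 * r) ^ n / fact n) :: real)"
  by (intro summable_mult) (use summable_exp[of "6 * r"] in \<open>simp add: divide_inverse mult.commute\<close>)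

context
  fixes k :: "'n::finite"
  assumes N: "CARD('n) \<ge> 2"
begin

lemma zonal_term_bound:
  assumes a: "\<And>n. \<bar>a n\<bar> \<le> C * 2 ^ n" and x: "norm x \<le> r"
  shows "\<bar>a n / fact n * zonal k n x\<bar> \<le> C * ((6 * r) ^ n / fact n)"
proof -
  have C: "C \<ge> 0" using a[of 0] by simp
  have "\<bar>zonal k n x\<bar> \<le> (3 * r) ^ n"
    by (rule order_trans[OF zonal_bound[OF N] power_mono]) (use x in auto)
  then have "\<bar>a n\<bar> * \<bar>zonal k n x\<bar> \<le> (C * 2 ^ n) * (3 * r) ^ n"
    using a[of n] C by (intro mult_mono) auto
  also have "\<dots> = C * (6 * r) ^ n"
    unfolding mult.assoc power_mult_distrib[symmetric] by simp
  finally show ?thesis by (simp add: abs_mult divide_right_mono)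
qed

lemma summable_zonal_series:
  assumes a: "\<And>n. \<bar>a n\<bar> \<le> C * 2 ^ n"
  shows "summable (\<lambda>n. a n / fact n * zonal k n x)"
  using zonal_term_bound[OF a order_refl]
  by (intro summable_comparison_test'[OF summable_zonal_bound[of C "norm x"], of 0]) auto

lemma zonal_series_uniform:
  assumes a: "\<And>n. \<bar>a n\<bar> \<le> C * 2 ^ n"
  shows "uniform_limit (cball 0 r) (\<lambda>L x. \<Sum>n<L. a n / fact n * zonal k n x) (zonal_series k a) sequentially"
  unfolding zonal_series_def
proof (rule Weierstrass_m_test[OF _ summable_zonal_bound[of C r]])
  show "norm (a n / fact n * zonal k n x) \<le> C * ((6 * r) ^ n / fact n)" if "x \<in> cball 0 r" for n x
    using zonal_term_bound[OF a, of x r n] that by simp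
qed

lemma zonal_sum_harmonic: "(\<lambda>x. \<Sum>n<L. c n * zonal k n x) \<in> harmonic_functions"
  by (intro harmonic_sum harmonic_cmult zonal_harmonic[OF N]) auto

lemma zonal_series_harmonic:
  assumes a: "\<And>n. \<bar>a n\<bar> \<le> C * 2 ^ n"
  shows "zonal_series k a \<in> harmonic_functions"
  by (rule harmonic_limit[OF zonal_sum_harmonic zonal_series_uniform[OF a]])

lemma zonal_series_partial:
  assumes a: "\<And>n. \<bar>a n\<bar> \<le> C * 2 ^ n"
  shows "partial k (zonal_series k a) = zonal_series k (\<lambda>n. a (n + 1))"
proof
  fix x :: "real^'n"
  let ?P = "\<lambda>L x. \<Sum>n<L. a n / fact n * zonal k n x"
  have "(\<lambda>L. partial k (?P L) x) \<longlonglongrightarrow> partial k (zonal_series k a) x"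
    by (rule tendsto_uniform_limitI[OF harmonic_limit_C1(2)[OF zonal_sum_harmonic zonal_series_uniform[OF a], where r="norm x"]]) simp
  \<comment> \<open>Differentiation kills the constant term and lowers the degrees, so the partial
    sum of length \<open>Suc L\<close> yields one of length \<open>L\<close>.\<close>
  then have "(\<lambda>L. partial k (?P (Suc L)) x) \<longlonglongrightarrow> partial k (zonal_series k a) x"
    by (rule LIMSEQ_Suc)
  moreover have "partial k (?P (Suc L)) x = (\<Sum>n<L. a (n + 1) / fact n * zonal k n x)" for L
  proof -
    have "C1_fun (\<lambda>x. a n / fact n * zonal k n x)" for n
      by (intro C1_cmult harmonicD(1)[OF zonal_harmonic[OF N]])
    then have "partial k (?P (Suc L)) x = (\<Sum>n<Suc L. partial k (\<lambda>x. a n / fact n * zonal k n x) x)"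
      using C1_sum[of "{..<Suc L}" "\<lambda>n x. a n / fact n * zonal k n x" k] by simp
    also have "\<dots> = (\<Sum>n<Suc L. a n / fact n * (real n * zonal k (n - 1) x))"
      unfolding C1_cmult(2)[OF harmonicD(1)[OF zonal_harmonic[OF N]]] zonal_partial[OF N] ..
    also have "\<dots> = (\<Sum>n<L. a (Suc n) / fact (Suc n) * (real (Suc n) * zonal k n x))"
      unfolding sum.lessThan_Suc_shift by simp
    also have "\<dots> = (\<Sum>n<L. a (n + 1) / fact n * zonal k n x)"
    proof (rule sum.cong[OF refl])
      fix n
      have "real (Suc n) / fact (Suc n) = 1 / fact n" by (simp add: fact_Suc divide_simps del: of_nat_Suc)
      then have "a (Suc n) * (real (Suc n) / fact (Suc n)) * zonal k n x = a (Suc n) * (1 / fact n) * zonal k n x"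
        by (simp only:)
      then show "a (Suc n) / fact (Suc n) * (real (Suc n) * zonal k n x) = a (n + 1) / fact n * zonal k n x"
        by (simp del: fact_Suc of_nat_Suc)
    qed
    finally show ?thesis .
  qed
  moreover have "(\<lambda>L. \<Sum>n<L. a (n + 1) / fact n * zonal k n x) \<longlonglongrightarrow> zonal_series k (\<lambda>n. a (n + 1)) x"
    using summable_LIMSEQ[OF summable_zonal_series[of "\<lambda>n. a (n + 1)" "C * 2 ^ 1", OF shifted_bound[OF a]], of x]
    by (simp add: zonal_series_def)
  ultimately show "partial k (zonal_series k a) x = zonal_series k (\<lambda>n. a (n + 1)) x"
    by (simp add: LIMSEQ_unique)
qed

lemma zonal_series_funpow_partial:
  assumes a: "\<And>n. \<bar>a n\<bar> \<le> C * 2 ^ n"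
  shows "(partial k ^^ j) (zonal_series k a) = zonal_series k (\<lambda>n. a (n + j))"
proof (induction j)
  case (Suc j)
  have "(partial k ^^ Suc j) (zonal_series k a) = partial k (zonal_series k (\<lambda>n. a (n + j)))"
    by (simp add: Suc)
  also have "\<dots> = zonal_series k (\<lambda>n. a (n + 1 + j))"
    by (rule zonal_series_partial[OF shifted_bound[OF a]])
  finally show ?case by simp
qed simp

text \<open>All zonal polynomials equal 1 at the axis point, so nonnegative coefficients cannot
  cancel there. For shifted coefficients this bounds the \<open>n\<close>-th iterate from below by
  the \<open>n\<close>-th coefficient.\<close>

lemma zonal_series_axis:
  assumes a: "\<And>n. \<bar>a n\<bar> \<le> C * 2 ^ n" and pos: "\<And>n. a n \<ge> 0"
  shows "a 0 \<le> zonal_series k a (axis k 1)"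
proof -
  have ax: "zonal k n (axis k 1) = 1" for n
    using zonal_axis[OF N, of k n 1] by simp
  have "(\<Sum>n\<in>{0}. a n / fact n * zonal k n (axis k 1)) \<le> zonal_series k a (axis k 1)"
    unfolding zonal_series_def
    by (rule sum_le_suminf[OF summable_zonal_series[OF a]]) (auto simp: ax pos)
  then show ?thesis by (simp add: ax)
qed

text \<open>Orthogonality turns the norm of a partial sum into the sum of
  \<open>weighted_sphere_sum\<close>, and Fatou's lemma passes to the series. Since \<open>K\<close>
  may depend on \<open>r\<close> and the slope \<open>2 / r\<close> is allowed, the bound remains
  usable for unbounded coefficients.\<close>

lemma zonal_series_M2:
  "\<exists>B>0. \<forall>a C r K. (\<forall>n. \<bar>a n\<bar> \<le> C * 2 ^ n) \<longrightarrow> r > 0 \<longrightarrow> K \<ge> 0 \<longrightarrow>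
     (\<forall>n. (a n)\<^sup>2 \<le> K + 2 * real n / r) \<longrightarrow>
     (M2 (zonal_series k a) r)\<^sup>2 \<le> B * (K + 2) * exp (2 * r) / r powr (real CARD('n) - 3/2)"
proof -
  define w where "w = ball_integral 1 1 (\<lambda>x::real^'n. 1) / (2 * sphere_area TYPE('n))"
  have w: "w > 0"
    unfolding w_def using sphere_area_pos[where ?'n='n] ball_integral_1_pos[of 1 1, where ?'n='n] by simp
  obtain B where B: "B > 0" "\<And>r K J L. r > 0 \<Longrightarrow> K \<ge> 0 \<Longrightarrow> (\<forall>n. 0 \<le> J n \<and> J n \<le> K + 2 * real n / r) \<Longrightarrow>
     (\<Sum>n<L. J n * sphere_weight CARD('n) n * r ^ (2 * n)) \<le> B * (K + 2) * exp (2 * r) / r powr (real CARD('n) - 3/2)"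
    using weighted_sphere_sum[OF N] by blast
  have "(M2 (zonal_series k a) r)\<^sup>2 \<le> (w * B) * (K + 2) * exp (2 * r) / r powr (real CARD('n) - 3/2)"
    if a: "\<And>n. \<bar>a n\<bar> \<le> C * 2 ^ n" and r: "r > 0" and K: "K \<ge> 0" and aK: "\<And>n. (a n)\<^sup>2 \<le> K + 2 * real n / r"
    for a C r K
  proof -
    let ?h = "zonal_series k a" and ?P = "\<lambda>L x. \<Sum>n<L. a n / fact n * zonal k n x"
    let ?b = "(w * B) * (K + 2) * exp (2 * r) / r powr (real CARD('n) - 3/2)"
    have b0: "?b \<ge> 0" using w B r K by simp
    have P: "(\<integral>\<^sup>+x. ennreal ((?P L x)\<^sup>2) \<partial>normalised_sphere_measure r) \<le> ennreal ?b" for L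
    proof -
      have [measurable]: "(\<lambda>x. ennreal ((?P L x)\<^sup>2)) \<in> borel_measurable borel"
        by (intro measurable_compose[OF _ measurable_ennreal] borel_measurable_continuous_onI continuous_intros continuous_zonal[OF N])
      have "(\<integral>\<^sup>+x. ennreal ((?P L x)\<^sup>2) \<partial>normalised_sphere_measure r) =
          (\<integral>\<^sup>+x. ennreal ((?P L (r *\<^sub>R x))\<^sup>2) \<partial>normalised_sphere_measure 1)"
        by (rule nn_integral_normalised_sphere_scale[OF _ r]) measurable
      also have "\<dots> = ennreal (LINT x|normalised_sphere_measure 1. (?P L (r *\<^sub>R x))\<^sup>2)"
        by (intro nn_integral_eq_integral integrable_normalised_sphere continuous_intros
            continuous_on_compose2[OF continuous_zonal[OF N, of UNIV]]) auto
      also have "(LINT x|normalised_sphere_measure 1. (?P L (r *\<^sub>R x))\<^sup>2) =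
          (\<Sum>n<L. (a n / fact n)\<^sup>2 * r ^ (2 * n) * (LINT x|normalised_sphere_measure 1. (zonal k n x)\<^sup>2))"
        by (rule sphere_norm_zonal_sum[OF N r])
      also have "\<dots> = (\<Sum>n<L. w * ((a n)\<^sup>2 * sphere_weight CARD('n) n * r ^ (2 * n)))"
      proof (rule sum.cong[OF refl])
        fix n
        have "(a n / fact n)\<^sup>2 * r ^ (2 * n) * (LINT x|normalised_sphere_measure 1. (zonal k n x)\<^sup>2)
           = (a n)\<^sup>2 * r ^ (2 * n) * ((LINT x|normalised_sphere_measure 1. (zonal k n x)\<^sup>2) / (fact n)\<^sup>2)"
          by (simp add: power_divide)
        also have "\<dots> = w * ((a n)\<^sup>2 * sphere_weight CARD('n) n * r ^ (2 * n))"
          unfolding sphere_zonal_norm[OF N] w_def by simp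
        finally show "(a n / fact n)\<^sup>2 * r ^ (2 * n) * (LINT x|normalised_sphere_measure 1. (zonal k n x)\<^sup>2)
           = w * ((a n)\<^sup>2 * sphere_weight CARD('n) n * r ^ (2 * n))" .
      qed
      also have "\<dots> = w * (\<Sum>n<L. (a n)\<^sup>2 * sphere_weight CARD('n) n * r ^ (2 * n))"
        by (simp add: sum_distrib_left)
      also have "ennreal \<dots> \<le> ennreal (w * (B * (K + 2) * exp (2 * r) / r powr (real CARD('n) - 3/2)))"
        using w B(2)[OF r K, of "\<lambda>n. (a n)\<^sup>2" L] aK by (intro ennreal_leI mult_left_mono) auto
      finally show ?thesis by (simp add: mult.assoc)
    qed
    have ch: "continuous_on UNIV ?h"
      by (rule harmonic_continuous[OF zonal_series_harmonic[OF a]])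
    have "ennreal ((M2 ?h r)\<^sup>2) = (\<integral>\<^sup>+x. ennreal ((?h x)\<^sup>2) \<partial>normalised_sphere_measure r)"
      by (rule M2_power2[OF ch r])
    also have "\<dots> = (\<integral>\<^sup>+x. liminf (\<lambda>L. ennreal ((?P L x)\<^sup>2)) \<partial>normalised_sphere_measure r)"
    proof (rule nn_integral_cong)
      fix x :: "real^'n"
      have "(\<lambda>L. ennreal ((?P L x)\<^sup>2)) \<longlonglongrightarrow> ennreal ((?h x)\<^sup>2)"
        unfolding zonal_series_def
        by (intro tendsto_ennrealI tendsto_power summable_LIMSEQ summable_zonal_series[OF a])
      then show "ennreal ((?h x)\<^sup>2) = liminf (\<lambda>L. ennreal ((?P L x)\<^sup>2))"
        by (rule lim_imp_Liminf[symmetric, rotated]) simp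
    qed
    also have "\<dots> \<le> liminf (\<lambda>L. \<integral>\<^sup>+x. ennreal ((?P L x)\<^sup>2) \<partial>normalised_sphere_measure r)"
      by (intro nn_integral_liminf measurable_normalised_sphere measurable_compose[OF _ measurable_ennreal]
          borel_measurable_continuous_onI continuous_intros continuous_zonal[OF N])
    also have "\<dots> \<le> limsup (\<lambda>L. \<integral>\<^sup>+x. ennreal ((?P L x)\<^sup>2) \<partial>normalised_sphere_measure r)"
      by (rule Liminf_le_Limsup) simp
    also have "\<dots> \<le> ennreal ?b"
      by (rule Limsup_bounded) (use P in auto)
    finally show ?thesis using b0 by (simp only: ennreal_le_iff)
  qed
  moreover have "w * B > 0" using w B by simp
  ultimately show ?thesis by blast
qed

end

text \<open>\<open>J\<close> counts the terms of a sufficiently sparse sequence, so that its values beyond \<open>Suc K\<close> are paid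
  for by the linear term as long as \<open>r\<close> stays below the next threshold.\<close>

lemma slow_counting_function:
  fixes R :: "nat \<Rightarrow> real"
  shows "\<exists>J::nat \<Rightarrow> nat. (\<forall>m. J m \<le> m) \<and> filterlim J at_top sequentially \<and>
     (\<forall>\<^sub>F r in at_top. \<exists>K. R K \<le> r \<and> (\<forall>m. real (J m) \<le> real (Suc K) + 2 * real m / r))"
proof -
  \<comment> \<open>A nondecreasing, unbounded majorant of the thresholds \<open>R\<close>, which
    need not be monotone.\<close>
  define \<rho> where "\<rho> j = real j + 1 + (\<Sum>i\<le>j. \<bar>R i\<bar>)" for j
  have \<rho>R: "R j \<le> \<rho> j" for j
  proof -
    have "\<bar>R j\<bar> \<le> (\<Sum>i\<le>j. \<bar>R i\<bar>)" by (rule member_le_sum) auto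
    then show ?thesis by (simp add: \<rho>_def)
  qed
  have \<rho>mono: "\<rho> i \<le> \<rho> j" if "i \<le> j" for i j
    unfolding \<rho>_def using that by (intro add_mono sum_mono2) auto
  have \<rho>1: "\<rho> j \<ge> real j + 1" for j by (simp add: \<rho>_def sum_nonneg)
  \<comment> \<open>The \<open>j\<close>-th increment of \<open>J\<close> waits until
    \<open>2 ^ j * \<rho> j\<close>, so that at any radius \<open>r \<le> \<rho> j\<close> it is
    paid for by \<open>real m / r * (1/2) ^ j\<close>; these prices add up to at most
    \<open>2 * real m / r\<close>.\<close>
  define p where "p j = nat \<lceil>2 ^ j * \<rho> j\<rceil>" for j
  have p: "real (p j) \<ge> 2 ^ j * \<rho> j" for j
    unfolding p_def by (rule real_nat_ceiling_ge)
  have pj: "j < p j" for j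
  proof -
    have "real j + 1 \<le> 1 * \<rho> j" using \<rho>1 by simp
    also have "\<dots> \<le> 2 ^ j * \<rho> j" using \<rho>1[of j] by (intro mult_right_mono) auto
    also have "\<dots> \<le> real (p j)" by (rule p)
    finally show ?thesis by simp
  qed
  define T where "T m = {j. p j \<le> m}" for m
  have Tsub: "T m \<subseteq> {..<m}" for m
    using pj by (force simp: T_def dest: less_le_trans)
  then have Tfin: "finite (T m)" for m by (meson finite_lessThan finite_subset)
  define J where "J m = card (T m)" for m
  have "J m \<le> m" for m
    unfolding J_def using card_mono[OF _ Tsub[of m]] by simp
  moreover have "filterlim J at_top sequentially"
    unfolding filterlim_at_top
  proof
    fix Z :: nat
    show "\<forall>\<^sub>F m in sequentially. Z \<le> J m"
      unfolding eventually_sequentially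
    proof (intro exI allI impI)
      fix m assume m: "(\<Sum>j<Z. p j) \<le> m"
      have "{..<Z} \<subseteq> T m"
      proof
        fix j assume "j \<in> {..<Z}"
        then have "p j \<le> (\<Sum>j<Z. p j)" by (intro member_le_sum) auto
        then show "j \<in> T m" using m by (simp add: T_def)
      qed
      from card_mono[OF Tfin this] show "Z \<le> J m" by (simp add: J_def)
    qed
  qed
  moreover have "\<forall>\<^sub>F r in at_top. \<exists>K. R K \<le> r \<and> (\<forall>m. real (J m) \<le> real (Suc K) + 2 * real m / r)"
    unfolding eventually_at_top_dense
  proof (rule exI[of _ "\<rho> 0"], intro allI impI)
    fix r :: real assume r: "\<rho> 0 < r"
    have r0: "r > 0" using r \<rho>1[of 0] by simp
    have ex: "\<exists>j. r \<le> \<rho> j"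
    proof -
      obtain j :: nat where "r \<le> real j" using real_arch_simple by blast
      then have "r \<le> \<rho> j" using \<rho>1[of j] by simp
      then show ?thesis ..
    qed
    \<comment> \<open>\<open>Suc K\<close> will be the first index whose threshold reaches
      \<open>r\<close>: the threshold of \<open>K\<close> lies below \<open>r\<close>, which gives
      \<open>R K \<le> r\<close>, and every \<open>j\<close> from \<open>Suc K\<close> on satisfies
      \<open>r \<le> \<rho> j\<close>.\<close>
    define K' where "K' = (LEAST j. r \<le> \<rho> j)"
    have K': "r \<le> \<rho> K'" unfolding K'_def using ex by (rule LeastI_ex)
    have "K' \<noteq> 0" using K' r by (intro notI) simp
    then obtain K where K: "K' = Suc K" by (cases K') auto
    have "\<not> r \<le> \<rho> K" using not_less_Least[of K "\<lambda>j. r \<le> \<rho> j"] K unfolding K'_def by simp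
    then have "R K \<le> r" using \<rho>R[of K] by simp
    moreover have "real (J m) \<le> real (Suc K) + 2 * real m / r" for m
    proof -
      let ?U = "{j \<in> T m. Suc K \<le> j}"
      have "T m \<subseteq> {..<Suc K} \<union> ?U" by auto
      then have "J m \<le> card ({..<Suc K} \<union> ?U)"
        unfolding J_def using Tfin[of m] by (intro card_mono) auto
      also have "\<dots> \<le> Suc K + card ?U" using card_Un_le[of "{..<Suc K}" ?U] by simp
      finally have 1: "real (J m) \<le> real (Suc K) + real (card ?U)" by simp
      have "real (card ?U) = (\<Sum>j\<in>?U. 1)" by simp
      also have "\<dots> \<le> (\<Sum>j\<in>?U. real m / r * (1/2) ^ j)"
      proof (rule sum_mono)
        fix j assume j: "j \<in> ?U"
        have "2 ^ j * r \<le> 2 ^ j * \<rho> j" using K' \<rho>mono[of K' j] j K by simp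
        also have "\<dots> \<le> real (p j)" by (rule p)
        also have "\<dots> \<le> real m" using j by (simp add: T_def)
        finally show "1 \<le> real m / r * (1/2) ^ j"
          using r0 by (simp add: power_one_over field_simps)
      qed
      also have "\<dots> = real m / r * (\<Sum>j\<in>?U. (1/2) ^ j)" by (simp add: sum_distrib_left)
      also have "\<dots> \<le> real m / r * 2"
      proof (rule mult_left_mono)
        have "(\<Sum>j\<in>?U. (1/2::real) ^ j) \<le> (\<Sum>j. (1/2) ^ j)"
          using Tfin[of m] by (intro sum_le_suminf summable_geometric) auto
        then show "(\<Sum>j\<in>?U. (1/2::real) ^ j) \<le> 2" using suminf_geometric[of "1/2::real"] by simp
      qed (use r0 in simp)
      finally show ?thesis using 1 by (simp add: mult.commute)
    qed
    ultimately show "\<exists>K. R K \<le> r \<and> (\<forall>m. real (J m) \<le> real (Suc K) + 2 * real m / r)" by blast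
  qed
  ultimately show ?thesis by blast
qed

section \<open>Factorial blocks of upper density one\<close>

lemma upper_density_eq_1I:
  assumes "\<And>e K0. e > 0 \<Longrightarrow> \<exists>K\<ge>K0. K \<ge> 1 \<and> real (card (B \<inter> {1..K})) \<ge> (1 - e) * real K"
  shows "upper_density B = 1"
proof (rule antisym)
  show "upper_density B \<le> 1"
    unfolding upper_density_def
  proof (rule Limsup_bounded, rule always_eventually, rule allI)
    fix n
    have "card (B \<inter> {1..n}) \<le> card {1..n}" by (rule card_mono) auto
    then have "real (card (B \<inter> {1..n})) / real n \<le> 1" by (cases "n = 0") auto
    then show "ereal (real (card (B \<inter> {1..n})) / real n) \<le> 1" by (simp add: one_ereal_def)
  qed
  show "1 \<le> upper_density B"
  proof (rule ccontr)
    assume "\<not> 1 \<le> upper_density B"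
    then have "upper_density B < ereal 1" by (simp add: one_ereal_def not_le)
    then obtain d where d: "upper_density B < ereal d" "d < 1"
      using ereal_dense2[of "upper_density B" "ereal 1"] by auto
    have "\<forall>\<^sub>F n in sequentially. ereal (real (card (B \<inter> {1..n})) / real n) < ereal d"
      using d(1) unfolding upper_density_def by (rule Limsup_lessD)
    then obtain K0 where K0: "\<And>n. n \<ge> K0 \<Longrightarrow> real (card (B \<inter> {1..n})) / real n < d"
      unfolding eventually_sequentially by auto
    obtain K where K: "K \<ge> K0" "K \<ge> 1" "real (card (B \<inter> {1..K})) \<ge> (1 - (1 - d)) * real K"
      using assms[of "1 - d" K0] d(2) by auto
    then show False using K0[OF K(1)] by (simp add: field_simps)
  qed
qed

text \<open>Ratios of consecutive factorials tend to infinity, so each block fills almost the whole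
  initial segment up to its right end, whatever came before. Alternating blocks can therefore both
  reach upper density 1.\<close>

definition active_block :: "nat set" where
  "active_block = {n. \<exists>i. fact (2 * i) \<le> n \<and> n < fact (2 * i + 1)}"

text \<open>The gaps between active blocks, shortened on the right by
  \<open>fact (2 * i + 1)\<close>: the \<open>n\<close>-th iterate starts at coefficient
  \<open>n\<close>, and its first \<open>fact (2 * i + 1)\<close> coefficients have to vanish as
  well. The loss is negligible against \<open>fact (2 * i + 2)\<close>.\<close>

definition silent_block :: "nat set" where
  "silent_block = {n. \<exists>i. fact (2 * i + 1) \<le> n \<and> n + fact (2 * i + 1) < fact (2 * i + 2)}"

lemma silent_not_active:
  assumes "fact (2 * i + 1) \<le> m" "m < fact (2 * i + 2)"
  shows "m \<notin> active_block"
proof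
  assume "m \<in> active_block"
  then obtain j where j: "fact (2 * j) \<le> m" "m < fact (2 * j + 1)" by (auto simp: active_block_def)
  have lt: "a < b" if "(fact a :: nat) < fact b" for a b
    using that fact_mono_nat[of b a] by (meson not_le)
  have "2 * j < 2 * i + 2" by (rule lt) (rule le_less_trans[OF j(1) assms(2)])
  moreover have "2 * i + 1 < 2 * j + 1" by (rule lt) (rule le_less_trans[OF assms(1) j(2)])
  ultimately show False by presburger
qed

lemma upper_density_active: "upper_density active_block = 1"
proof (rule upper_density_eq_1I)
  fix e :: real and K0 :: nat assume e: "e > 0"
  obtain i0 :: nat where i0: "1 / e \<le> real i0" using real_arch_simple by blast
  define i where "i = max (max i0 K0) 1"
  have ie: "1 \<le> e * real i" "i \<ge> K0" "i \<ge> 1"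
  proof -
    have "1 / e \<le> real i" using i0 by (simp add: i_def)
    then show "1 \<le> e * real i" using e by (simp add: field_simps)
  qed (auto simp: i_def)
  let ?K = "fact (2 * i + 1) :: nat" and ?L = "fact (2 * i) :: nat"
  have KL: "?K = (2 * i + 1) * ?L" by simp
  have L1: "?L \<ge> 1" by (simp add: fact_ge_1)
  have "card {?L..<?K} \<le> card (active_block \<inter> {1..?K})"
  proof (intro card_mono subsetI)
    fix x assume x: "x \<in> {?L..<?K}"
    then have "1 \<le> x" using L1 by (meson atLeastLessThan_iff order_trans)
    with x show "x \<in> active_block \<inter> {1..?K}"
      unfolding active_block_def by (auto simp del: fact_Suc simp: less_imp_le)
  qed simp
  then have "?K - ?L \<le> card (active_block \<inter> {1..?K})" by (simp only: card_atLeastLessThan)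
  then have "real ?K - real ?L \<le> real (card (active_block \<inter> {1..?K}))" by linarith
  moreover have "real ?L \<le> e * real ?K"
  proof -
    have "1 * real ?L \<le> (e * real (2 * i + 1)) * real ?L"
      using ie e by (intro mult_right_mono) (auto simp: distrib_left intro: order_trans[OF ie(1)])
    then show ?thesis unfolding KL by (simp only: of_nat_mult mult.assoc mult_1)
  qed
  ultimately have "(1 - e) * real ?K \<le> real (card (active_block \<inter> {1..?K}))" by (simp add: left_diff_distrib)
  moreover have "?K \<ge> K0" using fact_ge_self[of "2 * i + 1"] ie(2) by linarith
  moreover have "?K \<ge> 1" by (rule fact_ge_1)
  ultimately show "\<exists>K\<ge>K0. K \<ge> 1 \<and> (1 - e) * real K \<le> real (card (active_block \<inter> {1..K}))" by blast
qed

lemma upper_density_silent: "upper_density silent_block = 1"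
proof (rule upper_density_eq_1I)
  fix e :: real and K0 :: nat assume e: "e > 0"
  obtain i0 :: nat where i0: "1 / e \<le> real i0" using real_arch_simple by blast
  define i where "i = max (max i0 K0) 1"
  have ie: "1 \<le> e * real i" "i \<ge> K0" "i \<ge> 1"
  proof -
    have "1 / e \<le> real i" using i0 by (simp add: i_def)
    then show "1 \<le> e * real i" using e by (simp add: field_simps)
  qed (auto simp: i_def)
  let ?K = "fact (2 * i + 2) :: nat" and ?L = "fact (2 * i + 1) :: nat"
  have KL: "?K = (2 * i + 2) * ?L" by simp
  have L1: "?L \<ge> 1" by (rule fact_ge_1)
  have "card {?L..<?K - ?L} \<le> card (silent_block \<inter> {1..?K})"
  proof (intro card_mono subsetI)
    fix x assume x: "x \<in> {?L..<?K - ?L}"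
    then have "1 \<le> x" using L1 by (meson atLeastLessThan_iff order_trans)
    moreover have "?L \<le> x" "x + ?L < ?K" using x by auto
    ultimately show "x \<in> silent_block \<inter> {1..?K}"
      unfolding silent_block_def by (simp del: fact_Suc) blast
  qed simp
  then have "?K - ?L - ?L \<le> card (silent_block \<inter> {1..?K})" by (simp only: card_atLeastLessThan)
  then have "real ?K - 2 * real ?L \<le> real (card (silent_block \<inter> {1..?K}))" by linarith
  moreover have "2 * real ?L \<le> e * real ?K"
  proof -
    have "2 * real ?L \<le> (e * real (2 * i + 2)) * real ?L"
      using ie e by (intro mult_right_mono) (auto simp: distrib_left)
    then show ?thesis unfolding KL by (simp only: of_nat_mult mult.assoc)
  qed
  ultimately have "(1 - e) * real ?K \<le> real (card (silent_block \<inter> {1..?K}))" by (simp add: left_diff_distrib del: fact_Suc)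
  moreover have "?K \<ge> K0" using fact_ge_self[of "2 * i + 2"] ie(2) by linarith
  moreover have "?K \<ge> 1" by (rule fact_ge_1)
  ultimately show "\<exists>K\<ge>K0. K \<ge> 1 \<and> (1 - e) * real K \<le> real (card (silent_block \<inter> {1..K}))" by blast
qed

text \<open>For a silent \<open>n\<close> only degrees from \<open>g = fact (2 * i + 1)\<close> on
  survive in the iterate, and the coefficients there grow at most quadratically in the degree, so
  the tail of one fixed series controls it on each sphere. For an active \<open>n\<close> the value
  at the axis point is at least \<open>sqrt (real (J n))\<close>.\<close>

lemma zonal_series_irregular:
  fixes k :: "'n::finite" and J :: "nat \<Rightarrow> nat"
  assumes N: "CARD('n) \<ge> 2" and Jle: "\<And>m. J m \<le> m" and Jlim: "filterlim J at_top sequentially"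
  defines "a \<equiv> \<lambda>n. if n \<in> active_block then sqrt (real (J n)) else 0"
  shows "distributionally_irregular sphere_seminorm (partial k) (zonal_series k a)"
    and "\<And>n. \<bar>a n\<bar> \<le> 1 * 2 ^ n"
proof -
  have a0: "a n \<ge> 0" for n by (simp add: a_def)
  have an: "a n \<le> real n" for n
  proof -
    have "sqrt (real (J n)) \<le> sqrt ((real n)\<^sup>2)"
    proof (rule real_sqrt_le_mono)
      have "J n \<le> n * n" using Jle[of n] by (cases n) (auto intro: order_trans)
      then show "real (J n) \<le> (real n)\<^sup>2" by (metis of_nat_le_iff of_nat_mult power2_eq_square)
    qed
    then show ?thesis by (simp add: a_def)
  qed
  have n2: "real n \<le> 2 ^ n" for n using of_nat_less_two_power[of n, where ?'a=real] by simp
  show a2: "\<bar>a n\<bar> \<le> 1 * 2 ^ n" for n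
    using order_trans[OF an[of n] n2[of n]] a0[of n] by simp
  let ?h = "zonal_series k a"
  note D = zonal_series_funpow_partial[OF N a2, where k=k]
  note cD = harmonic_continuous[OF harmonic_funpow_partial[OF zonal_series_harmonic[OF N a2]]]
  have silent: "((\<lambda>n. sphere_seminorm m ((partial k ^^ n) ?h)) \<longlongrightarrow> 0) (inf sequentially (principal silent_block))" for m
  proof (rule tendstoI)
    fix e :: real assume e: "e > 0"
    \<comment> \<open>One dominating series for all silent iterates: 12 is 4 from the coefficient
      bound \<open>big\<close> times 3 from \<open>zonal_bound\<close>.\<close>
    define t where "t j = 2 * ((12 * real m) ^ j / fact j)" for j
    have t0: "t j \<ge> 0" for j by (simp add: t_def)
    have st: "summable t"
      unfolding t_def using summable_zonal_bound[of 2 "2 * real m"] by simp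
    obtain G where G: "\<And>g. g \<ge> G \<Longrightarrow> norm (\<Sum>j. t (j + g)) < e"
      using suminf_exist_split[OF e st] by blast
    have "sphere_seminorm m ((partial k ^^ n) ?h) < e \<and> 0 \<le> sphere_seminorm m ((partial k ^^ n) ?h)"
      if n: "n \<ge> fact (2 * G + 2)" "n \<in> silent_block" for n
    proof -
      obtain i where i: "fact (2 * i + 1) \<le> n" "n + fact (2 * i + 1) < fact (2 * i + 2)"
        using n(2) by (auto simp: silent_block_def)
      have "G < i"
      proof (rule ccontr)
        assume "\<not> G < i"
        then have "(fact (2 * i + 2) :: nat) \<le> fact (2 * G + 2)" by (intro fact_mono_nat) simp
        with i(2) n(1) show False by linarith
      qed
      define g where "g = (fact (2 * i + 1) :: nat)"
      have gi: "2 * i + 1 \<le> g" unfolding g_def by (rule fact_ge_self)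
      have "g \<ge> G" using gi \<open>G < i\<close> by linarith
      \<comment> \<open>This requires \<open>i \<ge> 1\<close>, which \<open>G < i\<close> supplies;
        the aim is \<open>n < g * g\<close>.\<close>
      have ig: "2 * i + 2 \<le> g"
      proof -
        have "(2 * i + 1) * 2 \<le> (2 * i + 1) * fact (2 * i)"
          using fact_ge_self[of "2 * i"] \<open>G < i\<close> by (intro mult_left_mono) linarith+
        also have "\<dots> = g" by (simp add: g_def)
        finally show ?thesis by presburger
      qed
      have "n < (2 * i + 2) * g"
        using i(2) by (simp add: g_def)
      also have "\<dots> \<le> g * g" using ig by (rule mult_right_mono) simp
      finally have ng: "n < g * g" .
      have zero: "a (j + n) = 0" if "j < g" for j
      proof -
        have "j + n \<notin> active_block"
          by (rule silent_not_active[of i]) (use i that in \<open>auto simp: g_def simp del: fact_Suc\<close>)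
        then show ?thesis by (simp add: a_def)
      qed
      \<comment> \<open>For \<open>j \<ge> g\<close> the index \<open>n\<close> is below
        \<open>j * j\<close>, so the bound on the shifted coefficient no longer involves
        \<open>n\<close>.\<close>
      have big: "\<bar>a (j + n)\<bar> \<le> 2 * 4 ^ j" if "g \<le> j" for j
      proof -
        have "j + n \<le> j + j * j" using ng mult_le_mono[OF that that] by linarith
        then have "real (j + n) \<le> real j + real j * real j" by (metis of_nat_add of_nat_le_iff of_nat_mult)
        also have "\<dots> \<le> 4 ^ j + 2 ^ j * 2 ^ j"
        proof (rule add_mono)
          have "(2::real) ^ j \<le> 4 ^ j" by (rule power_mono) auto
          then show "real j \<le> 4 ^ j" using n2[of j] by linarith
          show "real j * real j \<le> 2 ^ j * 2 ^ j" using n2[of j] by (intro mult_mono) auto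
        qed
        also have "\<dots> = 2 * 4 ^ j" by (simp add: power_mult_distrib[symmetric])
        finally show ?thesis using an[of "j + n"] a0[of "j + n"] by simp
      qed
      have "\<bar>(partial k ^^ n) ?h x\<bar> \<le> (\<Sum>j. t (j + g))" if x: "norm x = real m" for x
      proof -
        let ?f = "\<lambda>j. a (j + n) / fact j * zonal k j x"
        have sf: "summable ?f"
          by (rule summable_zonal_series[OF N shifted_bound[OF a2]])
        have "(partial k ^^ n) ?h x = (\<Sum>j. ?f j)"
          unfolding D zonal_series_def ..
        also have "\<dots> = (\<Sum>j. ?f (j + g)) + (\<Sum>j<g. ?f j)"
          by (rule suminf_split_initial_segment[OF sf])
        also have "(\<Sum>j<g. ?f j) = 0" using zero by simp
        finally have eq: "(partial k ^^ n) ?h x = (\<Sum>j. ?f (j + g))" by simp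
        have ft: "norm (?f (j + g)) \<le> t (j + g)" for j
        proof -
          let ?j = "j + g"
          have "\<bar>a (?j + n)\<bar> * \<bar>zonal k ?j x\<bar> \<le> (2 * 4 ^ ?j) * (3 * real m) ^ ?j"
            using big[of ?j] zonal_bound[OF N, of k ?j x] x by (intro mult_mono) auto
          also have "\<dots> = 2 * (12 * real m) ^ ?j"
            by (simp only: power_mult_distrib[symmetric] mult.assoc) simp
          finally show ?thesis by (simp add: t_def abs_mult divide_right_mono)
        qed
        have stg: "summable (\<lambda>j. t (j + g))" using st by (simp add: summable_iff_shift)
        show ?thesis
          unfolding eq using norm_suminf_le[OF ft stg] by simp
      qed
      then have "sphere_seminorm m ((partial k ^^ n) ?h) \<le> (\<Sum>j. t (j + g))"
        by (rule sphere_seminorm_le)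
      also have "\<dots> < e" using G[OF \<open>g \<ge> G\<close>] by simp
      finally have "sphere_seminorm m ((partial k ^^ n) ?h) < e" .
      moreover have "0 \<le> sphere_seminorm m ((partial k ^^ n) ?h)"
        using order_trans[OF abs_ge_zero abs_le_sphere_seminorm[OF cD]] sphere_nonempty[of k m] by simp
      ultimately show ?thesis by blast
    qed
    then show "\<forall>\<^sub>F n in inf sequentially (principal silent_block). dist (sphere_seminorm m ((partial k ^^ n) ?h)) 0 < e"
      unfolding eventually_inf_principal eventually_sequentially
      by (intro exI[of _ "fact (2 * G + 2)"]) (auto simp: dist_real_def simp del: fact_Suc)
  qed
  have active: "filterlim (\<lambda>n. sphere_seminorm 1 ((partial k ^^ n) ?h)) at_top (inf sequentially (principal active_block))"
    unfolding filterlim_at_top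
  proof
    fix Z :: real
    have "\<forall>\<^sub>F n in sequentially. nat \<lceil>Z\<^sup>2\<rceil> \<le> J n"
      using Jlim unfolding filterlim_at_top by blast
    then obtain n0 where n0: "\<And>n. n \<ge> n0 \<Longrightarrow> nat \<lceil>Z\<^sup>2\<rceil> \<le> J n" unfolding eventually_sequentially by blast
    have "Z \<le> sphere_seminorm 1 ((partial k ^^ n) ?h)" if n: "n \<ge> n0" "n \<in> active_block" for n
    proof -
      have "Z\<^sup>2 \<le> real (nat \<lceil>Z\<^sup>2\<rceil>)" by (rule real_nat_ceiling_ge)
      also have "\<dots> \<le> real (J n)" using n0[OF n(1)] by (simp only: of_nat_le_iff)
      finally have "\<bar>Z\<bar> \<le> sqrt (real (J n))"
        by (rule real_le_rsqrt[of "\<bar>Z\<bar>", simplified])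
      also have "\<dots> = a (0 + n)" using n(2) by (simp add: a_def)
      also have "\<dots> \<le> zonal_series k (\<lambda>j. a (j + n)) (axis k 1)"
        by (rule zonal_series_axis[OF N shifted_bound[OF a2] a0])
      also have "\<dots> \<le> \<bar>(partial k ^^ n) ?h (axis k 1)\<bar>" unfolding D by (rule abs_ge_self)
      also have "\<dots> \<le> sphere_seminorm 1 ((partial k ^^ n) ?h)"
        by (rule abs_le_sphere_seminorm[OF cD]) simp
      finally show ?thesis by simp
    qed
    then show "\<forall>\<^sub>F n in inf sequentially (principal active_block). Z \<le> sphere_seminorm 1 ((partial k ^^ n) ?h)"
      unfolding eventually_inf_principal eventually_sequentially by blast
  qed
  show "distributionally_irregular sphere_seminorm (partial k) ?h"
    unfolding distributionally_irregular_def
    using silent active upper_density_silent upper_density_active by blast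
qed

lemma exists_irregular_with_growth:
  fixes k :: "'n::finite" and \<phi> :: "real \<Rightarrow> real"
  assumes N: "CARD('n) \<ge> 2" and pos: "\<And>r. r \<ge> 0 \<Longrightarrow> \<phi> r \<ge> 0" and lim: "filterlim \<phi> at_top at_top"
  shows "\<exists>h :: real ^ 'n \<Rightarrow> real. h \<in> harmonic_functions \<and>
           distributionally_irregular sphere_seminorm (partial k) h \<and>
           (\<forall>\<^sub>F r in at_top. M2 h r \<le> \<phi> r * (exp r / r powr (real CARD('n) / 2 - 3 / 4)))"
proof -
  obtain B where B: "B > 0" "\<And>a C r K. (\<forall>n. \<bar>a n\<bar> \<le> C * 2 ^ n) \<Longrightarrow> r > 0 \<Longrightarrow> K \<ge> 0 \<Longrightarrow>
     (\<forall>n. (a n)\<^sup>2 \<le> K + 2 * real n / r) \<Longrightarrow>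
     (M2 (zonal_series k a) r)\<^sup>2 \<le> B * (K + 2) * exp (2 * r) / r powr (real CARD('n) - 3/2)"
    using zonal_series_M2[OF N, of k] by blast
  \<comment> \<open>From the radius \<open>R K\<close> on, \<phi> stays above the constant that
    \<open>zonal_series_M2\<close> yields for the coefficient bound \<open>Suc K\<close>; these
    thresholds dictate how slowly \<open>J\<close> has to grow.\<close>
  have "\<exists>R. \<forall>r\<ge>R. sqrt (B * (real (Suc K) + 2)) \<le> \<phi> r" for K :: nat
    using lim unfolding filterlim_at_top eventually_at_top_linorder by blast
  then obtain R where R: "\<And>K r. r \<ge> R K \<Longrightarrow> sqrt (B * (real (Suc K) + 2)) \<le> \<phi> r" by metis
  obtain J :: "nat \<Rightarrow> nat" where J: "\<And>m. J m \<le> m" "filterlim J at_top sequentially"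
    "\<forall>\<^sub>F r in at_top. \<exists>K. R K \<le> r \<and> (\<forall>m. real (J m) \<le> real (Suc K) + 2 * real m / r)"
    using slow_counting_function[of R] by blast
  define a where "a = (\<lambda>n. if n \<in> active_block then sqrt (real (J n)) else 0)"
  let ?h = "zonal_series k a"
  have a2: "\<bar>a n\<bar> \<le> 1 * 2 ^ n" for n
    unfolding a_def by (rule zonal_series_irregular(2)[OF N J(1,2)])
  have "?h \<in> harmonic_functions" by (rule zonal_series_harmonic[OF N a2])
  moreover have "distributionally_irregular sphere_seminorm (partial k) ?h"
    unfolding a_def by (rule zonal_series_irregular(1)[OF N J(1,2)])
  moreover have "\<forall>\<^sub>F r in at_top. M2 ?h r \<le> \<phi> r * (exp r / r powr (real CARD('n) / 2 - 3 / 4))"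
    using J(3) eventually_gt_at_top[of 0]
  proof eventually_elim
    case (elim r)
    then obtain K where K: "R K \<le> r" "\<And>m. real (J m) \<le> real (Suc K) + 2 * real m / r" by blast
    have aK: "(a n)\<^sup>2 \<le> real (Suc K) + 2 * real n / r" for n
      using K(2)[of n] \<open>0 < r\<close> by (auto simp: a_def)
    have "(M2 ?h r)\<^sup>2 \<le> B * (real (Suc K) + 2) * exp (2 * r) / r powr (real CARD('n) - 3/2)"
      using a2 aK \<open>0 < r\<close> by (intro B(2)[of a 1]) auto
    also have "\<dots> = (sqrt (B * (real (Suc K) + 2)) * (exp r / r powr (real CARD('n) / 2 - 3 / 4)))\<^sup>2"
    proof -
      have "(r powr (real CARD('n) / 2 - 3 / 4))\<^sup>2 = r powr (real CARD('n) - 3 / 2)"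
        by (simp add: power2_eq_square powr_add[symmetric])
      then show ?thesis using B(1) by (simp add: power_mult_distrib power_divide exp_double)
    qed
    finally have "M2 ?h r \<le> sqrt (B * (real (Suc K) + 2)) * (exp r / r powr (real CARD('n) / 2 - 3 / 4))"
      by (rule power2_le_imp_le) (use B(1) in simp)
    also have "\<dots> \<le> \<phi> r * (exp r / r powr (real CARD('n) / 2 - 3 / 4))"
      by (rule mult_right_mono[OF R[OF K(1)]]) simp
    finally show ?case .
  qed
  ultimately show ?thesis by blast
qed

theorem theorem4p4:
  fixes k :: "'n::finite"
  assumes "CARD('n) \<ge> 2"
  shows
    "(\<forall>\<phi>::real \<Rightarrow> real.
        (\<forall>r\<ge>0. \<phi> r \<ge> 0) \<longrightarrow> filterlim \<phi> at_top at_top \<longrightarrow>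
        (\<exists>h :: real ^ 'n \<Rightarrow> real. h \<in> harmonic_functions \<and>
           distributionally_irregular sphere_seminorm (partial k) h \<and>
           (\<forall>\<^sub>F r in at_top.
              M2 h r \<le> \<phi> r * (exp r / r powr (real CARD('n) / 2 - 3 / 4))))) \<and>
     \<not> (\<exists>h :: real ^ 'n \<Rightarrow> real. h \<in> harmonic_functions \<and>
           distributionally_irregular sphere_seminorm (partial k) h \<and>
           (\<exists>c>0. \<forall>\<^sub>F r in at_top.
              M2 h r \<le> c * (exp r / r powr (real CARD('n) / 2 - 3 / 4))))"
  using exists_irregular_with_growth[OF assms] not_distributionally_irregular[OF assms] by blast

end
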